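(* Let $(M_1,\nabla_1,b_1)$ and $(M_2,\nabla_2,b_2)$ be affine Banach manifolds with base points, and assume that the torsion and curvature tensors $\mathrm{Tor}_1,R_1$ of $M_1$ and $\mathrm{Tor}_2,R_2$ of $M_2$ are parallel on certain neighborhoods of $b_1$ and $b_2$, respectively. For every continuous linear map $A\colon T_{b_1}M_1\to T_{b_2}M_2$ that intertwines the torsion and curvature tensors in the base points in the sense that $$A\circ(\mathrm{Tor}_1)_{b_1}=(\mathrm{Tor}_2)_{b_2}\circ A^2\quad\text{and}\quad A\circ(R_1)_{b_1}=(R_2)_{b_2}\circ A^3,$$ there exists an affine map $f$ from an open neighborhood of $b_1$ into $M_2$ that satisfies $T_{b_1}f=A$.
   Context: Manifolds are smooth Banach manifolds. An affine connection on $TM$ is a fiber bundle morphism $B\colon TM\oplus TM\to TTM$ over $M$, bilinear on each $T_xM\oplus T_xM$, with $(\pi_{TM},T\pi)\circ B=\mathrm{id}$, where $\pi\colon TM\to M$ and $\pi_{TM}\colon TTM\to TM$ are the natural projections; in a chart $\varphi\colon U\to V\subseteq E$ it has the form $(x,v,w)\mapsto(x,v,w,B^\varphi_x(v,w))$ with a smooth map $B^\varphi\colon V\to\mathcal L^2(E,E)$ into the continuous bilinear maps. It corresponds to the covariant derivative $\nabla$ given locally by $(\nabla_\xi\eta)^\varphi(x)=d\eta^\varphi(x)(\xi^\varphi(x))-B^\varphi_x(\eta^\varphi(x),\xi^\varphi(x))$; $(M,\nabla)=(M,B)$ is called an affine Banach manifold. A smooth map $f\colon M_1\to M_2$ is affine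 if $TTf\circ B_1=B_2\circ(Tf\oplus Tf)$, i.e., in charts $d^2f(x)(v,w)+df(x)((B_1)_x(v,w))=(B_2)_{f(x)}(df(x)v,df(x)w)$. Torsion and curvature are the tensor fields with $\mathrm{Tor}(\xi,\eta)=\nabla_\xi\eta-\nabla_\eta\xi-[\xi,\eta]$ and $R(\xi,\eta,\zeta)=\nabla_\xi\nabla_\eta\zeta-\nabla_\eta\nabla_\xi\zeta-\nabla_{[\xi,\eta]}\zeta$ for local smooth vector fields. A tensor field $\omega$ whose values $\omega_x$ are continuous $n$-linear maps $(T_xM)^n\to T_xM$ is parallel on an open set $U$ if $\nabla_v\omega=0$ for all $v\in TU$, where $(\nabla_\xi\omega)(\eta_1,\dots,\eta_n)=\nabla_\xi(\omega(\eta_1,\dots,\eta_n))-\sum_i\omega(\eta_1,\dots,\nabla_\xi\eta_i,\dots,\eta_n)$. $A^n$ denotes $A\times\dots\times A$ ($n$ factors). *)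

theory Defs
  imports "HOL-Analysis.Analysis" "HOL-Library.Function_Algebras"
begin

section \<open>Smooth maps between normed spaces\<close>

definition bounded_multilinear ::
    "nat \<Rightarrow> ('a::real_normed_vector list \<Rightarrow> 'b::real_normed_vector) \<Rightarrow> bool" where
  "bounded_multilinear k m \<longleftrightarrow>
     (\<forall>vs i. length vs = k \<longrightarrow> i < k \<longrightarrow> linear (\<lambda>v. m (vs[i := v]))) \<and>
     (\<exists>K. \<forall>vs. length vs = k \<longrightarrow> norm (m vs) \<le> K * prod_list (map norm vs))"

text \<open>
  Smoothness of a map on an open set in the sense of iterated Frechet derivatives. The types of
  the iterated derivatives \<open>S \<rightarrow> L(E, L(E, \<dots>))\<close> grow with the order, so the \<open>k\<close>-th derivative is
  encoded as a bounded \<open>k\<close>-linear map on lists of length \<open>k\<close>; the last clause says that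
  \<open>D (Suc k) x\<close>, with the direction of differentiation as first argument, is the Frechet derivative
  of \<open>D k\<close> at \<open>x\<close> with respect to the norm of bounded \<open>k\<close>-linear maps.
\<close>

definition smooth_on :: "'a::real_normed_vector set \<Rightarrow> ('a \<Rightarrow> 'b::real_normed_vector) \<Rightarrow> bool" where
  "smooth_on S f \<longleftrightarrow> open S \<and>
     (\<exists>D :: nat \<Rightarrow> 'a \<Rightarrow> 'a list \<Rightarrow> 'b.
        (\<forall>x\<in>S. D 0 x [] = f x) \<and>
        (\<forall>k. \<forall>x\<in>S. bounded_multilinear k (D k x)) \<and>
        (\<forall>k. \<forall>x\<in>S. \<forall>\<epsilon>>0. \<exists>\<delta>>0. \<forall>y\<in>S. norm (y - x) < \<delta> \<longrightarrow>
           (\<forall>vs. length vs = k \<longrightarrow>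
              norm (D k y vs - D k x vs - D (Suc k) x ((y - x) # vs))
                \<le> \<epsilon> * norm (y - x) * prod_list (map norm vs))))"


section \<open>Banach manifolds\<close>

datatype ('m, 'e) chart = Chart (cdom: "'m set") (cmap: "'m \<Rightarrow> 'e")

definition cinv :: "('m, 'e) chart \<Rightarrow> 'e \<Rightarrow> 'm" where
  "cinv c = inv_into (cdom c) (cmap c)"

text \<open>
  A manifold is given by an atlas. Its underlying set is the union of the chart domains, and its
  topology is the one that makes all charts homeomorphisms onto open sets (\<open>open_subset\<close>).
\<close>

definition points :: "('m, 'e) chart set \<Rightarrow> 'm set" where
  "points M = (\<Union>c\<in>M. cdom c)"

definition charts_at :: "('m, 'e) chart set \<Rightarrow> 'm \<Rightarrow> ('m, 'e) chart set" where
  "charts_at M x = {c \<in> M. x \<in> cdom c}"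

definition banach_manifold :: "('m, 'e::banach) chart set \<Rightarrow> bool" where
  "banach_manifold M \<longleftrightarrow>
     (\<forall>c\<in>M. inj_on (cmap c) (cdom c) \<and> open (cmap c ` cdom c)) \<and>
     (\<forall>c\<in>M. \<forall>d\<in>M. open (cmap c ` (cdom c \<inter> cdom d)) \<and>
        smooth_on (cmap c ` (cdom c \<inter> cdom d)) (cmap d \<circ> cinv c))"

definition open_subset :: "('m, 'e::topological_space) chart set \<Rightarrow> 'm set \<Rightarrow> bool" where
  "open_subset M W \<longleftrightarrow> W \<subseteq> points M \<and> (\<forall>c\<in>M. open (cmap c ` (W \<inter> cdom c)))"

text \<open>
  Smooth maps from an open subset \<open>W\<close> of \<open>M\<close> into \<open>N\<close>. The openness of the sets
  on which the local representatives live, part of \<open>smooth_on\<close>, is the continuity of \<open>f\<close>.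
\<close>

definition smooth_map ::
    "('m, 'e::real_normed_vector) chart set \<Rightarrow> ('n, 'f::real_normed_vector) chart set \<Rightarrow>
     'm set \<Rightarrow> ('m \<Rightarrow> 'n) \<Rightarrow> bool" where
  "smooth_map M N W f \<longleftrightarrow> open_subset M W \<and> f ` W \<subseteq> points N \<and>
     (\<forall>c\<in>M. \<forall>d\<in>N. smooth_on (cmap c ` {x \<in> W \<inter> cdom c. f x \<in> cdom d}) (cmap d \<circ> f \<circ> cinv c))"


section \<open>Tangent bundles and tangent maps\<close>

text \<open>
  A tangent vector at \<open>x\<close> is a class of pairs (chart at \<open>x\<close>, vector of the model space), where
  \<open>(c, a)\<close> and \<open>(d, b)\<close> are identified iff the derivative of the chart change at the coordinates
  of \<open>x\<close> maps \<open>a\<close> to \<open>b\<close>. Such a class contains exactly one pair for every chart at \<open>x\<close>, and is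
  encoded as the function \<open>v\<close> assigning to a chart \<open>c\<close> at \<open>x\<close> the coordinate vector \<open>v c\<close> (and \<open>0\<close> to
  anything else). The vector space operations of a tangent space are then the pointwise ones.
\<close>

type_synonym ('m, 'e) tvec = "('m, 'e) chart \<Rightarrow> 'e"

type_synonym ('m, 'e) tangent = "'m \<times> ('m, 'e) tvec"

definition tangent_space ::
    "('m, 'e::real_normed_vector) chart set \<Rightarrow> 'm \<Rightarrow> ('m, 'e) tvec set" where
  "tangent_space M x = {v.
     (\<forall>c\<in>charts_at M x. \<forall>d\<in>charts_at M x.
        v d = frechet_derivative (cmap d \<circ> cinv c) (at (cmap c x)) (v c)) \<and>
     (\<forall>c. c \<notin> charts_at M x \<longrightarrow> v c = 0)}"

definition tangent_bundle ::
    "('m, 'e::real_normed_vector) chart set \<Rightarrow> ('m, 'e) tangent set" where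
  "tangent_bundle M = Sigma (points M) (tangent_space M)"

text \<open>
  The tangent bundle is again a manifold, modelled on \<open>E \<times> E\<close>, with the atlas of the charts
  \<open>T\<phi>\<close>; iterating the construction gives the second tangent bundle. The projections
  from \<open>TM\<close> to \<open>M\<close> and from \<open>TTM\<close> to \<open>TM\<close> are both \<open>fst\<close>.
\<close>

definition tangent_chart ::
    "('m, 'e::real_normed_vector) chart set \<Rightarrow> ('m, 'e) chart \<Rightarrow>
     (('m, 'e) tangent, 'e \<times> 'e) chart" where
  "tangent_chart M c =
     Chart {u \<in> tangent_bundle M. fst u \<in> cdom c} (\<lambda>(x, v). (cmap c x, v c))"

definition tangent_atlas ::
    "('m, 'e::real_normed_vector) chart set \<Rightarrow> (('m, 'e) tangent, 'e \<times> 'e) chart set" where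
  "tangent_atlas M = tangent_chart M ` M"

text \<open>The value does not depend on the chosen chart \<open>c\<close> if \<open>f\<close> is smooth near \<open>x\<close>.\<close>

definition tangent_at ::
    "('m, 'e::real_normed_vector) chart set \<Rightarrow> ('n, 'f::real_normed_vector) chart set \<Rightarrow>
     ('m \<Rightarrow> 'n) \<Rightarrow> 'm \<Rightarrow> ('m, 'e) tvec \<Rightarrow> ('n, 'f) tvec" where
  "tangent_at M N f x v =
     (let c = (SOME c. c \<in> charts_at M x)
      in (\<lambda>d. if d \<in> charts_at N (f x)
              then frechet_derivative (cmap d \<circ> f \<circ> cinv c) (at (cmap c x)) (v c)
              else 0))"

definition tangent_map ::
    "('m, 'e::real_normed_vector) chart set \<Rightarrow> ('n, 'f::real_normed_vector) chart set \<Rightarrow>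
     ('m \<Rightarrow> 'n) \<Rightarrow> ('m, 'e) tangent \<Rightarrow> ('n, 'f) tangent" where
  "tangent_map M N f = (\<lambda>(x, v). (f x, tangent_at M N f x v))"

text \<open>
  Continuous linear maps between tangent spaces. The topology of a tangent space is the one of
  the model space, transported by any chart.
\<close>

definition tangent_continuous_linear ::
    "('m, 'e::real_normed_vector) chart set \<Rightarrow> 'm \<Rightarrow> ('n, 'f::real_normed_vector) chart set \<Rightarrow> 'n \<Rightarrow>
     (('m, 'e) tvec \<Rightarrow> ('n, 'f) tvec) \<Rightarrow> bool" where
  "tangent_continuous_linear M x N y A \<longleftrightarrow>
     A ` tangent_space M x \<subseteq> tangent_space N y \<and>
     (\<forall>v\<in>tangent_space M x. \<forall>w\<in>tangent_space M x. A (v + w) = A v + A w) \<and>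
     (\<forall>r. \<forall>v\<in>tangent_space M x. A (\<lambda>c. r *\<^sub>R v c) = (\<lambda>d. r *\<^sub>R A v d)) \<and>
     (\<forall>c\<in>charts_at M x. \<forall>d\<in>charts_at N y.
        \<exists>K. \<forall>v\<in>tangent_space M x. norm (A v d) \<le> K * norm (v c))"


section \<open>Affine connections\<close>

definition whitney_sum ::
    "('m, 'e::real_normed_vector) chart set \<Rightarrow> ('m \<times> ('m, 'e) tvec \<times> ('m, 'e) tvec) set" where
  "whitney_sum M = {(x, v, w). x \<in> points M \<and> v \<in> tangent_space M x \<and> w \<in> tangent_space M x}"

type_synonym ('m, 'e) connection =
  "'m \<times> ('m, 'e) tvec \<times> ('m, 'e) tvec \<Rightarrow> (('m, 'e) tangent, 'e \<times> 'e) tangent"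

text \<open>
  The chart \<open>TT\<phi>\<close> of the second tangent bundle has values of the form \<open>((x, v), (w, z))\<close>, where
  \<open>(x, v)\<close> and \<open>(x, w)\<close> are the coordinates of the images under the projection \<open>TTM \<rightarrow> TM\<close> and
  under the tangent map of \<open>TM \<rightarrow> M\<close>, respectively. Bilinearity on the fibers is expressed by the
  type of \<open>\<beta>\<close>, the space of continuous bilinear maps being \<open>L(E, L(E, E))\<close>.
\<close>

definition second_tangent_coords ::
    "('m, 'e::real_normed_vector) chart set \<Rightarrow> ('m, 'e) chart \<Rightarrow>
     (('m, 'e) tangent, 'e \<times> 'e) tangent \<Rightarrow> ('e \<times> 'e) \<times> ('e \<times> 'e)" where
  "second_tangent_coords M c = cmap (tangent_chart (tangent_atlas M) (tangent_chart M c))"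

definition affine_connection ::
    "('m, 'e::real_normed_vector) chart set \<Rightarrow> ('m, 'e) connection \<Rightarrow> bool" where
  "affine_connection M B \<longleftrightarrow>
     (\<forall>(x, v, w)\<in>whitney_sum M.
        B (x, v, w) \<in> tangent_bundle (tangent_atlas M) \<and>
        fst (B (x, v, w)) = (x, v) \<and>
        tangent_map (tangent_atlas M) M fst (B (x, v, w)) = (x, w)) \<and>
     (\<forall>c\<in>M. \<exists>\<beta> :: 'e \<Rightarrow> 'e \<Rightarrow>\<^sub>L 'e \<Rightarrow>\<^sub>L 'e.
        smooth_on (cmap c ` cdom c) \<beta> \<and>
        (\<forall>(x, v, w)\<in>whitney_sum M. x \<in> cdom c \<longrightarrow>
           second_tangent_coords M c (B (x, v, w)) =
             ((cmap c x, v c), (w c, blinfun_apply (blinfun_apply (\<beta> (cmap c x)) (v c)) (w c)))))"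

definition affine_banach_manifold ::
    "('m, 'e::banach) chart set \<Rightarrow> ('m, 'e) connection \<Rightarrow> bool" where
  "affine_banach_manifold M B \<longleftrightarrow> banach_manifold M \<and> affine_connection M B"

definition affine_map ::
    "('m, 'e::real_normed_vector) chart set \<Rightarrow> ('m, 'e) connection \<Rightarrow>
     ('n, 'f::real_normed_vector) chart set \<Rightarrow> ('n, 'f) connection \<Rightarrow>
     'm set \<Rightarrow> ('m \<Rightarrow> 'n) \<Rightarrow> bool" where
  "affine_map M\<^sub>1 B\<^sub>1 M\<^sub>2 B\<^sub>2 W f \<longleftrightarrow> smooth_map M\<^sub>1 M\<^sub>2 W f \<and>
     (\<forall>(x, v, w)\<in>whitney_sum M\<^sub>1. x \<in> W \<longrightarrow>
        tangent_map (tangent_atlas M\<^sub>1) (tangent_atlas M\<^sub>2) (tangent_map M\<^sub>1 M\<^sub>2 f) (B\<^sub>1 (x, v, w)) =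
        B\<^sub>2 (f x, tangent_at M\<^sub>1 M\<^sub>2 f x v, tangent_at M\<^sub>1 M\<^sub>2 f x w))"


section \<open>Covariant derivative, torsion and curvature\<close>

text \<open>
  Local vector fields are total functions of which only the values on the open set \<open>U\<close> matter.
\<close>

definition vector_field ::
    "('m, 'e::real_normed_vector) chart set \<Rightarrow> 'm set \<Rightarrow> ('m \<Rightarrow> ('m, 'e) tvec) \<Rightarrow> bool" where
  "vector_field M U \<xi> \<longleftrightarrow> open_subset M U \<and> (\<forall>x\<in>U. \<xi> x \<in> tangent_space M x) \<and>
     smooth_map M (tangent_atlas M) U (\<lambda>x. (x, \<xi> x))"

definition local_rep :: "('m, 'e) chart \<Rightarrow> ('m \<Rightarrow> ('m, 'e) tvec) \<Rightarrow> 'e \<Rightarrow> 'e" where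
  "local_rep c \<xi> y = \<xi> (cinv c y) c"

text \<open>
  In \<open>cov_deriv_at\<close>, the term \<open>snd (snd \<dots>)\<close> is the value at \<open>(\<eta>(x), v)\<close> of the local
  representative of \<open>B\<close> in the chart \<open>c\<close>.
\<close>

definition cov_deriv_at ::
    "('m, 'e::real_normed_vector) chart set \<Rightarrow> ('m, 'e) connection \<Rightarrow>
     'm \<Rightarrow> ('m, 'e) tvec \<Rightarrow> ('m \<Rightarrow> ('m, 'e) tvec) \<Rightarrow> ('m, 'e) tvec" where
  "cov_deriv_at M B x v \<eta> =
     (\<lambda>c. if c \<in> charts_at M x
          then frechet_derivative (local_rep c \<eta>) (at (cmap c x)) (v c)
               - snd (snd (second_tangent_coords M c (B (x, \<eta> x, v))))
          else 0)"

definition cov_deriv ::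
    "('m, 'e::real_normed_vector) chart set \<Rightarrow> ('m, 'e) connection \<Rightarrow>
     ('m \<Rightarrow> ('m, 'e) tvec) \<Rightarrow> ('m \<Rightarrow> ('m, 'e) tvec) \<Rightarrow> 'm \<Rightarrow> ('m, 'e) tvec" where
  "cov_deriv M B \<xi> \<eta> = (\<lambda>x. cov_deriv_at M B x (\<xi> x) \<eta>)"

definition lie_bracket ::
    "('m, 'e::real_normed_vector) chart set \<Rightarrow>
     ('m \<Rightarrow> ('m, 'e) tvec) \<Rightarrow> ('m \<Rightarrow> ('m, 'e) tvec) \<Rightarrow> 'm \<Rightarrow> ('m, 'e) tvec" where
  "lie_bracket M \<xi> \<eta> = (\<lambda>x c.
     if c \<in> charts_at M x
     then frechet_derivative (local_rep c \<eta>) (at (cmap c x)) (\<xi> x c)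
          - frechet_derivative (local_rep c \<xi>) (at (cmap c x)) (\<eta> x c)
     else 0)"

text \<open>
  A tensor field of rank \<open>n\<close> is a function of a point and a list of \<open>n\<close> tangent vectors there.
  The values of torsion and curvature on tangent vectors at \<open>x\<close> are defined by means of
  arbitrary extensions of these vectors to smooth vector fields on a neighborhood of \<open>x\<close>.
\<close>

type_synonym ('m, 'e) tensor = "'m \<Rightarrow> ('m, 'e) tvec list \<Rightarrow> ('m, 'e) tvec"

definition torsion ::
    "('m, 'e::real_normed_vector) chart set \<Rightarrow> ('m, 'e) connection \<Rightarrow> ('m, 'e) tensor" where
  "torsion M B x vs = (THE u. \<forall>U \<xi> \<eta>.
     x \<in> U \<longrightarrow> vector_field M U \<xi> \<longrightarrow> vector_field M U \<eta> \<longrightarrow> [\<xi> x, \<eta> x] = vs \<longrightarrow>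
     u = cov_deriv M B \<xi> \<eta> x - cov_deriv M B \<eta> \<xi> x - lie_bracket M \<xi> \<eta> x)"

definition curvature ::
    "('m, 'e::real_normed_vector) chart set \<Rightarrow> ('m, 'e) connection \<Rightarrow> ('m, 'e) tensor" where
  "curvature M B x vs = (THE u. \<forall>U \<xi> \<eta> \<zeta>.
     x \<in> U \<longrightarrow> vector_field M U \<xi> \<longrightarrow> vector_field M U \<eta> \<longrightarrow> vector_field M U \<zeta> \<longrightarrow>
     [\<xi> x, \<eta> x, \<zeta> x] = vs \<longrightarrow>
     u = cov_deriv M B \<xi> (cov_deriv M B \<eta> \<zeta>) x
         - cov_deriv M B \<eta> (cov_deriv M B \<xi> \<zeta>) x
         - cov_deriv M B (lie_bracket M \<xi> \<eta>) \<zeta> x)"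

definition cov_deriv_tensor ::
    "('m, 'e::real_normed_vector) chart set \<Rightarrow> ('m, 'e) connection \<Rightarrow> ('m, 'e) tensor \<Rightarrow>
     'm \<Rightarrow> ('m, 'e) tvec \<Rightarrow> ('m \<Rightarrow> ('m, 'e) tvec) list \<Rightarrow> ('m, 'e) tvec" where
  "cov_deriv_tensor M B \<omega> x v \<eta>s =
     cov_deriv_at M B x v (\<lambda>y. \<omega> y (map (\<lambda>\<eta>. \<eta> y) \<eta>s))
     - (\<Sum>i<length \<eta>s. \<omega> x ((map (\<lambda>\<eta>. \<eta> x) \<eta>s)[i := cov_deriv_at M B x v (\<eta>s ! i)]))"

definition parallel_on ::
    "('m, 'e::real_normed_vector) chart set \<Rightarrow> ('m, 'e) connection \<Rightarrow> nat \<Rightarrow>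
     ('m, 'e) tensor \<Rightarrow> 'm set \<Rightarrow> bool" where
  "parallel_on M B n \<omega> U \<longleftrightarrow>
     (\<forall>x\<in>U. \<forall>v\<in>tangent_space M x. \<forall>V \<eta>s.
        x \<in> V \<longrightarrow> length \<eta>s = n \<longrightarrow> (\<forall>\<eta>\<in>set \<eta>s. vector_field M V \<eta>) \<longrightarrow>
        cov_deriv_tensor M B \<omega> x v \<eta>s = 0)"

end

theory Submission
  imports Defs
begin

text \<open>
  In charts, an affine map \<open>f\<close> with \<open>L = df\<close> solves the total differential equation saying that \<open>L\<close> is
  the derivative of \<open>f\<close> and that \<open>L\<close> is parallel. Its integrability condition is that \<open>L\<close> intertwines
  the torsions and the curvatures. We solve the equation along the rays from the base point, where
  this condition holds: it holds at the base point, and since torsions and curvatures are parallel, its defect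
  satisfies a homogeneous linear equation along each ray. By integrability, the function obtained
  from the solutions along rays is differentiable and solves the total equation. The equation
  itself then yields smoothness, so no smooth dependence of solutions on parameters is needed.
\<close>

section \<open>Bounded multilinear maps on lists\<close>

text \<open>In a Banach space there is no finite list of coordinates along which to integrate one
  variable after another, and \<open>A\<close> need not be injective or surjective, so no adapted
  frame can be transported either. The unknown is the triple (\<open>x\<close>, \<open>f\<close>,
  \<open>L\<close>): with the position in the state the equation is autonomous, and the result on
  total differential equations can be stated for a general field \<open>H\<close>. Its integrability
  condition may fail at arbitrary states; it holds where \<open>L\<close> intertwines the tensors.
  So the radial solution has to be constructed before integrability can be checked, and its
  differentiability has to follow from the symmetry at its own values alone. One smallness
  condition, radius times coefficient at most 1/2, serves throughout: it makes the fixed point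
  operator a contraction, absorbs linear terms in estimates and halves the bound of the defect. The
  other obstacle is the meaning of smoothness. Derivatives of all orders live on lists, whereas the
  analysis uses operator-valued first derivatives. Families closed under directional derivatives
  mediate between the two.\<close>

lemma prod_list_norm_nonneg: "0 \<le> prod_list (map norm (vs :: 'a::real_normed_vector list))"
  by (induction vs) auto

lemma prod_list_norm_le_1:
  "(\<And>v. v \<in> set vs \<Longrightarrow> norm v \<le> 1) \<Longrightarrow> prod_list (map norm (vs :: 'a::real_normed_vector list)) \<le> 1"
  by (induction vs) (auto intro!: mult_le_one prod_list_norm_nonneg)

lemma bounded_multilinear_linear_hd:
  assumes "bounded_multilinear (Suc k) m" "length us = k"
  shows "linear (\<lambda>v. m (v # us))"
proof -
  have "linear (\<lambda>v. m ((0 # us)[0 := v]))"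
    using assms unfolding bounded_multilinear_def by (metis length_Cons zero_less_Suc)
  then show ?thesis by simp
qed

lemma bounded_multilinear_bound:
  assumes "bounded_multilinear k m"
  obtains K where "K \<ge> 0" "\<And>vs. length vs = k \<Longrightarrow> norm (m vs) \<le> K * prod_list (map norm vs)"
proof -
  obtain K where K: "\<And>vs. length vs = k \<Longrightarrow> norm (m vs) \<le> K * prod_list (map norm vs)"
    using assms unfolding bounded_multilinear_def by blast
  have "norm (m vs) \<le> max K 0 * prod_list (map norm vs)" if "length vs = k" for vs
    using K[OF that] mult_right_mono[OF max.cobounded1[of K 0] prod_list_norm_nonneg[of vs]] by linarith
  then show ?thesis using that[of "max K 0"] by auto
qed

lemma bounded_multilinear_Cons:
  assumes "bounded_multilinear (Suc k) m"
  shows "bounded_multilinear k (\<lambda>us. m (v # us))"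
  unfolding bounded_multilinear_def
proof (intro conjI allI impI)
  fix us :: "'a list" and i assume "length us = k" "i < k"
  then show "linear (\<lambda>a. m (v # us[i := a]))"
    using assms[unfolded bounded_multilinear_def, THEN conjunct1, rule_format, of "v # us" "Suc i"] by simp
next
  obtain K where K: "K \<ge> 0" "\<And>vs. length vs = Suc k \<Longrightarrow> norm (m vs) \<le> K * prod_list (map norm vs)"
    by (rule bounded_multilinear_bound[OF assms]) blast
  show "\<exists>K. \<forall>us. length us = k \<longrightarrow> norm (m (v # us)) \<le> K * prod_list (map norm us)"
    by (rule exI[of _ "K * norm v"]) (use K(2)[of "v # _"] in \<open>auto simp: mult.assoc\<close>)
qed

lemma bounded_multilinear_bounded_linear_hd:
  assumes "bounded_multilinear (Suc k) m" "length us = k"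
  shows "bounded_linear (\<lambda>v. m (v # us))"
proof -
  obtain K where K: "K \<ge> 0" "\<And>vs. length vs = Suc k \<Longrightarrow> norm (m vs) \<le> K * prod_list (map norm vs)"
    by (rule bounded_multilinear_bound[OF assms(1)]) blast
  show ?thesis
    by (intro bounded_linear.intro[OF bounded_multilinear_linear_hd[OF assms]] bounded_linear_axioms.intro
        exI[of _ "K * prod_list (map norm us)"]) (use K(2)[of "_ # us"] assms in \<open>auto simp: algebra_simps\<close>)
qed

text \<open>Names the witness hidden in \<open>smooth_on\<close>: a coherent sequence of derivatives
  of all orders, detached from the function at its bottom. Any level can then be differentiated in
  the same way as the lowest one.\<close>

definition jet :: "'a::real_normed_vector set \<Rightarrow> (nat \<Rightarrow> 'a \<Rightarrow> 'a list \<Rightarrow> 'b::real_normed_vector) \<Rightarrow> bool" where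
  "jet S D \<longleftrightarrow> open S \<and> (\<forall>k. \<forall>x\<in>S. bounded_multilinear k (D k x)) \<and>
        (\<forall>k. \<forall>x\<in>S. \<forall>\<epsilon>>0. \<exists>\<delta>>0. \<forall>y\<in>S. norm (y - x) < \<delta> \<longrightarrow>
           (\<forall>vs. length vs = k \<longrightarrow>
              norm (D k y vs - D k x vs - D (Suc k) x ((y - x) # vs))
                \<le> \<epsilon> * norm (y - x) * prod_list (map norm vs)))"

lemma smooth_on_iff_jet: "smooth_on S f \<longleftrightarrow> (\<exists>D. jet S D \<and> (\<forall>x\<in>S. D 0 x [] = f x))"
  unfolding smooth_on_def jet_def by blast

lemma jet_estimate:
  assumes "jet S D" "x \<in> S" "\<epsilon> > 0"
  obtains \<delta> where "\<delta> > 0" "\<And>y. norm (y - x) < \<delta> \<Longrightarrow> y \<in> S"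
    "\<And>y vs. norm (y - x) < \<delta> \<Longrightarrow> length vs = k \<Longrightarrow>
       norm (D k y vs - D k x vs - D (Suc k) x ((y - x) # vs)) \<le> \<epsilon> * norm (y - x) * prod_list (map norm vs)"
proof -
  obtain d where d: "d > 0" "\<And>y vs. y \<in> S \<Longrightarrow> norm (y - x) < d \<Longrightarrow> length vs = k \<Longrightarrow>
       norm (D k y vs - D k x vs - D (Suc k) x ((y - x) # vs)) \<le> \<epsilon> * norm (y - x) * prod_list (map norm vs)"
    using assms unfolding jet_def by metis
  obtain e where e: "e > 0" "\<And>y. norm (y - x) < e \<Longrightarrow> y \<in> S"
    using assms unfolding jet_def open_dist dist_norm by metis
  show ?thesis by (rule that[of "min d e"]) (use d e in auto)
qed

lemma jet_multilinear: "jet S D \<Longrightarrow> x \<in> S \<Longrightarrow> bounded_multilinear k (D k x)"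
  unfolding jet_def by blast

lemma jet_has_derivative:
  assumes "jet S D" "x \<in> S" "length vs = k"
  shows "((\<lambda>y. D k y vs) has_derivative (\<lambda>w. D (Suc k) x (w # vs))) (at x)"
  unfolding has_derivative_at_alt
proof (intro conjI allI impI)
  show "bounded_linear (\<lambda>w. D (Suc k) x (w # vs))"
    using jet_multilinear[OF assms(1,2)] assms(3) by (rule bounded_multilinear_bounded_linear_hd)
  fix e :: real assume "e > 0"
  define P where "P = prod_list (map norm vs)"
  have P: "P \<ge> 0" unfolding P_def by (rule prod_list_norm_nonneg)
  have "e / (P + 1) > 0" using \<open>e > 0\<close> P by simp
  from jet_estimate[OF assms(1,2) this, of k] obtain d where d: "d > 0"
    "\<And>y. norm (y - x) < d \<Longrightarrow> norm (D k y vs - D k x vs - D (Suc k) x ((y - x) # vs))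
        \<le> e / (P + 1) * norm (y - x) * P"
    using assms(3) unfolding P_def by metis
  have *: "e / (P + 1) * norm (y - x) * P \<le> e * norm (y - x)" for y
  proof -
    have "e / (P + 1) * P \<le> e" using P \<open>e > 0\<close> by (simp add: field_simps)
    from mult_right_mono[OF this norm_ge_zero[of "y - x"]] show ?thesis by (simp add: ac_simps)
  qed
  show "\<exists>d>0. \<forall>y. norm (y - x) < d \<longrightarrow> norm (D k y vs - D k x vs - D (Suc k) x ((y - x) # vs))
      \<le> e * norm (y - x)"
    using d * by (meson order_trans)
qed

text \<open>Differentiability of level \<open>k\<close> is uniform in \<open>vs\<close>, so it
  bounds the operator norm nearby. With error constant 1 and distance below 1, the remainder, the
  value at \<open>x\<close> and the linear term contribute 1, \<open>K0\<close> and
  \<open>K1\<close>.\<close>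

lemma jet_bound:
  assumes "jet S D" "x \<in> S"
  obtains \<delta> K where "\<delta> > 0" "K \<ge> 0" "\<And>y vs. norm (y - x) < \<delta> \<Longrightarrow> length vs = k \<Longrightarrow>
      norm (D k y vs) \<le> K * prod_list (map norm vs)"
proof -
  obtain d where d: "d > 0" "\<And>y vs. norm (y - x) < d \<Longrightarrow> length vs = k \<Longrightarrow>
       norm (D k y vs - D k x vs - D (Suc k) x ((y - x) # vs)) \<le> 1 * norm (y - x) * prod_list (map norm vs)"
    by (rule jet_estimate[OF assms zero_less_one]) blast
  obtain K0 where K0: "K0 \<ge> 0" "\<And>vs. length vs = k \<Longrightarrow> norm (D k x vs) \<le> K0 * prod_list (map norm vs)"
    by (rule bounded_multilinear_bound[OF jet_multilinear[OF assms]]) blast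
  obtain K1 where K1: "K1 \<ge> 0" "\<And>vs. length vs = Suc k \<Longrightarrow> norm (D (Suc k) x vs) \<le> K1 * prod_list (map norm vs)"
    by (rule bounded_multilinear_bound[OF jet_multilinear[OF assms]]) blast
  show ?thesis
  proof (rule that[of "min d 1" "1 + K0 + K1"])
    fix y vs assume y: "norm (y - x) < min d 1" and l: "length (vs :: 'a list) = k"
    define P where "P = prod_list (map norm vs)"
    have P: "P \<ge> 0" unfolding P_def by (rule prod_list_norm_nonneg)
    have "norm (D k y vs - D k x vs - D (Suc k) x ((y - x) # vs)) \<le> 1 * norm (y - x) * P"
      using d(2) y l unfolding P_def by simp
    also have "\<dots> \<le> 1 * P" using y P by (intro mult_right_mono) auto
    finally have 1: "norm (D k y vs - D k x vs - D (Suc k) x ((y - x) # vs)) \<le> 1 * P" .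
    have 2: "norm (D k x vs) \<le> K0 * P" using K0(2) l unfolding P_def by simp
    have "norm (D (Suc k) x ((y - x) # vs)) \<le> K1 * (norm (y - x) * P)"
      using K1(2)[of "(y - x) # vs"] l unfolding P_def by simp
    also have "\<dots> \<le> K1 * (1 * P)" using y P K1(1) by (intro mult_left_mono mult_right_mono) auto
    finally have 3: "norm (D (Suc k) x ((y - x) # vs)) \<le> K1 * P" by simp
    have "norm (D k y vs) \<le> norm (D k y vs - D k x vs - D (Suc k) x ((y - x) # vs)) + norm (D k x vs)
        + norm (D (Suc k) x ((y - x) # vs))"
      by (smt (verit) norm_triangle_sub)
    also have "\<dots> \<le> (1 + K0 + K1) * P" using 1 2 3 by (simp add: algebra_simps)
    finally show "norm (D k y vs) \<le> (1 + K0 + K1) * prod_list (map norm vs)" unfolding P_def .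
  qed (use d K0 K1 in auto)
qed

section \<open>Bounded families of differentiable functions\<close>

definition locally_bounded_family :: "'a::real_normed_vector set \<Rightarrow> ('a \<Rightarrow> 'b::real_normed_vector) set \<Rightarrow>
    bool" where
  "locally_bounded_family S F \<longleftrightarrow>
     (\<forall>x\<in>S. \<exists>\<delta>>0. \<exists>K. \<forall>y\<in>S. norm (y - x) < \<delta> \<longrightarrow> (\<forall>f\<in>F. norm (f y) \<le> K))"

text \<open>
  In higher order logic an induction on the order of differentiability cannot change the type of
  the functions involved, as the operator-valued derivative would. Families of functions that
  are closed under directional derivatives have a fixed type; uniform bounds over
  the family replace operator norms.
\<close>

primrec Ck_family :: "nat \<Rightarrow> 'a::real_normed_vector set \<Rightarrow> ('a \<Rightarrow> 'b::real_normed_vector) set \<Rightarrow> bool" where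
  "Ck_family 0 S F \<longleftrightarrow> locally_bounded_family S F"
| "Ck_family (Suc n) S F \<longleftrightarrow> locally_bounded_family S F \<and> (\<forall>f\<in>F. \<forall>x\<in>S. f differentiable at x) \<and>
     Ck_family n S {(\<lambda>x. frechet_derivative f (at x) v) | f v. f \<in> F \<and> norm v \<le> 1}"

lemma Ck_family_bounded: "Ck_family n S F \<Longrightarrow> locally_bounded_family S F"
  by (cases n) auto

lemma locally_bounded_family_cong:
  assumes "locally_bounded_family S G" "\<And>f. f \<in> F \<Longrightarrow> \<exists>g\<in>G. \<forall>x\<in>S. f x = g x"
  shows "locally_bounded_family S F"
  using assms unfolding locally_bounded_family_def by metis

lemma frechet_derivative_cong_open:
  assumes "open S" "x \<in> S" "\<And>y. y \<in> S \<Longrightarrow> f y = g y"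
  shows "frechet_derivative f (at x) = frechet_derivative g (at x)"
proof -
  have "(f has_derivative D) (at x) \<longleftrightarrow> (g has_derivative D) (at x)" for D
    using assms by (metis has_derivative_transform_within_open)
  then show ?thesis unfolding frechet_derivative_def by simp
qed

lemma differentiable_cong_open:
  assumes "open S" "x \<in> S" "\<And>y. y \<in> S \<Longrightarrow> f y = g y"
  shows "f differentiable at x \<longleftrightarrow> g differentiable at x"
  using assms unfolding differentiable_def by (metis has_derivative_transform_within_open)

text \<open>Families matter only on \<open>S\<close>; off \<open>S\<close> a member and its Frechet
  derivative may be anything. As all bounds are uniform, a smaller family inherits them, so concrete
  families can be recognized inside the larger ones that closure lemmas produce.\<close>

lemma Ck_family_cong:
  assumes "open S"
  shows "Ck_family n S G \<Longrightarrow> (\<And>f. f \<in> F \<Longrightarrow> \<exists>g\<in>G. \<forall>x\<in>S. f x = g x) \<Longrightarrow> Ck_family n S F"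
proof (induction n arbitrary: F G)
  case (0 F G) then show ?case by (auto intro: locally_bounded_family_cong)
next
  case (Suc n F G)
  let ?d = "\<lambda>F. {(\<lambda>x. frechet_derivative f (at x) v) | f v. f \<in> F \<and> norm v \<le> 1}"
  have "f differentiable at x" if "f \<in> F" "x \<in> S" for f x
  proof -
    from Suc.prems(2)[OF that(1)] obtain g where g: "g \<in> G" "\<And>x. x \<in> S \<Longrightarrow> f x = g x" by blast
    have "g differentiable at x" using Suc.prems(1) g(1) that(2) by simp
    then show ?thesis by (simp add: differentiable_cong_open[OF assms that(2), of f g] g(2))
  qed
  moreover have "Ck_family n S (?d F)"
  proof (rule Suc.IH)
    show "Ck_family n S (?d G)" using Suc.prems(1) by simp
    fix h assume "h \<in> ?d F"
    then obtain f v where h: "h = (\<lambda>x. frechet_derivative f (at x) v)" "f \<in> F" "norm v \<le> 1" by blast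
    obtain g where g: "g \<in> G" "\<And>x. x \<in> S \<Longrightarrow> f x = g x" using Suc.prems(2)[OF h(2)] by blast
    show "\<exists>g\<in>?d G. \<forall>x\<in>S. h x = g x"
      by (rule bexI[of _ "\<lambda>x. frechet_derivative g (at x) v"])
        (use h g frechet_derivative_cong_open[OF assms _ g(2)] in auto)
  qed
  moreover have "locally_bounded_family S F"
    by (rule locally_bounded_family_cong[OF Ck_family_bounded[OF Suc.prems(1)] Suc.prems(2)])
  ultimately show ?case by simp
qed

lemma Ck_family_subset: "open S \<Longrightarrow> Ck_family n S G \<Longrightarrow> F \<subseteq> G \<Longrightarrow> Ck_family n S F"
  by (rule Ck_family_cong) blast+

text \<open>The form used in all inductions: it suffices that the derivatives in unit directions
  lie, on \<open>S\<close>, in some family \<open>G\<close> of order \<open>n\<close>.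
  \<open>G\<close> may be much larger than the set of these derivatives.\<close>

lemma Ck_family_SucI:
  assumes "open S" "locally_bounded_family S F"
    and "\<And>f. f \<in> F \<Longrightarrow> \<exists>f'. (\<forall>x\<in>S. (f has_derivative f' x) (at x)) \<and> (\<forall>v. norm v \<le> 1 \<longrightarrow>
        (\<exists>g\<in>G. \<forall>x\<in>S. f' x v = g x))"
    and "Ck_family n S G"
  shows "Ck_family (Suc n) S F"
  unfolding Ck_family.simps
proof (intro conjI ballI)
  show "f differentiable at x" if "f \<in> F" "x \<in> S" for f x
    using assms(3)[OF that(1)] that(2) unfolding differentiable_def by blast
  show "Ck_family n S {(\<lambda>x. frechet_derivative f (at x) v) | f v. f \<in> F \<and> norm v \<le> 1}"
  proof (rule Ck_family_cong[OF assms(1,4)])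
    fix h assume "h \<in> {(\<lambda>x. frechet_derivative f (at x) v) | f v. f \<in> F \<and> norm v \<le> 1}"
    then obtain f v where h: "h = (\<lambda>x. frechet_derivative f (at x) v)" "f \<in> F" "norm v \<le> 1" by blast
    obtain f' where f': "\<And>x. x \<in> S \<Longrightarrow> (f has_derivative f' x) (at x)" "\<And>v. norm v \<le> 1 \<Longrightarrow>
        \<exists>g\<in>G. \<forall>x\<in>S. f' x v = g x"
      using assms(3)[OF h(2)] by blast
    show "\<exists>g\<in>G. \<forall>x\<in>S. h x = g x"
      using f'(2)[OF h(3)] f'(1) frechet_derivative_at unfolding h(1) by metis
  qed
qed (use assms in auto)

text \<open>Besides the family of derivatives it returns \<open>F\<close> itself at order
  \<open>n\<close>: by the product rule, derivatives still contain undifferentiated factors.\<close>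

lemma Ck_family_SucE:
  assumes "Ck_family (Suc n) S F" "open S"
  obtains G where "Ck_family n S G" "Ck_family n S F" 
    "\<And>f x. f \<in> F \<Longrightarrow> x \<in> S \<Longrightarrow> (f has_derivative frechet_derivative f (at x)) (at x)"
    "\<And>f v. f \<in> F \<Longrightarrow> norm v \<le> 1 \<Longrightarrow> (\<lambda>x. frechet_derivative f (at x) v) \<in> G"
proof -
  have mono: "Ck_family (Suc n) S F \<Longrightarrow> Ck_family n S F" for F :: "('a \<Rightarrow> 'b) set"
    by (induction n arbitrary: F) auto
  show ?thesis
    by (rule that[OF _ mono[OF assms(1)], of "{(\<lambda>x. frechet_derivative f (at x) v) | f v. f \<in> F \<and> norm v
        \<le> 1}"])
      (use assms in \<open>auto simp: frechet_derivative_works[symmetric]\<close>)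
qed

lemma locally_bounded_family_Un:
  assumes "locally_bounded_family S F" "locally_bounded_family S G"
  shows "locally_bounded_family S (F \<union> G)"
  unfolding locally_bounded_family_def
proof
  fix x assume "x \<in> S"
  obtain d K where 1: "d > 0" "\<And>y f. y \<in> S \<Longrightarrow> norm (y - x) < d \<Longrightarrow> f \<in> F \<Longrightarrow> norm (f y) \<le> K"
    using assms(1) \<open>x \<in> S\<close> unfolding locally_bounded_family_def by metis
  obtain e L where 2: "e > 0" "\<And>y f. y \<in> S \<Longrightarrow> norm (y - x) < e \<Longrightarrow> f \<in> G \<Longrightarrow> norm (f y) \<le> L"
    using assms(2) \<open>x \<in> S\<close> unfolding locally_bounded_family_def by metis
  show "\<exists>\<delta>>0. \<exists>K. \<forall>y\<in>S. norm (y - x) < \<delta> \<longrightarrow> (\<forall>f\<in>F \<union> G. norm (f y) \<le> K)"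
    by (rule exI[of _ "min d e"], intro conjI, use 1 2 in simp, rule exI[of _ "max K L"])
      (use 1 2 in \<open>fastforce simp: le_max_iff_disj\<close>)
qed

lemma Ck_family_Un:
  assumes "open S"
  shows "Ck_family n S F \<Longrightarrow> Ck_family n S G \<Longrightarrow> Ck_family n S (F \<union> G)"
proof (induction n arbitrary: F G)
  case (0 F G) then show ?case by (auto intro: locally_bounded_family_Un)
next
  case (Suc n F G)
  obtain F' where F': "Ck_family n S F'"
    "\<And>f x. f \<in> F \<Longrightarrow> x \<in> S \<Longrightarrow> (f has_derivative frechet_derivative f (at x)) (at x)"
    "\<And>f v. f \<in> F \<Longrightarrow> norm v \<le> 1 \<Longrightarrow> (\<lambda>x. frechet_derivative f (at x) v) \<in> F'"
    by (rule Ck_family_SucE[OF Suc.prems(1) assms]) blast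
  obtain G' where G': "Ck_family n S G'"
    "\<And>f x. f \<in> G \<Longrightarrow> x \<in> S \<Longrightarrow> (f has_derivative frechet_derivative f (at x)) (at x)"
    "\<And>f v. f \<in> G \<Longrightarrow> norm v \<le> 1 \<Longrightarrow> (\<lambda>x. frechet_derivative f (at x) v) \<in> G'"
    by (rule Ck_family_SucE[OF Suc.prems(2) assms]) blast
  show ?case
    by (rule Ck_family_SucI[OF assms _ _ Suc.IH[OF F'(1) G'(1)]])
      (use F' G' Suc.prems in \<open>auto intro!: locally_bounded_family_Un exI[of _ "\<lambda>x. frechet_derivative _
          (at x)"]
          dest: Ck_family_bounded\<close>)
qed

lemma locally_bounded_family_add:
  assumes "locally_bounded_family S F" "locally_bounded_family S G"
  shows "locally_bounded_family S {(\<lambda>x. f x + g x) | f g. f \<in> F \<and> g \<in> G}"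
  unfolding locally_bounded_family_def
proof
  fix x assume "x \<in> S"
  obtain d K where 1: "d > 0" "\<And>y f. y \<in> S \<Longrightarrow> norm (y - x) < d \<Longrightarrow> f \<in> F \<Longrightarrow> norm (f y) \<le> K"
    using assms(1) \<open>x \<in> S\<close> unfolding locally_bounded_family_def by metis
  obtain e L where 2: "e > 0" "\<And>y f. y \<in> S \<Longrightarrow> norm (y - x) < e \<Longrightarrow> f \<in> G \<Longrightarrow> norm (f y) \<le> L"
    using assms(2) \<open>x \<in> S\<close> unfolding locally_bounded_family_def by metis
  have "norm (h y) \<le> K + L"
    if "y \<in> S" "norm (y - x) < min d e" "h \<in> {(\<lambda>x. f x + g x) | f g. f \<in> F \<and> g \<in> G}" for y h
  proof -
    from that(3) obtain f g where "h = (\<lambda>x. f x + g x)" "f \<in> F" "g \<in> G" by blast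
    then show ?thesis using 1(2)[OF that(1), of f] 2(2)[OF that(1), of g] that(2)
      by (auto intro: norm_triangle_mono)
  qed
  then show "\<exists>\<delta>>0. \<exists>K. \<forall>y\<in>S. norm (y - x) < \<delta> \<longrightarrow> (\<forall>f\<in>{(\<lambda>x. f x + g x) | f g. f \<in> F \<and> g \<in> G}. norm (f y) \<le> K)"
    using 1(1) 2(1) by (intro exI[of _ "min d e"] exI[of _ "K + L"] conjI) auto
qed

lemma Ck_family_add:
  assumes "open S"
  shows "Ck_family n S F \<Longrightarrow> Ck_family n S G \<Longrightarrow> Ck_family n S {(\<lambda>x. f x + g x) | f g. f \<in> F \<and> g \<in> G}"
proof (induction n arbitrary: F G)
  case (0 F G) then show ?case by (auto intro: locally_bounded_family_add)
next
  case (Suc n F G)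
  obtain F' where F': "Ck_family n S F'"
    "\<And>f x. f \<in> F \<Longrightarrow> x \<in> S \<Longrightarrow> (f has_derivative frechet_derivative f (at x)) (at x)"
    "\<And>f v. f \<in> F \<Longrightarrow> norm v \<le> 1 \<Longrightarrow> (\<lambda>x. frechet_derivative f (at x) v) \<in> F'"
    by (rule Ck_family_SucE[OF Suc.prems(1) assms]) blast
  obtain G' where G': "Ck_family n S G'"
    "\<And>f x. f \<in> G \<Longrightarrow> x \<in> S \<Longrightarrow> (f has_derivative frechet_derivative f (at x)) (at x)"
    "\<And>f v. f \<in> G \<Longrightarrow> norm v \<le> 1 \<Longrightarrow> (\<lambda>x. frechet_derivative f (at x) v) \<in> G'"
    by (rule Ck_family_SucE[OF Suc.prems(2) assms]) blast
  show ?case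
  proof (rule Ck_family_SucI[OF assms _ _ Suc.IH[OF F'(1) G'(1)]])
    show "locally_bounded_family S {(\<lambda>x. f x + g x) | f g. f \<in> F \<and> g \<in> G}"
      by (intro locally_bounded_family_add Ck_family_bounded[OF Suc.prems(1)] Ck_family_bounded[OF
          Suc.prems(2)])
    fix h assume "h \<in> {(\<lambda>x. f x + g x) | f g. f \<in> F \<and> g \<in> G}"
    then obtain f g where h: "h = (\<lambda>x. f x + g x)" "f \<in> F" "g \<in> G" by blast
    let ?h' = "\<lambda>x v. frechet_derivative f (at x) v + frechet_derivative g (at x) v"
    have "(h has_derivative ?h' x) (at x)" if "x \<in> S" for x
      unfolding h(1) by (intro has_derivative_add F'(2) G'(2) h that)
    moreover have "\<exists>g\<in>{(\<lambda>x. f x + g x) | f g. f \<in> F' \<and> g \<in> G'}. \<forall>x\<in>S. ?h' x v = g x" if "norm v \<le> 1" for v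
      by (rule bexI[of _ "\<lambda>x. ?h' x v"]) (use F'(3)[OF h(2) that] G'(3)[OF h(3) that] in auto)
    ultimately show "\<exists>f'. (\<forall>x\<in>S. (h has_derivative f' x) (at x)) \<and>
       (\<forall>v. norm v \<le> 1 \<longrightarrow> (\<exists>g\<in>{(\<lambda>x. f x + g x) | f g. f \<in> F' \<and> g \<in> G'}. \<forall>x\<in>S. f' x v = g x))"
      by (intro exI[of _ ?h']) blast
  qed
qed

text \<open>By the Leibniz rule a derivative is a sum of two expressions of the same shape, with one
  of the families replaced by its derivatives, so the induction hypothesis applies to both
  summands.\<close>

lemma Ck_family_bilinear:
  assumes "open S" "bounded_bilinear b"
  shows "Ck_family n S F \<Longrightarrow> Ck_family n S G \<Longrightarrow> Ck_family n S {(\<lambda>x. b (f x) (g x)) | f g. f \<in> F \<and> g \<in> G}"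
proof (induction n arbitrary: F G)
  have bnd: "locally_bounded_family S {(\<lambda>x. b (f x) (g x)) | f g. f \<in> F \<and> g \<in> G}"
    if "locally_bounded_family S F" "locally_bounded_family S G" for F G
    unfolding locally_bounded_family_def
  proof
    fix x assume "x \<in> S"
    from that(1) \<open>x \<in> S\<close> obtain d K where 1: "d > 0" "\<And>y f. y \<in> S \<Longrightarrow> norm (y - x) < d \<Longrightarrow> f \<in> F \<Longrightarrow> norm (f y) \<le> K"
      unfolding locally_bounded_family_def by metis
    from that(2) \<open>x \<in> S\<close> obtain e L where 2: "e > 0" "\<And>y f. y \<in> S \<Longrightarrow> norm (y - x) < e \<Longrightarrow> f \<in> G \<Longrightarrow> norm (f y) \<le> L"
      unfolding locally_bounded_family_def by metis
    obtain C where C: "C > 0" "\<And>u v. norm (b u v) \<le> norm u * norm v * C"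
      using bounded_bilinear.pos_bounded[OF assms(2)] by blast
    have "norm (h y) \<le> K * L * C"
      if "y \<in> S" "norm (y - x) < min d e" "h \<in> {(\<lambda>x. b (f x) (g x)) | f g. f \<in> F \<and> g \<in> G}" for y h
    proof -
      from that(3) obtain f g where h: "h = (\<lambda>x. b (f x) (g x))" "f \<in> F" "g \<in> G" by blast
      have f: "norm (f y) \<le> K" and g: "norm (g y) \<le> L"
        using 1(2)[OF that(1), of f] 2(2)[OF that(1), of g] that(2) h by auto
      have "norm (f y) * norm (g y) * C \<le> K * L * C"
        using C(1) f g order_trans[OF norm_ge_zero f] by (intro mult_right_mono mult_mono) auto
      then show ?thesis using C(2)[of "f y" "g y"] h(1) by simp
    qed
    then show "\<exists>\<delta>>0. \<exists>K. \<forall>y\<in>S. norm (y - x) < \<delta> \<longrightarrow> (\<forall>f\<in>{(\<lambda>x. b (f x) (g x)) | f g. f \<in> F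
        \<and> g \<in> G}. norm (f y) \<le> K)"
      using 1(1) 2(1) by (intro exI[of _ "min d e"] exI[of _ "K * L * C"] conjI) auto
  qed
  {
    case (0 F G) then show ?case by (auto intro: bnd)
  next
    case (Suc n F G)
    obtain F' where F': "Ck_family n S F'" "Ck_family n S F"
      "\<And>f x. f \<in> F \<Longrightarrow> x \<in> S \<Longrightarrow> (f has_derivative frechet_derivative f (at x)) (at x)"
      "\<And>f v. f \<in> F \<Longrightarrow> norm v \<le> 1 \<Longrightarrow> (\<lambda>x. frechet_derivative f (at x) v) \<in> F'"
      by (rule Ck_family_SucE[OF Suc.prems(1) assms(1)]) blast
    obtain G' where G': "Ck_family n S G'" "Ck_family n S G"
      "\<And>f x. f \<in> G \<Longrightarrow> x \<in> S \<Longrightarrow> (f has_derivative frechet_derivative f (at x)) (at x)"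
      "\<And>f v. f \<in> G \<Longrightarrow> norm v \<le> 1 \<Longrightarrow> (\<lambda>x. frechet_derivative f (at x) v) \<in> G'"
      by (rule Ck_family_SucE[OF Suc.prems(2) assms(1)]) blast
    let ?B = "\<lambda>F G. {(\<lambda>x. b (f x) (g x)) | f g. f \<in> F \<and> g \<in> G}"
    let ?A = "{(\<lambda>x. p x + q x) | p q. p \<in> ?B F G' \<and> q \<in> ?B F' G}"
    have A: "Ck_family n S ?A"
      by (rule Ck_family_add[OF assms(1) Suc.IH[OF F'(2) G'(1)] Suc.IH[OF F'(1) G'(2)]])
    show ?case
    proof (rule Ck_family_SucI[OF assms(1) _ _ A])
      show "locally_bounded_family S (?B F G)"
        by (intro bnd Ck_family_bounded[OF Suc.prems(1)] Ck_family_bounded[OF Suc.prems(2)])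
      fix h assume "h \<in> ?B F G"
      then obtain f g where h: "h = (\<lambda>x. b (f x) (g x))" "f \<in> F" "g \<in> G" by blast
      let ?h' = "\<lambda>x v. b (f x) (frechet_derivative g (at x) v) + b (frechet_derivative f (at x) v) (g x)"
      have "(h has_derivative ?h' x) (at x)" if "x \<in> S" for x
        unfolding h(1) by (rule bounded_bilinear.FDERIV[OF assms(2) F'(3)[OF h(2) that] G'(3)[OF h(3) that]])
      moreover have "\<exists>g\<in>?A. \<forall>x\<in>S. ?h' x v = g x" if "norm v \<le> 1" for v
      proof (rule bexI[of _ "\<lambda>x. ?h' x v"])
        have A: "(\<lambda>x. b (f x) (frechet_derivative g (at x) v)) \<in> ?B F G'"
          and B: "(\<lambda>x. b (frechet_derivative f (at x) v) (g x)) \<in> ?B F' G"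
          by (intro CollectI exI conjI refl, use F'(4)[OF h(2) that] G'(4)[OF h(3) that] h in simp_all)+
        show "(\<lambda>x. ?h' x v) \<in> ?A"
          by (rule CollectI, rule exI[of _ "\<lambda>x. b (f x) (frechet_derivative g (at x) v)"],
              rule exI[of _ "\<lambda>x. b (frechet_derivative f (at x) v) (g x)"], intro conjI refl A B)
      qed simp
      ultimately show "\<exists>f'. (\<forall>x\<in>S. (h has_derivative f' x) (at x)) \<and>
         (\<forall>v. norm v \<le> 1 \<longrightarrow> (\<exists>g\<in>?A. \<forall>x\<in>S. f' x v = g x))"
        by (intro exI[of _ ?h']) blast
    qed
  }
qed

lemma Ck_family_const:
  assumes "open S" "bounded C"
  shows "Ck_family n S {(\<lambda>x. c) | c. c \<in> C}"
  using assms(2)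
proof (induction n arbitrary: C)
  have bnd: "locally_bounded_family S {(\<lambda>x. c) | c. c \<in> C}" if "bounded C" for C :: "'b set"
  proof -
    from that obtain K where "\<And>c. c \<in> C \<Longrightarrow> norm c \<le> K" unfolding bounded_iff by blast
    then show ?thesis unfolding locally_bounded_family_def by (fastforce intro: exI[of _ 1] exI[of _ K])
  qed
  {
    case (0 C) then show ?case by (auto intro: bnd)
  next
    case (Suc n C)
    show ?case
      by (rule Ck_family_SucI[OF assms(1) bnd[OF Suc.prems] _ Suc.IH[of "{0}"]])
        (auto intro!: exI[of _ "\<lambda>x v. 0"])
  }
qed

text \<open>Evaluation is a bilinear pairing with the bounded family of constant unit vectors. This
  is how an operator-valued function enters as the family of directional derivatives of another
  one.\<close>

lemma Ck_family_blinfun_apply: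
  assumes "open S" "Ck_family n S F"
  shows "Ck_family n S {(\<lambda>x. blinfun_apply (f x) v) | f v. f \<in> F \<and> norm v \<le> 1}"
proof (rule Ck_family_subset[OF assms(1)])
  have "bounded {v :: 'b. norm v \<le> 1}" unfolding bounded_iff by auto
  from Ck_family_bilinear[OF assms(1) bounded_bilinear_blinfun_apply assms(2) Ck_family_const[OF assms(1)
      this]]
  show "Ck_family n S {(\<lambda>x. blinfun_apply (f x) (g x)) | f g. f \<in> F \<and> g \<in> {(\<lambda>x. c) | c. c \<in> {v. norm v
      \<le> 1}}}" .
  show "{(\<lambda>x. blinfun_apply (f x) v) | f v. f \<in> F \<and> norm v \<le> 1}
    \<subseteq> {(\<lambda>x. blinfun_apply (f x) (g x)) | f g. f \<in> F \<and> g \<in> {(\<lambda>x. c) | c. c \<in> {v. norm v \<le> 1}}}"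
  proof
    fix h assume "h \<in> {(\<lambda>x. blinfun_apply (f x) v) | f v. f \<in> F \<and> norm v \<le> 1}"
    then obtain f v where "h = (\<lambda>x. blinfun_apply (f x) v)" "f \<in> F" "norm v \<le> 1" by blast
    then show "h \<in> {(\<lambda>x. blinfun_apply (f x) (g x)) | f g. f \<in> F \<and> g \<in> {(\<lambda>x. c) | c. c \<in> {v. norm v \<le> 1}}}"
      by (intro CollectI exI[of _ f] exI[of _ "\<lambda>x. v"]) auto
  qed
qed

text \<open>A bounded linear map is a constant operator-valued function, so the bilinear rule for
  evaluation covers it.\<close>

lemma Ck_family_bounded_linear:
  assumes "open S" "bounded_linear l" "Ck_family n S {f}"
  shows "Ck_family n S {(\<lambda>x. l (f x))}"
proof (rule Ck_family_subset[OF assms(1)])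
  have l: "blinfun_apply (Blinfun l) = l" by (rule bounded_linear_Blinfun_apply[OF assms(2)])
  show "Ck_family n S {(\<lambda>x. blinfun_apply (g x) (h x)) | g h. g \<in> {(\<lambda>x. c) | c. c \<in> {Blinfun l}} \<and> h \<in> {f}}"
    by (intro Ck_family_bilinear[OF assms(1) bounded_bilinear_blinfun_apply] Ck_family_const assms) auto
  show "{(\<lambda>x. l (f x))} \<subseteq> {(\<lambda>x. blinfun_apply (g x) (h x)) | g h. g \<in> {(\<lambda>x. c) | c. c \<in> {Blinfun l}}
      \<and> h \<in> {f}}"
    by (auto simp: l intro!: exI[of _ "\<lambda>x. Blinfun l"])
qed

lemma Ck_family_Pair:
  assumes "open S" "Ck_family n S {f}" "Ck_family n S {g}"
  shows "Ck_family n S {(\<lambda>x. (f x, g x))}"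
proof (rule Ck_family_subset[OF assms(1)])
  have "Ck_family n S {(\<lambda>x. (f x, 0 :: 'c))}" "Ck_family n S {(\<lambda>x. (0 :: 'b, g x))}"
    using Ck_family_bounded_linear[OF assms(1) _ assms(2), of "\<lambda>u. (u, 0 :: 'c)"]
      Ck_family_bounded_linear[OF assms(1) _ assms(3), of "\<lambda>u. (0 :: 'b, u)"]
    by (simp_all add: bounded_linear_Pair bounded_linear_ident bounded_linear_zero)
  from Ck_family_add[OF assms(1) this] show
    "Ck_family n S {(\<lambda>x. p x + q x) | p q. p \<in> {(\<lambda>x. (f x, 0 :: 'c))} \<and> q \<in> {(\<lambda>x. (0 :: 'b, g x))}}" .
  show "{(\<lambda>x. (f x, g x))} \<subseteq> {(\<lambda>x. p x + q x) | p q. p \<in> {(\<lambda>x. (f x, 0 :: 'c))} \<and> q \<in> {(\<lambda>x. (0 :: 'b, g x))}}"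
    by (auto intro!: exI[of _ "\<lambda>x. (f x, 0 :: 'c)"] exI[of _ "\<lambda>x. (0 :: 'b, g x)"])
qed

lemma Ck_family_sum:
  assumes "open S" "Ck_family n S F"
  shows "Ck_family n S {(\<lambda>x. \<Sum>i<m::nat. f i x) | f. \<forall>i<m. f i \<in> F}"
proof (induction m)
  case 0
  show ?case by (rule Ck_family_subset[OF assms(1) Ck_family_const[OF assms(1), of "{0}"]]) auto
next
  case (Suc m)
  show ?case
    by (rule Ck_family_subset[OF assms(1) Ck_family_add[OF assms(1) Suc assms(2)]]) fastforce
qed

section \<open>The product rule for multilinear maps\<close>

text \<open>Frechet differentiability at \<open>x\<close> of \<open>M\<close> as a map into the
  bounded \<open>k\<close>-linear maps with their operator norm, written out on lists;
  \<open>M' w\<close> is the derivative in direction \<open>w\<close>. Multilinearity is demanded at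
  every \<open>y\<close>, also away from \<open>x\<close>.\<close>

definition uniform_derivative ::
    "nat \<Rightarrow> 'a::real_normed_vector \<Rightarrow> ('a \<Rightarrow> 'b::real_normed_vector list \<Rightarrow> 'c::real_normed_vector) \<Rightarrow>
     ('a \<Rightarrow> 'b list \<Rightarrow> 'c) \<Rightarrow> bool" where
  "uniform_derivative k x M M' \<longleftrightarrow>
     (\<forall>y. bounded_multilinear k (M y)) \<and> (\<forall>w. bounded_multilinear k (M' w)) \<and>
     (\<forall>us. length us = k \<longrightarrow> linear (\<lambda>w. M' w us)) \<and>
     (\<exists>K. \<forall>w us. length us = k \<longrightarrow> norm (M' w us) \<le> K * norm w * prod_list (map norm us)) \<and>
     (\<forall>\<epsilon>>0. \<forall>\<^sub>F y in nhds x. \<forall>us. length us = k \<longrightarrow>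
        norm (M y us - M x us - M' (y - x) us) \<le> \<epsilon> * norm (y - x) * prod_list (map norm us))"

lemma uniform_derivative_boundE:
  assumes "uniform_derivative k x M M'"
  obtains K where "K > 0" "\<And>w us. length us = k \<Longrightarrow> norm (M' w us) \<le> K * norm w * prod_list (map norm us)"
    "\<And>us. length us = k \<Longrightarrow> norm (M x us) \<le> K * prod_list (map norm us)"
proof -
  obtain K where K: "\<And>w us. length us = k \<Longrightarrow> norm (M' w us) \<le> K * norm w * prod_list (map norm us)"
    using assms unfolding uniform_derivative_def by blast
  obtain L where L: "L \<ge> 0" "\<And>us. length us = k \<Longrightarrow> norm (M x us) \<le> L * prod_list (map norm us)"
  proof -
    have "bounded_multilinear k (M x)" using assms unfolding uniform_derivative_def by blast
    then show ?thesis by (rule bounded_multilinear_bound) (rule that)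
  qed
  let ?K = "\<bar>K\<bar> + L + 1"
  show ?thesis
  proof (rule that[of ?K])
    fix w :: 'a and us assume l: "length (us :: 'b list) = k"
    have "K * norm w * prod_list (map norm us) \<le> ?K * norm w * prod_list (map norm us)"
      using L(1) by (intro mult_right_mono prod_list_norm_nonneg) auto
    then show "norm (M' w us) \<le> ?K * norm w * prod_list (map norm us)" using K[OF l, of w] by linarith
  next
    fix us assume l: "length (us :: 'b list) = k"
    have "L * prod_list (map norm us) \<le> ?K * prod_list (map norm us)"
      using L(1) by (intro mult_right_mono prod_list_norm_nonneg) auto
    then show "norm (M x us) \<le> ?K * prod_list (map norm us)" using L(2)[OF l] by linarith
  qed (use L in auto)
qed

lemma has_derivative_eventually:
  assumes "(f has_derivative f') (at x)" "\<epsilon> > 0"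
  shows "\<forall>\<^sub>F y in nhds x. norm (f y - f x - f' (y - x)) \<le> \<epsilon> * norm (y - x)"
  using assms unfolding has_derivative_at_alt eventually_nhds_metric dist_norm by meson

text \<open>The product rule for filling the first slot with a differentiable function. The estimate
  remains uniform in the other slots, so the rule can be iterated until no slot is left.\<close>

lemma uniform_derivative_apply:
  assumes M: "uniform_derivative (Suc k) x M M'" and h: "(h has_derivative h') (at x)"
  shows "uniform_derivative k x (\<lambda>y us. M y (h y # us)) (\<lambda>w us. M' w (h x # us) + M x (h' w # us))"
proof -
  have ml: "\<And>y. bounded_multilinear (Suc k) (M y)" "\<And>w. bounded_multilinear (Suc k) (M' w)"
    and lin: "\<And>us. length us = Suc k \<Longrightarrow> linear (\<lambda>w. M' w us)"
    and est: "\<And>\<epsilon>. \<epsilon> > 0 \<Longrightarrow> \<forall>\<^sub>F y in nhds x. \<forall>us. length us = Suc k \<longrightarrow>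
        norm (M y us - M x us - M' (y - x) us) \<le> \<epsilon> * norm (y - x) * prod_list (map norm us)"
    using M unfolding uniform_derivative_def by blast+
  obtain K where K: "K > 0" "\<And>w us. length us = Suc k \<Longrightarrow> norm (M' w us) \<le> K * norm w * prod_list (map norm us)"
    "\<And>us. length us = Suc k \<Longrightarrow> norm (M x us) \<le> K * prod_list (map norm us)"
    by (rule uniform_derivative_boundE[OF M]) blast
  have bl: "bounded_linear h'" using h by (rule has_derivative_bounded_linear)
  obtain L where L: "L > 0" "\<And>w. norm (h' w) \<le> norm w * L" using bounded_linear.pos_bounded[OF bl] by blast
  have bml_add: "bounded_multilinear k (\<lambda>us. p us + q us)"
    if p: "bounded_multilinear k p" and q: "bounded_multilinear k q" for p q :: "'b list \<Rightarrow> 'c"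
  proof -
    obtain A where A: "A \<ge> 0" "\<And>vs. length vs = k \<Longrightarrow> norm (p vs) \<le> A * prod_list (map norm vs)"
      by (rule bounded_multilinear_bound[OF p]) blast
    obtain B where B: "B \<ge> 0" "\<And>vs. length vs = k \<Longrightarrow> norm (q vs) \<le> B * prod_list (map norm vs)"
      by (rule bounded_multilinear_bound[OF q]) blast
    have "norm (p vs + q vs) \<le> (A + B) * prod_list (map norm vs)" if "length vs = k" for vs
      using norm_triangle_mono[OF A(2)[OF that] B(2)[OF that]] by (simp add: algebra_simps)
    then show ?thesis using p q unfolding bounded_multilinear_def by (auto intro!: linear_compose_add)
  qed
  show ?thesis unfolding uniform_derivative_def
  proof (intro conjI allI impI)
    fix y show "bounded_multilinear k (\<lambda>us. M y (h y # us))" by (rule bounded_multilinear_Cons[OF ml(1)])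
  next
    fix w show "bounded_multilinear k (\<lambda>us. M' w (h x # us) + M x (h' w # us))"
      by (intro bml_add bounded_multilinear_Cons ml)
  next
    fix us assume l: "length (us :: 'b list) = k"
    have "linear (\<lambda>w. M x (h' w # us))"
      using linear_compose[OF bounded_linear.linear[OF bl] bounded_multilinear_linear_hd[OF ml(1) l, of x]]
      by (simp add: o_def)
    then show "linear (\<lambda>w. M' w (h x # us) + M x (h' w # us))"
      using lin[of "h x # us"] l by (intro linear_compose_add) auto
  next
    show "\<exists>C. \<forall>w us. length us = k \<longrightarrow> norm (M' w (h x # us) + M x (h' w # us))
        \<le> C * norm w * prod_list (map norm us)"
    proof (intro exI[of _ "K * norm (h x) + K * L"] allI impI)
      fix w us assume l: "length (us :: 'b list) = k"
      define P where "P = prod_list (map norm us)"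
      have P: "P \<ge> 0" unfolding P_def by (rule prod_list_norm_nonneg)
      have 1: "norm (M' w (h x # us)) \<le> K * norm w * (norm (h x) * P)"
        using K(2)[of "h x # us" w] l by (simp add: P_def)
      have "norm (M x (h' w # us)) \<le> K * (norm (h' w) * P)" using K(3)[of "h' w # us"] l by (simp add: P_def)
      also have "\<dots> \<le> K * (norm w * L * P)" using K(1) L(2)[of w] P
          by (intro mult_left_mono mult_right_mono) auto
      finally have 2: "norm (M x (h' w # us)) \<le> K * (norm w * L * P)" .
      show "norm (M' w (h x # us) + M x (h' w # us)) \<le> (K * norm (h x) + K * L) * norm w
          * prod_list (map norm us)"
        using norm_triangle_mono[OF 1 2] unfolding P_def[symmetric] by (simp add: algebra_simps)
    qed
  next
    fix \<epsilon> :: real assume "\<epsilon> > 0"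
    \<comment> \<open>Adds up the three errors of the decomposition below:
      \<open>norm (h x) + 1\<close> bounds \<open>h y\<close> in the remainder of \<open>M\<close>,
      one \<open>K\<close> belongs to the change of \<open>h\<close> under \<open>M'\<close>, the
      other to the remainder of \<open>h\<close> under \<open>M x\<close>.\<close>
    define C where "C = norm (h x) + 1 + K + K"
    have C: "C > 0" using K(1) unfolding C_def by (simp add: add_nonneg_pos)
    define \<eta> where "\<eta> = \<epsilon> / C"
    have \<eta>: "\<eta> > 0" using \<open>\<epsilon> > 0\<close> C unfolding \<eta>_def by simp
    have cont: "(h \<longlongrightarrow> h x) (nhds x)"
      using has_derivative_continuous[OF h] by (simp add: continuous_at isCont_def tendsto_nhds_iff)
    have "\<forall>\<^sub>F y in nhds x. norm (h y - h x) < min 1 \<eta>"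
      using tendstoD[OF cont, of "min 1 \<eta>"] \<eta> by (simp add: dist_norm)
    with est[OF \<eta>] has_derivative_eventually[OF h \<eta>]
    show "\<forall>\<^sub>F y in nhds x. \<forall>us. length us = k \<longrightarrow>
        norm (M y (h y # us) - M x (h x # us) - (M' (y - x) (h x # us) + M x (h' (y - x) # us)))
        \<le> \<epsilon> * norm (y - x) * prod_list (map norm us)"
    proof eventually_elim
      case (elim y)
      show ?case
      proof (intro allI impI)
        fix us assume l: "length (us :: 'b list) = k"
        define P where "P = prod_list (map norm us)"
        have P: "P \<ge> 0" unfolding P_def by (rule prod_list_norm_nonneg)
        let ?w = "y - x"
        interpret Mx: linear "\<lambda>v. M x (v # us)" by (rule bounded_multilinear_linear_hd[OF ml(1) l])
        interpret M'w: linear "\<lambda>v. M' ?w (v # us)" by (rule bounded_multilinear_linear_hd[OF ml(2) l])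
        have eq: "M y (h y # us) - M x (h x # us) - (M' ?w (h x # us) + M x (h' ?w # us))
          = (M y (h y # us) - M x (h y # us) - M' ?w (h y # us)) + M' ?w ((h y - h x) # us)
            + M x ((h y - h x - h' ?w) # us)"
          by (simp add: Mx.diff M'w.diff)
        have hy: "norm (h y) \<le> norm (h x) + 1" using elim(3) norm_triangle_sub[of "h y" "h x"] by simp
        have 1: "norm (M y (h y # us) - M x (h y # us) - M' ?w (h y # us))
            \<le> \<eta> * norm ?w * ((norm (h x) + 1) * P)"
        proof -
          have "norm (M y (h y # us) - M x (h y # us) - M' ?w (h y # us)) \<le> \<eta> * norm ?w * (norm (h y) * P)"
            using elim(1)[rule_format, of "h y # us"] l by (simp add: P_def)
          also have "\<dots> \<le> \<eta> * norm ?w * ((norm (h x) + 1) * P)"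
            using \<eta> P hy by (intro mult_left_mono mult_right_mono) auto
          finally show ?thesis .
        qed
        have 2: "norm (M' ?w ((h y - h x) # us)) \<le> K * norm ?w * (\<eta> * P)"
        proof -
          have "norm (M' ?w ((h y - h x) # us)) \<le> K * norm ?w * (norm (h y - h x) * P)"
            using K(2)[of "(h y - h x) # us" ?w] l by (simp add: P_def)
          also have "\<dots> \<le> K * norm ?w * (\<eta> * P)"
            using K(1) P elim(3) by (intro mult_left_mono mult_right_mono) auto
          finally show ?thesis .
        qed
        have 3: "norm (M x ((h y - h x - h' ?w) # us)) \<le> K * (\<eta> * norm ?w * P)"
        proof -
          have "norm (M x ((h y - h x - h' ?w) # us)) \<le> K * (norm (h y - h x - h' ?w) * P)"
            using K(3)[of "(h y - h x - h' ?w) # us"] l by (simp add: P_def)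
          also have "\<dots> \<le> K * (\<eta> * norm ?w * P)"
            using K(1) P elim(2) by (intro mult_left_mono mult_right_mono) auto
          finally show ?thesis .
        qed
        have "norm (M y (h y # us) - M x (h x # us) - (M' ?w (h x # us) + M x (h' ?w # us)))
          \<le> \<eta> * norm ?w * ((norm (h x) + 1) * P) + K * norm ?w * (\<eta> * P) + K * (\<eta> * norm ?w * P)"
          unfolding eq by (rule norm_triangle_mono[OF norm_triangle_mono[OF 1 2] 3])
        also have "\<dots> = (\<eta> * C) * norm ?w * P" unfolding C_def by (simp add: algebra_simps)
        also have "\<dots> = \<epsilon> * norm ?w * P" using C unfolding \<eta>_def by simp
        finally show "norm (M y (h y # us) - M x (h x # us) - (M' ?w (h x # us) + M x (h' ?w # us)))
          \<le> \<epsilon> * norm ?w * prod_list (map norm us)" unfolding P_def .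
      qed
    qed
  qed
qed

lemma uniform_derivative_0:
  assumes "uniform_derivative 0 x M M'"
  shows "((\<lambda>y. M y []) has_derivative (\<lambda>w. M' w [])) (at x)"
  unfolding has_derivative_at_alt
proof (intro conjI allI impI)
  obtain K where K: "\<And>w us. length us = 0 \<Longrightarrow> norm (M' w us) \<le> K * norm w * prod_list (map norm us)"
    using assms unfolding uniform_derivative_def by blast
  show "bounded_linear (\<lambda>w. M' w [])"
    by (intro bounded_linear.intro bounded_linear_axioms.intro exI[of _ K])
      (use assms K[of "[]"] in \<open>auto simp: uniform_derivative_def ac_simps\<close>)
  fix e :: real assume "e > 0"
  then have "\<forall>\<^sub>F y in nhds x. norm (M y [] - M x [] - M' (y - x) []) \<le> e * norm (y - x)"
    using assms unfolding uniform_derivative_def by (auto elim: eventually_mono)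
  then show "\<exists>d>0. \<forall>y. norm (y - x) < d \<longrightarrow> norm (M y [] - M x [] - M' (y - x) []) \<le> e * norm (y - x)"
    by (simp add: eventually_nhds_metric dist_norm)
qed

text \<open>Filling the first slot leaves a map of one slot less that is again uniformly
  differentiable, so induction on \<open>hs\<close> yields the Leibniz sum one term at a
  time.\<close>

lemma has_derivative_multilinear_apply:
  assumes "uniform_derivative (length hs) x M M'"
    and "\<And>h. h \<in> set hs \<Longrightarrow> (h has_derivative h' h) (at x)"
  shows "((\<lambda>y. M y (map (\<lambda>h. h y) hs)) has_derivative
    (\<lambda>w. M' w (map (\<lambda>h. h x) hs) + (\<Sum>i<length hs. M x ((map (\<lambda>h. h x) hs)[i := h' (hs ! i) w])))) (at x)"
  using assms
proof (induction hs arbitrary: M M')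
  case (Nil M M')
  then show ?case using uniform_derivative_0 by fastforce
next
  case (Cons h hs M M')
  let ?N = "\<lambda>y us. M y (h y # us)" and ?N' = "\<lambda>w us. M' w (h x # us) + M x (h' h w # us)"
  have "uniform_derivative (length hs) x ?N ?N'"
    using Cons.prems by (intro uniform_derivative_apply) auto
  from Cons.IH[OF this] Cons.prems(2)
  show ?case
    by (simp only: length_Cons list.map sum.lessThan_Suc_shift) (simp add: add.assoc)
qed

text \<open>The chain rule in operator norm. The value 0 where \<open>f y\<close> leaves
  \<open>T\<close> serves only to have a multilinear map at every \<open>y\<close>; near
  \<open>x\<close> it does not occur.\<close>

lemma jet_uniform_derivative:
  fixes f :: "'a::real_normed_vector \<Rightarrow> 'b::real_normed_vector"
  assumes D: "jet T D" and f: "(f has_derivative f') (at x)" "f x \<in> T"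
  shows "uniform_derivative k x (\<lambda>y. if f y \<in> T then D k (f y) else (\<lambda>us. 0)) (\<lambda>w us. D (Suc k) (f x) (f'
      w # us))"
proof -
  have ml: "\<And>k y. y \<in> T \<Longrightarrow> bounded_multilinear k (D k y)" using D by (auto simp: jet_def)
  obtain K where K: "K \<ge> 0" "\<And>us. length us = Suc k \<Longrightarrow> norm (D (Suc k) (f x) us) \<le> K * prod_list (map norm us)"
    by (rule bounded_multilinear_bound[OF ml[OF f(2)]]) blast
  have bl: "bounded_linear f'" using f(1) by (rule has_derivative_bounded_linear)
  obtain L where L: "L > 0" "\<And>w. norm (f' w) \<le> norm w * L" using bounded_linear.pos_bounded[OF bl] by blast
  have zero: "bounded_multilinear k (\<lambda>us :: 'b list. 0 :: 'c)"
    unfolding bounded_multilinear_def by (auto intro!: exI[of _ 0] simp: linear_zero)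
  show ?thesis unfolding uniform_derivative_def
  proof (intro conjI allI impI)
    fix y show "bounded_multilinear k (if f y \<in> T then D k (f y) else (\<lambda>us. 0))" using ml zero by auto
  next
    fix w show "bounded_multilinear k (\<lambda>us. D (Suc k) (f x) (f' w # us))"
      by (rule bounded_multilinear_Cons[OF ml[OF f(2)]])
  next
    fix us assume l: "length (us :: 'b list) = k"
    show "linear (\<lambda>w. D (Suc k) (f x) (f' w # us))"
      using linear_compose[OF bounded_linear.linear[OF bl] bounded_multilinear_linear_hd[OF ml[OF f(2)] l]]
      by (simp add: o_def)
  next
    show "\<exists>C. \<forall>w us. length us = k \<longrightarrow> norm (D (Suc k) (f x) (f' w # us))
        \<le> C * norm w * prod_list (map norm us)"
    proof (intro exI[of _ "K * L"] allI impI)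
      fix w us assume l: "length (us :: 'b list) = k"
      have "norm (D (Suc k) (f x) (f' w # us)) \<le> K * (norm (f' w) * prod_list (map norm us))"
        using K(2)[of "f' w # us"] l by simp
      also have "\<dots> \<le> K * ((norm w * L) * prod_list (map norm us))"
        using K(1) L(2)[of w] by (intro mult_left_mono mult_right_mono prod_list_norm_nonneg) auto
      finally show "norm (D (Suc k) (f x) (f' w # us)) \<le> K * L * norm w * prod_list (map norm us)"
        by (simp add: ac_simps)
    qed
  next
    fix \<epsilon> :: real assume "\<epsilon> > 0"
    \<comment> \<open>\<open>L + 1\<close> bounds the difference quotients of \<open>f\<close> near
      \<open>x\<close>, for which \<open>\<eta>\<close> must be at most 1; \<open>K\<close>
      multiplies the remainder of \<open>f\<close>.\<close>
    define C where "C = L + 1 + K"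
    have C: "C > 0" using K(1) L(1) unfolding C_def by simp
    define \<eta> where "\<eta> = min 1 (\<epsilon> / C)"
    have \<eta>: "\<eta> > 0" "\<eta> \<le> 1" "\<eta> * C \<le> \<epsilon>"
    using \<open>\<epsilon> > 0\<close> C mult_right_mono[of \<eta> "\<epsilon> / C" C] unfolding \<eta>_def by auto
    have cont: "(f \<longlongrightarrow> f x) (nhds x)"
      using has_derivative_continuous[OF f(1)] by (simp add: continuous_at isCont_def tendsto_nhds_iff)
    obtain d where d: "d > 0" "\<And>y. norm (y - f x) < d \<Longrightarrow> y \<in> T"
      "\<And>y vs. norm (y - f x) < d \<Longrightarrow> length vs = k \<Longrightarrow>
         norm (D k y vs - D k (f x) vs - D (Suc k) (f x) ((y - f x) # vs))
             \<le> \<eta> * norm (y - f x) * prod_list (map norm vs)"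
      by (rule jet_estimate[OF D f(2) \<eta>(1), of k]) blast
    have "\<forall>\<^sub>F y in nhds x. norm (f y - f x) < d"
      using tendstoD[OF cont d(1)] by (simp add: dist_norm)
    with has_derivative_eventually[OF f(1) \<eta>(1)]
    show "\<forall>\<^sub>F y in nhds x. \<forall>us. length us = k \<longrightarrow>
        norm ((if f y \<in> T then D k (f y) else (\<lambda>us. 0)) us - (if f x \<in> T then D k (f x) else (\<lambda>us. 0)) us
          - D (Suc k) (f x) (f' (y - x) # us)) \<le> \<epsilon> * norm (y - x) * prod_list (map norm us)"
    proof eventually_elim
      case (elim y)
      show ?case
      proof (intro allI impI)
        fix us assume l: "length (us :: 'b list) = k"
        define P where "P = prod_list (map norm us)"
        have P: "P \<ge> 0" unfolding P_def by (rule prod_list_norm_nonneg)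
        let ?w = "y - x"
        interpret Dx: linear "\<lambda>v. D (Suc k) (f x) (v # us)"
            by (rule bounded_multilinear_linear_hd[OF ml[OF f(2)] l])
        have eq: "D k (f y) us - D k (f x) us - D (Suc k) (f x) (f' ?w # us)
          = (D k (f y) us - D k (f x) us - D (Suc k) (f x) ((f y - f x) # us)) + D (Suc k) (f x) ((f y
              - f x - f' ?w) # us)"
          by (simp add: Dx.diff)
        have "norm (f y - f x) \<le> norm (f' ?w) + norm (f y - f x - f' ?w)"
          using norm_triangle_sub[of "f y - f x" "f' ?w"] by simp
        also have "\<dots> \<le> norm ?w * L + 1 * norm ?w"
          using L(2)[of ?w] elim(1) mult_right_mono[OF \<eta>(2) norm_ge_zero[of ?w]] by linarith
        finally have n: "norm (f y - f x) \<le> (L + 1) * norm ?w" by (simp add: algebra_simps)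
        have 1: "norm (D k (f y) us - D k (f x) us - D (Suc k) (f x) ((f y - f x) # us))
            \<le> \<eta> * ((L + 1) * norm ?w) * P"
          using d(3)[OF elim(2) l] mult_right_mono[OF mult_left_mono[OF n less_imp_le[OF \<eta>(1)]] P]
          unfolding P_def by linarith
        have "norm (D (Suc k) (f x) ((f y - f x - f' ?w) # us)) \<le> K * (norm (f y - f x - f' ?w) * P)"
          using K(2)[of "(f y - f x - f' ?w) # us"] l by (simp add: P_def)
        also have "\<dots> \<le> K * (\<eta> * norm ?w * P)" using K(1) elim(1) P
            by (intro mult_left_mono mult_right_mono) auto
        finally have 2: "norm (D (Suc k) (f x) ((f y - f x - f' ?w) # us)) \<le> K * (\<eta> * norm ?w * P)" .
        have "norm (D k (f y) us - D k (f x) us - D (Suc k) (f x) (f' ?w # us))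
            \<le> \<eta> * ((L + 1) * norm ?w) * P + K * (\<eta> * norm ?w * P)"
          unfolding eq by (rule norm_triangle_mono[OF 1 2])
        also have "\<dots> = (\<eta> * C) * (norm ?w * P)" unfolding C_def by (simp add: algebra_simps)
        also have "\<dots> \<le> \<epsilon> * (norm ?w * P)" using \<eta>(3) P by (intro mult_right_mono) auto
        finally show "norm ((if f y \<in> T then D k (f y) else (\<lambda>us. 0)) us - (if f x \<in> T then D k (f x) else
            (\<lambda>us. 0)) us
          - D (Suc k) (f x) (f' ?w # us)) \<le> \<epsilon> * norm ?w * prod_list (map norm us)"
          using d(2)[OF elim(2)] f(2) by (simp add: P_def mult.assoc)
      qed
    qed
  qed
qed

lemma jet_compose_has_derivative:
  assumes D: "jet T D" and f: "(f has_derivative f') (at x)" "open S" "x \<in> S" "f ` S \<subseteq> T"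
    and h: "\<And>h. h \<in> set hs \<Longrightarrow> (h has_derivative h' h) (at x)" and l: "length hs = j"
  shows "((\<lambda>y. D j (f y) (map (\<lambda>h. h y) hs)) has_derivative
    (\<lambda>w. D (Suc j) (f x) (f' w # map (\<lambda>h. h x) hs) +
       (\<Sum>i<j. D j (f x) ((map (\<lambda>h. h x) hs)[i := h' (hs ! i) w])))) (at x)"
proof -
  have fx: "f x \<in> T" using f by blast
  let ?M = "\<lambda>y. if f y \<in> T then D j (f y) else (\<lambda>us. 0)"
  have "((\<lambda>y. ?M y (map (\<lambda>h. h y) hs)) has_derivative
    (\<lambda>w. D (Suc j) (f x) (f' w # map (\<lambda>h. h x) hs) +
       (\<Sum>i<length hs. ?M x ((map (\<lambda>h. h x) hs)[i := h' (hs ! i) w])))) (at x)"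
    by (rule has_derivative_multilinear_apply[OF _ h])
      (use jet_uniform_derivative[OF D f(1) fx, of j] l in simp_all)
  then have "((\<lambda>y. ?M y (map (\<lambda>h. h y) hs)) has_derivative
    (\<lambda>w. D (Suc j) (f x) (f' w # map (\<lambda>h. h x) hs) +
       (\<Sum>i<j. D j (f x) ((map (\<lambda>h. h x) hs)[i := h' (hs ! i) w])))) (at x)"
    using fx l by simp
  then show ?thesis
    by (rule has_derivative_transform_within_open[OF _ f(2,3)]) (use f(4) in auto)
qed

section \<open>Characterization and closure properties of smooth maps\<close>

text \<open>Differentiating an evaluation of level \<open>k\<close> in a unit direction prepends
  that direction and gives an evaluation of level \<open>Suc k\<close>; the induction therefore runs
  over all levels at once.\<close>

lemma jet_family:
  assumes D: "jet S D"
  shows "Ck_family n S {(\<lambda>x. D k x vs) | vs. length vs = k \<and> (\<forall>v\<in>set vs. norm v \<le> 1)}"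
proof (induction n arbitrary: k)
  have bnd: "locally_bounded_family S {(\<lambda>x. D k x vs) | vs. length vs = k \<and> (\<forall>v\<in>set vs. norm v \<le> 1)}" for k
    unfolding locally_bounded_family_def
  proof
    fix x assume "x \<in> S"
    obtain d K where d: "d > 0" "K \<ge> 0" "\<And>y vs. norm (y - x) < d \<Longrightarrow> length vs = k \<Longrightarrow>
        norm (D k y vs) \<le> K * prod_list (map norm vs)"
      by (rule jet_bound[OF D \<open>x \<in> S\<close>]) blast
    have "norm (D k y vs) \<le> K" if "norm (y - x) < d" "length vs = k" "\<forall>v\<in>set vs. norm v \<le> 1" for y vs
    proof -
      have "K * prod_list (map norm vs) \<le> K * 1"
        using that(3) d(2) by (intro mult_left_mono prod_list_norm_le_1) auto
      then show ?thesis using d(3)[OF that(1,2)] by linarith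
    qed
    then show "\<exists>\<delta>>0. \<exists>K. \<forall>y\<in>S. norm (y - x) < \<delta> \<longrightarrow>
      (\<forall>f\<in>{(\<lambda>x. D k x vs) | vs. length vs = k \<and> (\<forall>v\<in>set vs. norm v \<le> 1)}. norm (f y) \<le> K)"
      using d(1) by (intro exI[of _ d] exI[of _ K] conjI) auto
  qed
  {
    case (0 k) then show ?case by (simp add: bnd)
  next
    case (Suc n k)
    show ?case
    proof (rule Ck_family_SucI[OF _ bnd _ Suc.IH[of "Suc k"]])
      show "open S" using D by (simp add: jet_def)
      fix f assume "f \<in> {(\<lambda>x. D k x vs) | vs. length vs = k \<and> (\<forall>v\<in>set vs. norm v \<le> 1)}"
      then obtain vs where vs: "f = (\<lambda>x. D k x vs)" "length vs = k" "\<forall>v\<in>set vs. norm v \<le> 1" by blast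
      show "\<exists>f'. (\<forall>x\<in>S. (f has_derivative f' x) (at x)) \<and> (\<forall>v. norm v \<le> 1 \<longrightarrow>
         (\<exists>g\<in>{(\<lambda>x. D (Suc k) x vs) | vs. length vs = Suc k \<and> (\<forall>v\<in>set vs. norm v \<le> 1)}. \<forall>x\<in>S. f' x v = g x))"
      proof (intro exI[of _ "\<lambda>x w. D (Suc k) x (w # vs)"] conjI ballI allI impI)
        show "(f has_derivative (\<lambda>w. D (Suc k) x (w # vs))) (at x)" if "x \<in> S" for x
          unfolding vs(1) by (rule jet_has_derivative[OF D that vs(2)])
        fix v :: 'a assume "norm v \<le> 1"
        then show "\<exists>g\<in>{(\<lambda>x. D (Suc k) x vs) | vs. length vs = Suc k \<and> (\<forall>v\<in>set vs. norm v \<le> 1)}.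
           \<forall>x\<in>S. D (Suc k) x (v # vs) = g x"
          by (intro bexI[of _ "\<lambda>x. D (Suc k) x (v # vs)"] ballI refl CollectI exI[of _ "v # vs"]) (use vs
              in auto)
      qed
    qed
  }
qed

lemma smooth_on_open: "smooth_on S f \<Longrightarrow> open S"
  by (simp add: smooth_on_def)

lemma smooth_on_imp_Ck_family:
  assumes "smooth_on S f"
  shows "Ck_family n S {f}"
proof -
  obtain D where D: "jet S D" "\<And>x. x \<in> S \<Longrightarrow> D 0 x [] = f x"
    using assms unfolding smooth_on_iff_jet by blast
  show ?thesis
    by (rule Ck_family_cong[OF smooth_on_open[OF assms] jet_family[OF D(1), of n 0]]) (use D(2) in auto)
qed

section \<open>Composition of smooth maps\<close>

lemma add_memI: "p \<in> P \<Longrightarrow> q \<in> Q \<Longrightarrow> (\<lambda>x. p x + q x) \<in> {(\<lambda>x. f x + g x) | f g. f \<in> P \<and> g \<in> Q}"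
  by blast

text \<open>The inductive content of the Faa di Bruno formula without the formula: expressions that
  insert functions from a family into a level of the jet along \<open>f\<close> are closed under
  differentiation. Order 0 means local boundedness only, so continuity of \<open>f\<close> is
  assumed separately.\<close>

lemma Ck_family_jet_compose:
  assumes D: "jet T D" and "open S" and f: "f ` S \<subseteq> T" "continuous_on S f"
  shows "Ck_family n S {f} \<Longrightarrow> Ck_family n S H \<Longrightarrow>
    Ck_family n S {(\<lambda>x. D j (f x) (map (\<lambda>h. h x) hs)) | hs. length hs = j \<and> set hs \<subseteq> H}"
proof (induction n arbitrary: j H)
  let ?F = "\<lambda>j H. {(\<lambda>x. D j (f x) (map (\<lambda>h. h x) hs)) | hs. length hs = j \<and> set hs \<subseteq> H}"
  have bnd: "locally_bounded_family S (?F j H)" if "locally_bounded_family S H" for j H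
    unfolding locally_bounded_family_def
  proof
    fix x assume "x \<in> S"
    then have "f x \<in> T" using f by blast
    obtain d K where d: "d > 0" "K \<ge> 0" "\<And>y vs. norm (y - f x) < d \<Longrightarrow> length vs = j \<Longrightarrow>
        norm (D j y vs) \<le> K * prod_list (map norm vs)"
      by (rule jet_bound[OF D \<open>f x \<in> T\<close>]) blast
    from that \<open>x \<in> S\<close> obtain e L where e: "e > 0" "\<And>y h. y \<in> S \<Longrightarrow> norm (y - x) < e \<Longrightarrow> h \<in> H \<Longrightarrow> norm (h y) \<le> L"
      unfolding locally_bounded_family_def by metis
    obtain e' where e': "e' > 0" "\<And>y. y \<in> S \<Longrightarrow> norm (y - x) < e' \<Longrightarrow> norm (f y - f x) < d"
      using f(2) \<open>x \<in> S\<close> d(1) unfolding continuous_on_iff dist_norm by metis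
    have "norm (g y) \<le> K * \<bar>L\<bar> ^ j" if y: "y \<in> S" "norm (y - x) < min e e'" and g: "g \<in> ?F j H" for y g
    proof -
      obtain hs where hs: "g = (\<lambda>x. D j (f x) (map (\<lambda>h. h x) hs))" "length hs = j" "set hs \<subseteq> H" using g
          by blast
      have "prod_list (map norm (map (\<lambda>h. h y) hs)) \<le> \<bar>L\<bar> ^ length hs" using hs(3)
      proof (induction hs)
        case (Cons h hs)
        have "norm (h y) \<le> \<bar>L\<bar>" using e(2)[OF y(1), of h] y(2) Cons.prems by auto
        moreover have "0 \<le> prod_list (map norm (map (\<lambda>h. h y) hs))" by (rule prod_list_norm_nonneg)
        ultimately show ?case using Cons by (auto intro!: mult_mono)
      qed simp
      then have "K * prod_list (map norm (map (\<lambda>h. h y) hs)) \<le> K * \<bar>L\<bar> ^ j"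
        using d(2) hs(2) by (intro mult_left_mono) auto
      moreover have "norm (g y) \<le> K * prod_list (map norm (map (\<lambda>h. h y) hs))"
        unfolding hs(1) using y hs(2) by (intro d(3) e'(2)) auto
      ultimately show ?thesis by linarith
    qed
    then show "\<exists>\<delta>>0. \<exists>K. \<forall>y\<in>S. norm (y - x) < \<delta> \<longrightarrow> (\<forall>g\<in>?F j H. norm (g y) \<le> K)"
      using e(1) e'(1) by (intro exI[of _ "min e e'"] exI[of _ "K * \<bar>L\<bar> ^ j"] conjI) auto
  qed
  {
    case (0 j H) then show ?case using bnd[of H j] by simp
  next
    case (Suc n j H)
    obtain F' where F': "Ck_family n S F'" "Ck_family n S {f}"
      "\<And>g x. g \<in> {f} \<Longrightarrow> x \<in> S \<Longrightarrow> (g has_derivative frechet_derivative g (at x)) (at x)"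
      "\<And>g v. g \<in> {f} \<Longrightarrow> norm v \<le> 1 \<Longrightarrow> (\<lambda>x. frechet_derivative g (at x) v) \<in> F'"
      by (rule Ck_family_SucE[OF Suc.prems(1) assms(2)]) blast
    obtain H' where H': "Ck_family n S H'" "Ck_family n S H"
      "\<And>h x. h \<in> H \<Longrightarrow> x \<in> S \<Longrightarrow> (h has_derivative frechet_derivative h (at x)) (at x)"
      "\<And>h v. h \<in> H \<Longrightarrow> norm v \<le> 1 \<Longrightarrow> (\<lambda>x. frechet_derivative h (at x) v) \<in> H'"
      by (rule Ck_family_SucE[OF Suc.prems(2) assms(2)]) blast
    \<comment> \<open>A derivative either passes to the next level, with a derivative of
      \<open>f\<close> as new first argument, or replaces one inserted function by its derivative.
      Both kinds of expression are built from \<open>A\<close>.\<close>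
    define A where "A = F' \<union> H' \<union> H"
    have A: "Ck_family n S A" unfolding A_def by (intro Ck_family_Un F' H' assms)
    let ?S = "{(\<lambda>x. \<Sum>i<j. g i x) | g. \<forall>i<j. g i \<in> ?F j A}"
    let ?G = "{(\<lambda>x. p x + q x) | p q. p \<in> ?F (Suc j) A \<and> q \<in> ?S}"
    have G: "Ck_family n S ?G"
      by (intro Ck_family_add Ck_family_sum assms Suc.IH[OF F'(2) A])
    show ?case
    proof (rule Ck_family_SucI[OF assms(2) bnd[OF Ck_family_bounded[OF Suc.prems(2)]] _ G])
      fix g assume "g \<in> ?F j H"
      then obtain hs where hs: "g = (\<lambda>x. D j (f x) (map (\<lambda>h. h x) hs))" "length hs = j" "set hs \<subseteq> H" by blast
      let ?f' = "\<lambda>x. frechet_derivative f (at x)" and ?h' = "\<lambda>h x. frechet_derivative h (at x)"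
      let ?g' = "\<lambda>x w. D (Suc j) (f x) (?f' x w # map (\<lambda>h. h x) hs) +
         (\<Sum>i<j. D j (f x) ((map (\<lambda>h. h x) hs)[i := ?h' (hs ! i) x w]))"
      have "(g has_derivative ?g' x) (at x)" if "x \<in> S" for x
        unfolding hs(1)
        by (rule jet_compose_has_derivative[OF D _ assms(2) that f(1) _ hs(2), where h' = "\<lambda>h. ?h' h x"])
          (use F'(3) H'(3) hs(3) that in auto)
      moreover have "\<exists>k\<in>?G. \<forall>x\<in>S. ?g' x v = k x" if v: "norm v \<le> 1" for v
      proof (rule bexI[of _ "\<lambda>x. ?g' x v"])
        have P: "(\<lambda>x. D (Suc j) (f x) (?f' x v # map (\<lambda>h. h x) hs)) \<in> ?F (Suc j) A"
          by (rule CollectI, rule exI[of _ "(\<lambda>x. ?f' x v) # hs"]) (use hs F'(4)[OF _ v] in \<open>auto simp: A_def\<close>)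
        have Q: "(\<lambda>x. D j (f x) ((map (\<lambda>h. h x) hs)[i := ?h' (hs ! i) x v])) \<in> ?F j A" if "i < j" for i
        proof (rule CollectI, rule exI[of _ "hs[i := (\<lambda>x. ?h' (hs ! i) x v)]"], intro conjI)
          show "(\<lambda>x. D j (f x) ((map (\<lambda>h. h x) hs)[i := ?h' (hs ! i) x v])) =
            (\<lambda>x. D j (f x) (map (\<lambda>h. h x) (hs[i := (\<lambda>x. ?h' (hs ! i) x v)])))" by (simp add: map_update)
          have "hs ! i \<in> H" using hs that by auto
          then have "(\<lambda>x. ?h' (hs ! i) x v) \<in> A" using H'(4)[OF _ v] unfolding A_def by blast
          then show "set (hs[i := (\<lambda>x. ?h' (hs ! i) x v)]) \<subseteq> A"
            using set_update_subset_insert[of hs i "\<lambda>x. ?h' (hs ! i) x v"] hs(3) unfolding A_def by blast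
        qed (use hs in simp)
        have "(\<lambda>x. \<Sum>i<j. D j (f x) ((map (\<lambda>h. h x) hs)[i := ?h' (hs ! i) x v])) \<in> ?S"
          by (rule CollectI, rule exI[of _ "\<lambda>i x. D j (f x) ((map (\<lambda>h. h x) hs)[i := ?h' (hs ! i) x v])"])
            (use Q in blast)
        then show "(\<lambda>x. ?g' x v) \<in> ?G" by (rule add_memI[OF P])
      qed simp
      ultimately show "\<exists>g'. (\<forall>x\<in>S. (g has_derivative g' x) (at x)) \<and>
         (\<forall>v. norm v \<le> 1 \<longrightarrow> (\<exists>k\<in>?G. \<forall>x\<in>S. g' x v = k x))"
        by (intro exI[of _ ?g']) blast
    qed
  }
qed

text \<open>The inner function has finite order here because \<open>smooth_on_ode\<close> composes
  with a solution whose smoothness is still being established.\<close>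

lemma Ck_family_compose:
  assumes g: "smooth_on T g" and "open S" "f ` S \<subseteq> T" "continuous_on S f" "Ck_family n S {f}"
  shows "Ck_family n S {(\<lambda>x. g (f x))}"
proof -
  obtain D where D: "jet T D" "\<And>x. x \<in> T \<Longrightarrow> D 0 x [] = g x"
    using g unfolding smooth_on_iff_jet by blast
  show ?thesis
    by (rule Ck_family_cong[OF assms(2) Ck_family_jet_compose[OF D(1) assms(2-5,5), where j = 0]])
      (use D(2) assms(3) in auto)
qed

section \<open>From uniformly bounded directional derivatives to smoothness\<close>

primrec iterated_derivative :: "'a::real_normed_vector list \<Rightarrow> ('a \<Rightarrow> 'b::real_normed_vector) \<Rightarrow> 'a \<Rightarrow> 'b" where
  "iterated_derivative [] f = f"
| "iterated_derivative (v # vs) f = (\<lambda>x. frechet_derivative (iterated_derivative vs f) (at x) v)"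

lemma Ck_family_iterated_derivative:
  assumes "open S"
  shows "Ck_family (n + k) S {f} \<Longrightarrow>
    Ck_family n S {iterated_derivative us f | us. length us = k \<and> (\<forall>u\<in>set us. norm u \<le> 1)}"
proof (induction k arbitrary: n)
  case (0 n) then show ?case by simp
next
  case (Suc k n)
  have "Ck_family (Suc n) S {iterated_derivative us f | us. length us = k \<and> (\<forall>u\<in>set us. norm u \<le> 1)}"
    using Suc.IH[of "Suc n"] Suc.prems by simp
  then obtain G where G: "Ck_family n S G"
    "\<And>g v. g \<in> {iterated_derivative us f | us. length us = k \<and> (\<forall>u\<in>set us. norm u \<le> 1)} \<Longrightarrow> norm v \<le> 1 \<Longrightarrow>
      (\<lambda>x. frechet_derivative g (at x) v) \<in> G"
    by (rule Ck_family_SucE[OF _ assms]) blast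
  show ?case
  proof (rule Ck_family_subset[OF assms G(1)], safe)
    fix us :: "'a list" assume us: "length us = Suc k" "\<forall>u\<in>set us. norm u \<le> 1"
    then obtain v vs where "us = v # vs" by (cases us) auto
    then show "iterated_derivative us f \<in> G" using us G(2)[of "iterated_derivative vs f" v] by auto
  qed
qed

text \<open>The families bound directional derivatives but do not estimate remainders. A bound on
  level \<open>k + 2\<close> supplies the estimate: one mean value inequality makes level
  \<open>k + 1\<close> Lipschitz at \<open>x\<close>, a second one bounds the remainder of level
  \<open>k\<close> quadratically, both uniformly in the directions. The head of a list is the
  direction differentiated last, in accordance with \<open>jet\<close>.\<close>

lemma smooth_onI:
  assumes "open S" and Ck: "\<And>n. Ck_family n S {f}"
  shows "smooth_on S f"
  unfolding smooth_on_iff_jet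
proof (intro exI[of _ "\<lambda>k x vs. iterated_derivative vs f x"] conjI ballI)
  note fam = Ck_family_iterated_derivative[OF assms(1) Ck]
  have diff_unit: "iterated_derivative us f differentiable at x"
    if "x \<in> S" "\<forall>u\<in>set us. norm u \<le> 1" for us x
    using fam[of "Suc 0" "length us"] that by auto
  \<comment> \<open>The families contain unit directions only; homogeneity reduces arbitrary
    directions to normalized ones. Since \<open>sgn 0 = 0\<close>, zero entries are covered.\<close>
  have sgn: "iterated_derivative vs f x = prod_list (map norm vs) *\<^sub>R iterated_derivative (map sgn vs) f x"
    if "x \<in> S" for vs x using that
  proof (induction vs arbitrary: x)
    case (Cons v vs x)
    let ?g = "iterated_derivative (map sgn vs) f" and ?c = "prod_list (map norm vs)"
    have d: "(?g has_derivative frechet_derivative ?g (at x)) (at x)"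
      using diff_unit[OF Cons.prems, of "map sgn vs"] by (simp add: frechet_derivative_works norm_sgn)
    have "frechet_derivative (iterated_derivative vs f) (at x) = frechet_derivative (\<lambda>y. ?c *\<^sub>R ?g y) (at x)"
      by (rule frechet_derivative_cong_open[OF assms(1) Cons.prems Cons.IH])
    also have "\<dots> = (\<lambda>w. ?c *\<^sub>R frechet_derivative ?g (at x) w)"
      by (rule frechet_derivative_at[symmetric]) (rule has_derivative_scaleR_right[OF d])
    finally have "iterated_derivative (v # vs) f x = ?c *\<^sub>R frechet_derivative ?g (at x) v" by simp
    also have "v = norm v *\<^sub>R sgn v" by (cases "v = 0") (simp_all add: sgn_div_norm)
    then have "frechet_derivative ?g (at x) v = norm v *\<^sub>R frechet_derivative ?g (at x) (sgn v)"
      using linear_scale[OF has_derivative_linear[OF d]] by metis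
    finally show ?case by (simp add: ac_simps)
  qed simp
  have norm_sgn_le: "\<forall>u\<in>set (map sgn vs). norm u \<le> 1" for vs :: "'a list" by (auto simp: norm_sgn)
  have diff: "iterated_derivative vs f differentiable at x" if "x \<in> S" for vs x
  proof -
    have "(\<lambda>y. prod_list (map norm vs) *\<^sub>R iterated_derivative (map sgn vs) f y) differentiable at x"
      using diff_unit[OF that norm_sgn_le] by simp
    moreover have "iterated_derivative vs f differentiable at x \<longleftrightarrow>
        (\<lambda>y. prod_list (map norm vs) *\<^sub>R iterated_derivative (map sgn vs) f y) differentiable at x"
      by (rule differentiable_cong_open[OF assms(1) that]) (rule sgn)
    ultimately show ?thesis by blast
  qed
  have deriv: "(iterated_derivative vs f has_derivative (\<lambda>w. iterated_derivative (w # vs) f x)) (at x)"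
    if "x \<in> S" for vs x using diff[OF that, of vs] by (simp add: frechet_derivative_works)
  have bound: "\<exists>\<delta>>0. \<exists>K\<ge>0. \<forall>y. norm (y - x) < \<delta> \<longrightarrow> y \<in> S \<and>
      (\<forall>vs. length vs = k \<longrightarrow> norm (iterated_derivative vs f y) \<le> K * prod_list (map norm vs))"
    if x: "x \<in> S" for x k
  proof -
    obtain d K where d: "d > 0" "\<And>y us. y \<in> S \<Longrightarrow> norm (y - x) < d \<Longrightarrow> length us = k \<Longrightarrow>
        \<forall>u\<in>set us. norm u \<le> 1 \<Longrightarrow> norm (iterated_derivative us f y) \<le> K"
    proof -
      let ?F = "{iterated_derivative us f | us. length us = k \<and> (\<forall>u\<in>set us. norm u \<le> 1)}"
      have "locally_bounded_family S ?F" by (rule Ck_family_bounded[OF fam[of 0 k]])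
      then have "\<exists>\<delta>>0. \<exists>K. \<forall>y\<in>S. norm (y - x) < \<delta> \<longrightarrow> (\<forall>g\<in>?F. norm (g y) \<le> K)"
        unfolding locally_bounded_family_def using x by (rule bspec)
      then obtain d K where
        "d > 0" "\<forall>y\<in>S. norm (y - x) < d \<longrightarrow>
          (\<forall>g\<in>{iterated_derivative us f | us. length us = k \<and> (\<forall>u\<in>set us. norm u \<le> 1)}. norm (g y) \<le> K)"
        by (elim exE conjE) (rule that)
      then show ?thesis by (intro that[of d K]) blast+
    qed
    obtain e where e: "e > 0" "\<And>y. norm (y - x) < e \<Longrightarrow> y \<in> S"
      using assms(1) x unfolding open_dist dist_norm by metis
    have "norm (iterated_derivative vs f y) \<le> \<bar>K\<bar> * prod_list (map norm vs)"
      if y: "norm (y - x) < min d e" and l: "length vs = k" for y vs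
    proof -
      have "y \<in> S" using e y by simp
      have "norm (iterated_derivative (map sgn vs) f y) \<le> \<bar>K\<bar>"
        using d(2)[OF \<open>y \<in> S\<close>, of "map sgn vs"] y l norm_sgn_le[of vs] by (smt (verit) length_map)
      from mult_left_mono[OF this prod_list_norm_nonneg[of vs]]
      show ?thesis using sgn[OF \<open>y \<in> S\<close>, of vs] prod_list_norm_nonneg[of vs] by (simp add: ac_simps)
    qed
    then show ?thesis using d(1) e by (intro exI[of _ "min d e"] conjI exI[of _ "\<bar>K\<bar>"] allI impI) auto
  qed
  \<comment> \<open>Linearity in a slot behind the head is an identity between functions on the open
    set \<open>S\<close>, so it survives differentiation in the direction at the head.\<close>
  have lin: "linear (\<lambda>v. iterated_derivative (vs[i := v]) f x)" if "x \<in> S" "i < length vs" for vs i x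
    using that
  proof (induction vs arbitrary: i x)
    case (Cons w vs i x)
    show ?case
    proof (cases i)
      case 0 then show ?thesis using has_derivative_linear[OF deriv[OF Cons.prems(1), of vs]] by simp
    next
      case (Suc j)
      have lin: "linear (\<lambda>v. iterated_derivative (vs[j := v]) f y)" if "y \<in> S" for y
        using Cons.IH[OF that] Cons.prems(2) Suc by simp
      let ?d = "\<lambda>v. frechet_derivative (iterated_derivative (vs[j := v]) f) (at x)"
      have d: "(iterated_derivative (vs[j := v]) f has_derivative ?d v) (at x)" for v
        using diff[OF Cons.prems(1)] by (simp add: frechet_derivative_works)
      have "?d (a + b) w = ?d a w + ?d b w" for a b
      proof -
        have "?d (a + b) = frechet_derivative (\<lambda>y. iterated_derivative (vs[j := a]) f y
            + iterated_derivative (vs[j := b]) f y) (at x)"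
          by (rule frechet_derivative_cong_open[OF assms(1) Cons.prems(1)]) (rule linear_add[OF lin])
        also have "\<dots> = (\<lambda>w. ?d a w + ?d b w)"
          by (rule frechet_derivative_at[symmetric]) (intro has_derivative_add d)
        finally show ?thesis by (simp add: fun_eq_iff)
      qed
      moreover have "?d (r *\<^sub>R a) w = r *\<^sub>R ?d a w" for r a
      proof -
        have "?d (r *\<^sub>R a) = frechet_derivative (\<lambda>y. r *\<^sub>R iterated_derivative (vs[j := a]) f y) (at x)"
          by (rule frechet_derivative_cong_open[OF assms(1) Cons.prems(1)]) (rule linear_scale[OF lin])
        also have "\<dots> = (\<lambda>w. r *\<^sub>R ?d a w)"
          by (rule frechet_derivative_at[symmetric]) (intro has_derivative_scaleR_right d)
        finally show ?thesis by (simp add: fun_eq_iff)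
      qed
      ultimately show ?thesis using Suc by (simp add: linear_iff)
    qed
  qed simp
  show "jet S (\<lambda>k x vs. iterated_derivative vs f x)"
    unfolding jet_def
  proof (intro conjI allI ballI impI)
    show "bounded_multilinear k (\<lambda>vs. iterated_derivative vs f x)" if x: "x \<in> S" for k x
      unfolding bounded_multilinear_def
    proof (intro conjI allI impI)
      from bound[OF x, of k] obtain \<delta> K where K: "\<delta> > 0"
        "\<forall>y. norm (y - x) < \<delta> \<longrightarrow> y \<in> S \<and>
          (\<forall>vs. length vs = k \<longrightarrow> norm (iterated_derivative vs f y) \<le> K * prod_list (map norm vs))"
        by blast
      show "\<exists>K. \<forall>vs. length vs = k \<longrightarrow> norm (iterated_derivative vs f x) \<le> K * prod_list (map norm vs)"
        using K(2)[rule_format, of x] K(1) by (intro exI[of _ K]) simp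
    qed (use lin[OF x] in auto)
  next
    fix k x and \<epsilon> :: real assume x: "x \<in> S" and "\<epsilon> > 0"
    from bound[OF x, of "Suc (Suc k)"] obtain d K where d: "d > 0" "K \<ge> 0"
      "\<forall>y. norm (y - x) < d \<longrightarrow> y \<in> S \<and>
        (\<forall>vs. length vs = Suc (Suc k) \<longrightarrow> norm (iterated_derivative vs f y) \<le> K * prod_list (map norm vs))"
      by blast
    have d': "y \<in> S" if "norm (y - x) < d" for y using d(3) that by blast
    have d'': "norm (iterated_derivative vs f y) \<le> K * prod_list (map norm vs)"
      if "norm (y - x) < d" "length vs = Suc (Suc k)" for y vs using d(3) that by blast
    \<comment> \<open>The remainder will be at most
      \<open>K * norm (y - x) * norm (y - x) * P\<close>, which dictates the radius; the summand 1
      in \<open>K + 1\<close> prevents a division by 0.\<close>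
    have *: "norm (iterated_derivative vs f y - iterated_derivative vs f x - iterated_derivative ((y
        - x) # vs) f x)
        \<le> \<epsilon> * norm (y - x) * prod_list (map norm vs)"
      if y: "norm (y - x) < min d (\<epsilon> / (K + 1))" and l: "length vs = k" for y vs
    proof -
      define P where "P = prod_list (map norm vs)"
      have P: "P \<ge> 0" unfolding P_def by (rule prod_list_norm_nonneg)
      let ?r = "norm (y - x)"
      have in_ball: "norm (z - x) < d" if "z \<in> cball x ?r" for z
        using that y by (simp add: dist_norm norm_minus_commute)
      have B: "norm (iterated_derivative (w # vs) f z - iterated_derivative (w # vs) f x)
          \<le> (K * (norm w * P)) * ?r"
        if z: "z \<in> cball x ?r" for z w
      proof -
        have "norm (iterated_derivative (w # vs) f z - iterated_derivative (w # vs) f x)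
            \<le> (K * (norm w * P)) * norm (z - x)"
        proof (rule differentiable_bound[of "cball x ?r" _ "\<lambda>z u. iterated_derivative (u # w # vs) f z"])
          fix z assume z: "z \<in> cball x ?r"
          show "(iterated_derivative (w # vs) f
              has_derivative (\<lambda>u. iterated_derivative (u # w # vs) f z)) (at z within cball x ?r)"
            by (rule has_derivative_at_withinI[OF deriv[OF d'[OF in_ball[OF z]]]])
          show "onorm (\<lambda>u. iterated_derivative (u # w # vs) f z) \<le> K * (norm w * P)"
            by (rule onorm_bound) (use d(2) P d''[OF in_ball[OF z], of "_ # w # vs"] l
                in \<open>auto simp: P_def ac_simps\<close>)
        qed (use z in auto)
        also have "\<dots> \<le> (K * (norm w * P)) * ?r"
          using z d(2) P by (intro mult_left_mono) (auto simp: dist_norm norm_minus_commute)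
        finally show ?thesis .
      qed
      have "norm (iterated_derivative vs f y - iterated_derivative vs f x - iterated_derivative ((y
          - x) # vs) f x) \<le> norm (y - x) * (K * P * ?r)"
      proof (rule differentiable_bound_linearization[of x y "cball x ?r" _ "\<lambda>z u. iterated_derivative (u #
          vs) f z" x])
        fix t :: real assume "t \<in> {0..1}"
        then show "x + t *\<^sub>R (y - x) \<in> cball x ?r" by (simp add: dist_norm mult_left_le_one_le)
      next
        fix z assume z: "z \<in> cball x ?r"
        show "(iterated_derivative vs f has_derivative (\<lambda>u. iterated_derivative (u # vs) f z)) (at z
            within cball x ?r)"
          by (rule has_derivative_at_withinI[OF deriv[OF d'[OF in_ball[OF z]]]])
        show "onorm ((\<lambda>u. iterated_derivative (u # vs) f z) - (\<lambda>u. iterated_derivative (u # vs) f x))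
            \<le> K * P * ?r"
          by (rule onorm_bound) (use d(2) P B[OF z] in \<open>auto simp: ac_simps\<close>)
      qed simp
      also have "\<dots> \<le> \<epsilon> * norm (y - x) * P"
      proof -
        have "K * ?r \<le> \<epsilon>"
        proof -
          have "(K + 1) * ?r \<le> \<epsilon>" using y d(2) by (simp add: pos_less_divide_eq mult.commute)
          then show ?thesis by (simp add: distrib_right) (smt (verit) norm_ge_zero)
        qed
        from mult_right_mono[OF this, of "P * ?r"] P show ?thesis by (simp add: ac_simps)
      qed
      finally show ?thesis unfolding P_def .
    qed
    show "\<exists>\<delta>>0. \<forall>y\<in>S. norm (y - x) < \<delta> \<longrightarrow> (\<forall>vs. length vs = k \<longrightarrow>
        norm (iterated_derivative vs f y - iterated_derivative vs f x - iterated_derivative ((y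
            - x) # vs) f x)
          \<le> \<epsilon> * norm (y - x) * prod_list (map norm vs))"
      using * d(1,2) \<open>\<epsilon> > 0\<close> by (intro exI[of _ "min d (\<epsilon> / (K + 1))"]) auto
  qed (use assms in auto)
qed simp

section \<open>Calculus of smooth maps\<close>

lemma smooth_on_differentiable:
  assumes "smooth_on S f" "x \<in> S"
  shows "f differentiable at x"
  using smooth_on_imp_Ck_family[OF assms(1), of "Suc 0"] assms(2) by simp

lemma smooth_on_has_derivative:
  "smooth_on S f \<Longrightarrow> x \<in> S \<Longrightarrow> (f has_derivative frechet_derivative f (at x)) (at x)"
  using smooth_on_differentiable frechet_derivative_works by blast

lemma smooth_on_continuous_on: "smooth_on S f \<Longrightarrow> continuous_on S f"
  by (meson continuous_at_imp_continuous_on differentiable_imp_continuous_within smooth_on_differentiable)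

lemma smooth_on_cong:
  assumes "smooth_on S f" "\<And>x. x \<in> S \<Longrightarrow> f x = g x"
  shows "smooth_on S g"
proof -
  note o = smooth_on_open[OF assms(1)]
  show ?thesis
    by (rule smooth_onI[OF o], rule Ck_family_cong[OF o smooth_on_imp_Ck_family[OF assms(1)]])
        (use assms(2) in auto)
qed

lemma smooth_on_subset:
  assumes "smooth_on S f" "open T" "T \<subseteq> S"
  shows "smooth_on T f"
proof -
  obtain D where D: "\<And>x. x \<in> S \<Longrightarrow> D 0 x [] = f x" "jet S D"
    using assms(1) unfolding smooth_on_iff_jet by blast
  have "jet T D"
    using D(2) assms(2,3) unfolding jet_def by (meson subsetD)
  then show ?thesis using D(1) assms(3) unfolding smooth_on_iff_jet by blast
qed

lemma smooth_on_compose: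
  assumes "smooth_on T g" "smooth_on S f" "f ` S \<subseteq> T"
  shows "smooth_on S (\<lambda>x. g (f x))"
  by (rule smooth_onI[OF smooth_on_open[OF assms(2)] Ck_family_compose[OF assms(1) smooth_on_open[OF assms(2)]
        assms(3) smooth_on_continuous_on[OF assms(2)] smooth_on_imp_Ck_family[OF assms(2)]]])

lemma smooth_on_bounded_linear:
  assumes "bounded_linear l" "smooth_on S f"
  shows "smooth_on S (\<lambda>x. l (f x))"
  by (rule smooth_onI[OF smooth_on_open[OF assms(2)] Ck_family_bounded_linear[OF smooth_on_open[OF assms(2)]
        assms(1) smooth_on_imp_Ck_family[OF assms(2)]]])

lemma smooth_on_const: "open S \<Longrightarrow> smooth_on S (\<lambda>x. c)"
  using Ck_family_const[of S "{c}"] by (intro smooth_onI) (auto simp: Collect_conv_if)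

lemma smooth_on_Pair:
  assumes "smooth_on S f" "smooth_on S g"
  shows "smooth_on S (\<lambda>x. (f x, g x))"
  by (rule smooth_onI[OF smooth_on_open[OF assms(1)] Ck_family_Pair[OF smooth_on_open[OF assms(1)]
        smooth_on_imp_Ck_family[OF assms(1)] smooth_on_imp_Ck_family[OF assms(2)]]])

lemma smooth_on_bilinear:
  assumes "bounded_bilinear b" "smooth_on S f" "smooth_on S g"
  shows "smooth_on S (\<lambda>x. b (f x) (g x))"
proof (rule smooth_onI)
  show o: "open S" by (rule smooth_on_open[OF assms(2)])
  show "Ck_family n S {(\<lambda>x. b (f x) (g x))}" for n
    by (rule Ck_family_subset[OF o Ck_family_bilinear[OF o assms(1) smooth_on_imp_Ck_family[OF assms(2)]
          smooth_on_imp_Ck_family[OF assms(3)]]]) blast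
qed

lemma continuous_on_locally_bounded:
  assumes "continuous_on S f"
  shows "locally_bounded_family S {f}"
  unfolding locally_bounded_family_def
proof
  fix x assume "x \<in> S"
  then obtain d where d: "d > 0" "\<And>z. z \<in> S \<Longrightarrow> norm (z - x) < d \<Longrightarrow> norm (f z - f x) < 1"
    using assms unfolding continuous_on_iff dist_norm by (metis zero_less_one)
  have "norm (f z) \<le> norm (f x) + 1" if "z \<in> S" "norm (z - x) < d" for z
    using d(2)[OF that] norm_triangle_sub[of "f z" "f x"] by linarith
  then show "\<exists>\<delta>>0. \<exists>K. \<forall>z\<in>S. norm (z - x) < \<delta> \<longrightarrow> (\<forall>g\<in>{f}. norm (g z) \<le> K)"
    using d(1) by blast
qed

lemma smooth_on_id:
  assumes "open S"
  shows "smooth_on S (\<lambda>x. x)"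
proof (rule smooth_onI[OF assms])
  have bnd: "locally_bounded_family S {(\<lambda>x. x)}"
    by (intro continuous_on_locally_bounded continuous_on_id)
  have b: "bounded {v :: 'a. norm v \<le> 1}" unfolding bounded_iff by auto
  show "Ck_family n S {(\<lambda>x. x)}" for n
  proof (cases n)
    case (Suc m)
    show ?thesis unfolding Suc
      by (rule Ck_family_SucI[OF assms bnd _ Ck_family_const[OF assms b]])
        (auto intro!: exI[of _ "\<lambda>x v. v"] derivative_eq_intros)
  qed (simp add: bnd)
qed

lemma smooth_on_diff:
  assumes "smooth_on S f" "smooth_on S g"
  shows "smooth_on S (\<lambda>x. f x - g x)"
  using smooth_on_bounded_linear[OF _ smooth_on_Pair[OF assms], of "\<lambda>p. fst p - snd p"]
  by (simp add: bounded_linear_sub bounded_linear_fst bounded_linear_snd)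

lemma smooth_on_fst: "smooth_on S f \<Longrightarrow> smooth_on S (\<lambda>x. fst (f x))"
  by (rule smooth_on_bounded_linear[OF bounded_linear_fst])

lemma smooth_on_snd: "smooth_on S f \<Longrightarrow> smooth_on S (\<lambda>x. snd (f x))"
  by (rule smooth_on_bounded_linear[OF bounded_linear_snd])

text \<open>The last entry of the list is the slot that turns into the argument of the operator.\<close>

lemma smooth_on_blinfun_derivative:
  assumes "smooth_on S f"
  obtains f' where "smooth_on S f'" "\<And>x. x \<in> S \<Longrightarrow> (f has_derivative blinfun_apply (f' x)) (at x)"
proof -
  obtain D where D: "jet S D" "\<And>x. x \<in> S \<Longrightarrow> D 0 x [] = f x"
    using assms unfolding smooth_on_iff_jet by blast
  have o: "open S" using D(1) by (simp add: jet_def)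
  define E where "E = (\<lambda>k x vs. Blinfun (\<lambda>v. D (Suc k) x (vs @ [v])))"
  have ml: "bounded_multilinear k (D k x)" if "x \<in> S" for k x using jet_multilinear[OF D(1) that] .
  have bl: "bounded_linear (\<lambda>v. D (Suc k) x (vs @ [v]))" if x: "x \<in> S" and l: "length vs = k" for x vs k
  proof -
    obtain K where K: "K \<ge> 0" "\<And>vs. length vs = Suc k \<Longrightarrow> norm (D (Suc k) x vs) \<le> K * prod_list (map norm vs)"
      by (rule bounded_multilinear_bound[OF ml[OF x]]) blast
    have "linear (\<lambda>v. D (Suc k) x ((vs @ [0])[k := v]))"
      using ml[OF x, of "Suc k"] l unfolding bounded_multilinear_def
      by (metis length_append_singleton lessI)
    then have "linear (\<lambda>v. D (Suc k) x (vs @ [v]))" using l by (simp add: list_update_append)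
    then show ?thesis
      by (intro bounded_linear.intro bounded_linear_axioms.intro exI[of _ "K * prod_list (map norm vs)"])
        (use K(2)[of "vs @ [_]"] l in \<open>auto simp: ac_simps\<close>)
  qed
  have E: "blinfun_apply (E k x vs) v = D (Suc k) x (vs @ [v])" if "x \<in> S" "length vs = k" for k x vs v
    unfolding E_def by (simp add: bounded_linear_Blinfun_apply[OF bl[OF that]])
  have "jet S E" unfolding jet_def
  proof (intro conjI allI ballI impI)
    fix k x assume x: "x \<in> S"
    obtain K where K: "K \<ge> 0" "\<And>vs. length vs = Suc k \<Longrightarrow> norm (D (Suc k) x vs) \<le> K * prod_list (map norm vs)"
      by (rule bounded_multilinear_bound[OF ml[OF x]]) blast
    show "bounded_multilinear k (E k x)" unfolding bounded_multilinear_def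
    proof (intro conjI allI impI)
      fix vs :: "'a list" and i assume l: "length vs = k" "i < k"
      have "linear (\<lambda>u. D (Suc k) x ((vs @ [v])[i := u]))" for v
        using ml[OF x, of "Suc k"] l unfolding bounded_multilinear_def
        by (metis length_append_singleton less_SucI)
      then have "linear (\<lambda>u. D (Suc k) x (vs[i := u] @ [v]))" for v using l by (simp add: list_update_append)
      then show "linear (\<lambda>u. E k x (vs[i := u]))" using l
        by (auto simp: linear_iff E[OF x] blinfun.bilinear_simps intro!: blinfun_eqI)
    next
      show "\<exists>K. \<forall>vs. length vs = k \<longrightarrow> norm (E k x vs) \<le> K * prod_list (map norm vs)"
      proof (intro exI[of _ K] allI impI norm_blinfun_bound)
        fix vs :: "'a list" and v assume l: "length vs = k"
        show "norm (blinfun_apply (E k x vs) v) \<le> K * prod_list (map norm vs) * norm v"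
          using K(2)[of "vs @ [v]"] l by (simp add: E[OF x l] ac_simps)
      qed (use K(1) in \<open>auto intro!: mult_nonneg_nonneg prod_list_norm_nonneg\<close>)
    qed
  next
    fix k x and \<epsilon> :: real assume x: "x \<in> S" and "\<epsilon> > 0"
    obtain d where d: "d > 0" "\<And>y. norm (y - x) < d \<Longrightarrow> y \<in> S"
      "\<And>y vs. norm (y - x) < d \<Longrightarrow> length vs = Suc k \<Longrightarrow>
       norm (D (Suc k) y vs - D (Suc k) x vs - D (Suc (Suc k)) x ((y - x) # vs))
           \<le> \<epsilon> * norm (y - x) * prod_list (map norm vs)"
      by (rule jet_estimate[OF D(1) x \<open>\<epsilon> > 0\<close>, of "Suc k"]) blast
    show "\<exists>\<delta>>0. \<forall>y\<in>S. norm (y - x) < \<delta> \<longrightarrow> (\<forall>vs. length vs = k \<longrightarrow>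
        norm (E k y vs - E k x vs - E (Suc k) x ((y - x) # vs)) \<le> \<epsilon> * norm (y - x) * prod_list (map norm vs))"
    proof (intro exI[of _ d] conjI d(1) ballI impI allI norm_blinfun_bound)
      fix y vs v assume y: "y \<in> S" "norm (y - x) < d" and l: "length (vs :: 'a list) = k"
      show "norm (blinfun_apply (E k y vs - E k x vs - E (Suc k) x ((y - x) # vs)) v)
        \<le> \<epsilon> * norm (y - x) * prod_list (map norm vs) * norm v"
        using d(3)[OF y(2), of "vs @ [v]"] l by (simp add: E x y blinfun.bilinear_simps ac_simps)
    qed (use \<open>\<epsilon> > 0\<close> in \<open>auto intro!: mult_nonneg_nonneg prod_list_norm_nonneg\<close>)
  qed (use o in auto)
  show ?thesis
  proof (rule that)
    show "smooth_on S (\<lambda>x. E 0 x [])" unfolding smooth_on_iff_jet using \<open>jet S E\<close> by blast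
    show "(f has_derivative blinfun_apply (E 0 x [])) (at x)" if x: "x \<in> S" for x
    proof -
      have "((\<lambda>y. D 0 y []) has_derivative (\<lambda>w. D (Suc 0) x [w])) (at x)"
        by (rule jet_has_derivative[OF D(1) x]) simp
      then have "(f has_derivative (\<lambda>w. D (Suc 0) x [w])) (at x)"
        by (rule has_derivative_transform_within_open[OF _ o x]) (use D(2) in auto)
      moreover have "blinfun_apply (E 0 x []) = (\<lambda>w. D (Suc 0) x [w])" using E[OF x, of "[]" 0] by
          (simp add: fun_eq_iff)
      ultimately show ?thesis by simp
    qed
  qed
qed

text \<open>Bootstrapping: if \<open>y\<close> has order \<open>n\<close>, then so has its
  composition with \<open>H\<close>, whose values are the derivatives of \<open>y\<close>; hence
  \<open>y\<close> has order \<open>n + 1\<close>.\<close>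

lemma smooth_on_ode:
  assumes H: "smooth_on U H" and "open S" "y ` S \<subseteq> U"
    and y: "\<And>x. x \<in> S \<Longrightarrow> (y has_derivative blinfun_apply (H (y x))) (at x)"
  shows "smooth_on S y"
proof (rule smooth_onI[OF assms(2)])
  have cont: "continuous_on S y" 
    by (meson y continuous_at_imp_continuous_on has_derivative_continuous)
  have bnd: "locally_bounded_family S {y}" by (rule continuous_on_locally_bounded[OF cont])
  show "Ck_family n S {y}" for n
  proof (induction n)
    case 0 then show ?case using bnd by simp
  next
    case (Suc n)
    note * = Ck_family_blinfun_apply[OF assms(2) Ck_family_compose[OF H assms(2,3) cont Suc]]
    show ?case
      by (rule Ck_family_SucI[OF assms(2) bnd _ *]) (use y
          in \<open>auto intro!: exI[of _ "\<lambda>x. blinfun_apply (H (y x))"]\<close>)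
  qed
qed

text \<open>The second difference of \<open>f\<close> over the parallelogram with sides
  \<open>s u\<close> and \<open>s v\<close> is symmetric in \<open>u\<close> and \<open>v\<close>,
  and it differs from \<open>s * s\<close> times the second derivative by an error of the order
  \<open>\<epsilon> * s * s\<close>. Dividing by \<open>s * s\<close> leaves an arbitrarily small
  bound for the asymmetry.\<close>

lemma symmetric_second_derivative:
  fixes f :: "'a::real_normed_vector \<Rightarrow> 'b::real_normed_vector" and f' :: "'a \<Rightarrow> 'a \<Rightarrow>\<^sub>L 'b"
  assumes "open S" "x \<in> S" and f: "\<And>y. y \<in> S \<Longrightarrow> (f has_derivative blinfun_apply (f' y)) (at y)"
    and f': "(f' has_derivative blinfun_apply f'') (at x)"
  shows "blinfun_apply (blinfun_apply f'' u) v = blinfun_apply (blinfun_apply f'' v) u"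
proof (cases "norm u + norm v = 0")
  case True
  then show ?thesis by (smt (verit) norm_ge_zero norm_le_zero_iff)
next
  case False
  define n where "n = norm u + norm v"
  have n: "n > 0" using False unfolding n_def by (smt (verit) norm_ge_zero)
  have *: "norm (blinfun_apply (blinfun_apply f'' u) v - blinfun_apply (blinfun_apply f'' v) u)
      \<le> \<epsilon> * (4 * n * n)"
    if "\<epsilon> > 0" for \<epsilon>
  proof -
    obtain d1 where d1: "d1 > 0" "\<And>y. norm (y - x) < d1 \<Longrightarrow> norm (f' y - f' x - blinfun_apply f'' (y - x))
        \<le> \<epsilon> * norm (y - x)"
      using f' \<open>\<epsilon> > 0\<close> unfolding has_derivative_at_alt by metis
    obtain d2 where d2: "d2 > 0" "\<And>y. norm (y - x) < d2 \<Longrightarrow> y \<in> S"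
      using assms(1,2) unfolding open_dist dist_norm by metis
    \<comment> \<open>All points of the parallelogram lie within \<open>s * n\<close> of
      \<open>x\<close>, which is half the smaller radius.\<close>
    define s where "s = min d1 d2 / (2 * n)"
    have s: "s > 0" "s * n < d1" "s * n < d2" using d1(1) d2(1) n unfolding s_def by
        (auto simp: min_def field_simps)
    have claim: "norm (f (x + s *\<^sub>R a + s *\<^sub>R b) - f (x + s *\<^sub>R b) - f (x + s *\<^sub>R a) + f x
        - (s * s) *\<^sub>R blinfun_apply (blinfun_apply f'' a) b) \<le> 2 * \<epsilon> * (s * n) * (s * n)"
      if ab: "norm a + norm b = n" for a b
    proof -
      have near: "norm (r *\<^sub>R a + t *\<^sub>R b) \<le> s * n" if "0 \<le> r" "r \<le> s" "0 \<le> t" "t \<le> s" for r t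
      proof -
        have "norm (r *\<^sub>R a + t *\<^sub>R b) \<le> r * norm a + t * norm b"
          using that by (intro norm_triangle_mono) auto
        also have "\<dots> \<le> s * norm a + s * norm b" using that by (intro add_mono mult_right_mono) auto
        finally show ?thesis by (simp add: ab[symmetric] distrib_left)
      qed
      \<comment> \<open>One edge is traversed by \<open>t\<close>, and the expected value is
        subtracted in proportion to \<open>t\<close>. Thus \<open>?g 1 - ?g 0\<close> is exactly the
        error of the second difference, and the derivative of \<open>?g\<close> involves
        \<open>f'\<close> only through a difference to its linearization.\<close>
      let ?g = "\<lambda>t. f (x + s *\<^sub>R a + t *\<^sub>R (s *\<^sub>R b)) - f (x + t *\<^sub>R (s *\<^sub>R b)) - t *\<^sub>R ((s
          * s) *\<^sub>R blinfun_apply (blinfun_apply f'' a) b)"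
      let ?g' = "\<lambda>t. blinfun_apply (f' (x + s *\<^sub>R a + t *\<^sub>R (s *\<^sub>R b)) - f' (x + t *\<^sub>R (s *\<^sub>R b))
          - blinfun_apply f'' (s *\<^sub>R a)) (s *\<^sub>R b)"
      have "norm (?g 1 - ?g 0) \<le> (2 * \<epsilon> * (s * n) * (s * n)) * norm (1 - 0 :: real)"
      proof (rule differentiable_bound[of "{0..1}" ?g "\<lambda>t h. h *\<^sub>R ?g' t"])
        fix t :: real assume t: "t \<in> {0..1}"
        have ts: "0 \<le> t * s" "t * s \<le> s" using t s(1) by (auto simp: mult_left_le_one_le)
        let ?p = "x + s *\<^sub>R a + t *\<^sub>R (s *\<^sub>R b)" and ?q = "x + t *\<^sub>R (s *\<^sub>R b)"
        have np: "norm (?p - x) \<le> s * n" using near[OF less_imp_le[OF s(1)] order_refl ts] by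
            (simp add: add.assoc)
        have nq: "norm (?q - x) \<le> s * n" using near[OF order_refl less_imp_le[OF s(1)] ts] by simp
        have "?p \<in> S" "?q \<in> S" using np nq s d2(2) by
            (auto simp del: add_diff_cancel_left' intro: le_less_trans)
        then have fp: "(f has_derivative blinfun_apply (f' ?p)) (at ?p)"
            and fq: "(f has_derivative blinfun_apply (f' ?q)) (at ?q)"
          using f by blast+
        have line: "((\<lambda>t. c + t *\<^sub>R (s *\<^sub>R b)) has_derivative (\<lambda>h. h *\<^sub>R (s *\<^sub>R b))) (at t within {0..1})"
            for c
          by (auto intro!: derivative_eq_intros)
        have "((\<lambda>t. f (x + s *\<^sub>R a + t *\<^sub>R (s *\<^sub>R b)))
            has_derivative (\<lambda>h. blinfun_apply (f' ?p) (h *\<^sub>R (s *\<^sub>R b)))) (at t within {0..1})"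
          by (rule has_derivative_compose[OF line, OF fp])
        moreover have "((\<lambda>t. f (x + t *\<^sub>R (s *\<^sub>R b)))
            has_derivative (\<lambda>h. blinfun_apply (f' ?q) (h *\<^sub>R (s *\<^sub>R b)))) (at t within {0..1})"
          by (rule has_derivative_compose[OF line[of x], OF fq])
        ultimately have "(?g has_derivative (\<lambda>h. blinfun_apply (f' ?p) (h *\<^sub>R (s *\<^sub>R b))
            - blinfun_apply (f' ?q) (h *\<^sub>R (s *\<^sub>R b))
            - h *\<^sub>R ((s * s) *\<^sub>R blinfun_apply (blinfun_apply f'' a) b))) (at t within {0..1})"
          by (intro has_derivative_diff has_derivative_scaleR_left has_derivative_ident)
        then show "(?g has_derivative (\<lambda>h. h *\<^sub>R ?g' t)) (at t within {0..1})"
          by (simp add: blinfun.bilinear_simps scaleR_diff_right ac_simps)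
        have 1: "norm (f' ?p - f' x - blinfun_apply f'' (?p - x)) \<le> \<epsilon> * (s * n)"
          by (rule order_trans[OF d1(2) mult_left_mono[OF np]]) (use np s \<open>\<epsilon> > 0\<close> in auto)
        have 2: "norm (f' ?q - f' x - blinfun_apply f'' (?q - x)) \<le> \<epsilon> * (s * n)"
          by (rule order_trans[OF d1(2) mult_left_mono[OF nq]]) (use nq s \<open>\<epsilon> > 0\<close> in auto)
        have eq: "f' ?p - f' ?q - blinfun_apply f'' (s *\<^sub>R a) = (f' ?p - f' x - blinfun_apply f'' (?p
            - x)) - (f' ?q - f' x - blinfun_apply f'' (?q - x))"
          by (simp add: blinfun.bilinear_simps algebra_simps)
        have 3: "norm (f' ?p - f' ?q - blinfun_apply f'' (s *\<^sub>R a)) \<le> 2 * \<epsilon> * (s * n)"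
          unfolding eq using order_trans[OF norm_triangle_ineq4 add_mono[OF 1 2]] by linarith
        have 4: "norm (s *\<^sub>R b) \<le> s * n" using s(1) by (simp add: mult_left_mono ab[symmetric])
        have "norm (?g' t) \<le> (2 * \<epsilon> * (s * n)) * (s * n)"
          by (rule order_trans[OF norm_blinfun mult_mono[OF 3 4]]) (use s n \<open>\<epsilon> > 0\<close> in auto)
        then show "onorm (\<lambda>h. h *\<^sub>R ?g' t) \<le> 2 * \<epsilon> * (s * n) * (s * n)"
          by (intro onorm_bound) (use s n \<open>\<epsilon> > 0\<close>
              in \<open>auto simp: mult.commute[of "\<bar>_\<bar>"] intro!: mult_right_mono\<close>)
      qed auto
      then show ?thesis by (simp add: algebra_simps)
    qed
    let ?D = "f (x + s *\<^sub>R u + s *\<^sub>R v) - f (x + s *\<^sub>R v) - f (x + s *\<^sub>R u) + f x"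
    have 1: "norm (?D - (s * s) *\<^sub>R blinfun_apply (blinfun_apply f'' u) v) \<le> 2 * \<epsilon> * (s * n) * (s * n)"
      by (rule claim) (simp add: n_def)
    have 2: "norm (?D - (s * s) *\<^sub>R blinfun_apply (blinfun_apply f'' v) u) \<le> 2 * \<epsilon> * (s * n) * (s * n)"
      using claim[of v u] by (simp add: n_def algebra_simps)
    have "(s * s) *\<^sub>R (blinfun_apply (blinfun_apply f'' u) v - blinfun_apply (blinfun_apply f'' v) u)
      = (?D - (s * s) *\<^sub>R blinfun_apply (blinfun_apply f'' v) u) - (?D - (s
          * s) *\<^sub>R blinfun_apply (blinfun_apply f'' u) v)"
      by (simp add: scaleR_diff_right)
    then have "norm ((s * s) *\<^sub>R (blinfun_apply (blinfun_apply f'' u) v - blinfun_apply (blinfun_apply f''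
        v) u))
      \<le> 2 * \<epsilon> * (s * n) * (s * n) + 2 * \<epsilon> * (s * n) * (s * n)"
      using order_trans[OF norm_triangle_ineq4 add_mono[OF 2 1]] by simp
    then have "(s * s) * norm (blinfun_apply (blinfun_apply f'' u) v - blinfun_apply (blinfun_apply f'' v)
        u) \<le> (s * s) * (\<epsilon> * (4 * n * n))"
      using s(1) by (simp add: ac_simps)
    then show ?thesis using s(1) by simp
  qed
  have "norm (blinfun_apply (blinfun_apply f'' u) v - blinfun_apply (blinfun_apply f'' v) u) \<le> 0"
  proof (rule field_le_epsilon)
    fix e :: real assume "e > 0"
    then show "norm (blinfun_apply (blinfun_apply f'' u) v - blinfun_apply (blinfun_apply f'' v) u) \<le> 0 + e"
      using *[of "e / (4 * n * n)"] n by simp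
  qed
  then show ?thesis by simp
qed

section \<open>Total differential equations\<close>

text \<open>At a point \<open>s\<close> where the norm of \<open>e\<close> is maximal, the mean
  value inequality gives \<open>norm (e s) \<le> norm (e s) / 2 + C\<close>, and the half is
  absorbed on the left.\<close>

lemma vector_derivative_sup_bound:
  fixes e :: "real \<Rightarrow> 'z::real_normed_vector"
  assumes e: "\<And>t. t \<in> {0..1} \<Longrightarrow> (e has_vector_derivative e' t) (at t within {0..1})"
    and "e 0 = 0" and bound: "\<And>t. t \<in> {0..1} \<Longrightarrow> norm (e' t) \<le> norm (e t) / 2 + C"
    and t: "t \<in> {0..1}"
  shows "norm (e t) \<le> 2 * C"
proof -
  have "continuous_on {0..1} (\<lambda>t. norm (e t))"
    using e by (intro continuous_on_norm continuous_on_vector_derivative) auto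
  then obtain s where s: "s \<in> {0..1}" "\<And>t. t \<in> {0..1} \<Longrightarrow> norm (e t) \<le> norm (e s)"
    using continuous_attains_sup[of "{0..1::real}" "\<lambda>t. norm (e t)"] by auto
  have "norm (e s - e 0) \<le> (norm (e s) / 2 + C) * norm (s - 0)"
  proof (rule differentiable_bound[of "{0..1}" e "\<lambda>t h. h *\<^sub>R e' t"])
    fix t :: real assume t: "t \<in> {0..1}"
    show "(e has_derivative (\<lambda>h. h *\<^sub>R e' t)) (at t within {0..1})"
      using e[OF t] by (simp add: has_vector_derivative_def)
    have *: "norm (e' t) \<le> norm (e s) / 2 + C" using bound[OF t] s(2)[OF t] by linarith
    show "onorm (\<lambda>h. h *\<^sub>R e' t) \<le> norm (e s) / 2 + C"
    proof (rule onorm_bound)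
      show "norm (h *\<^sub>R e' t) \<le> (norm (e s) / 2 + C) * norm h" for h
        using mult_right_mono[OF * norm_ge_zero[of h]] by (simp add: mult.commute)
    qed (rule order_trans[OF norm_ge_zero *])
  qed (use s in auto)
  also have "\<dots> \<le> (norm (e s) / 2 + C) * 1"
    using s(1) order_trans[OF norm_ge_zero bound[OF s(1)]] by (intro mult_left_mono) auto
  finally have "norm (e s) \<le> 2 * C" using \<open>e 0 = 0\<close> by simp
  then show ?thesis using s(2)[OF t] by linarith
qed

text \<open>All rays are solved at once by a single fixed point
  \<open>y v = z0 + integral of H (y (t v)) v\<close> over \<open>t\<close> in
  \<open>[0, 1]\<close>, in a space of continuous functions of the endpoint \<open>v\<close>;
  continuity across rays is then part of the result. The condition \<open>r * K \<le> R\<close>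
  keeps values in the ball, and \<open>r * K \<le> 1/2\<close> gives the contraction.\<close>

lemma ray_ode_exists:
  fixes H :: "'z::banach \<Rightarrow> 'e::real_normed_vector \<Rightarrow>\<^sub>L 'z"
  assumes "0 < r" "0 < K" "0 < R" "r * K \<le> R" "r * K \<le> 1/2"
    and H: "\<And>z. z \<in> cball z0 R \<Longrightarrow> norm (H z) \<le> K"
    and lip: "\<And>z z'. z \<in> cball z0 R \<Longrightarrow> z' \<in> cball z0 R \<Longrightarrow> norm (H z' - H z) \<le> K * norm (z' - z)"
  obtains y where "continuous_on UNIV y" "y 0 = z0" "\<And>v. y v \<in> cball z0 R"
    "\<And>v t. norm v \<le> r \<Longrightarrow> t \<in> {0..1} \<Longrightarrow>
       ((\<lambda>t. y (t *\<^sub>R v)) has_vector_derivative blinfun_apply (H (y (t *\<^sub>R v))) v) (at t within {0..1})"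
proof -
  \<comment> \<open>The radial retraction onto the ball of radius \<open>r\<close>. It lets the
    integral operator act on bounded continuous functions on the whole space, which form a complete
    metric space, and does not change the equation for \<open>norm v \<le> r\<close>.\<close>
  define \<rho> where "\<rho> = (\<lambda>x :: 'e. (r / max r (norm x)) *\<^sub>R x)"
  have \<rho>_cont: "continuous_on UNIV \<rho>" unfolding \<rho>_def
    using \<open>0 < r\<close> by (intro continuous_intros) auto
  have \<rho>_norm: "norm (\<rho> x) \<le> r" for x
  proof -
    have "r * norm x \<le> r * max r (norm x)" using \<open>0 < r\<close> by (intro mult_left_mono) auto
    then show ?thesis using \<open>0 < r\<close> unfolding \<rho>_def by (simp add: pos_divide_le_eq)
  qed
  have \<rho>_id: "\<rho> x = x" if "norm x \<le> r" for x using that \<open>0 < r\<close> unfolding \<rho>_def by (simp add: max_def)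
  have H_cont: "continuous_on (cball z0 R) H"
    by (rule lipschitz_on_continuous_on[of K])
      (use lip \<open>0 < K\<close> in \<open>auto simp: lipschitz_on_def dist_norm norm_minus_commute\<close>)
  define A where "A = {u :: 'e \<Rightarrow>\<^sub>C 'z. \<forall>x. apply_bcontfun u x \<in> cball z0 R}"
  define g where "g = (\<lambda>(u :: 'e \<Rightarrow>\<^sub>C 'z) x t. blinfun_apply (H (apply_bcontfun u (t *\<^sub>R \<rho> x))) (\<rho> x))"
  have g_cont: "continuous_on (UNIV \<times> {0..1}) (\<lambda>(x, t :: real). g u x t)" if u: "u \<in> A" for u
  proof -
    have 1: "continuous_on (UNIV \<times> {0..1}) (\<lambda>p :: 'e \<times> real. \<rho> (fst p))"
      by (rule continuous_on_compose2[OF \<rho>_cont]) (auto intro!: continuous_intros)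
    have 2: "continuous_on (UNIV \<times> {0..1}) (\<lambda>p :: 'e \<times> real. apply_bcontfun u (snd p *\<^sub>R \<rho> (fst p)))"
      by (rule continuous_on_compose2[OF continuous_on_apply_bcontfun[of UNIV]])
          (auto intro!: continuous_on_scaleR continuous_on_snd continuous_on_id 1)
    have 3: "continuous_on (UNIV \<times> {0..1}) (\<lambda>p :: 'e \<times> real. H (apply_bcontfun u (snd p *\<^sub>R \<rho> (fst p))))"
      by (rule continuous_on_compose2[OF H_cont 2]) (use u in \<open>auto simp: A_def\<close>)
    show ?thesis unfolding g_def split_beta by (intro bounded_bilinear.continuous_on[OF
        bounded_bilinear_blinfun_apply] 1 3)
  qed
  have g_line: "continuous_on {0..1} (g u x)" if u: "u \<in> A" for u x
  proof -
    have "continuous_on {0..1} (\<lambda>t. (\<lambda>(x, t). g u x t) (x, t))"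
      by (rule continuous_on_compose2[OF g_cont[OF u]]) (auto intro!: continuous_intros)
    then show ?thesis by simp
  qed
  have g_norm: "norm (g u x t) \<le> K * r" if "u \<in> A" for u x t
    unfolding g_def using H that \<open>0 < K\<close> \<rho>_norm
    by (intro order_trans[OF norm_blinfun mult_mono]) (auto simp: A_def)
  define T0 where "T0 = (\<lambda>u x. z0 + integral (cbox 0 1) (g u x))"
  have T0_norm: "norm (integral (cbox 0 1) (g u x)) \<le> K * r" if "u \<in> A" for u x
    using integral_bound[OF _ g_line[OF that] g_norm[OF that]] by simp
  have T0_bc: "T0 u \<in> bcontfun" if "u \<in> A" for u
    by (rule bcontfun_normI[of _ "norm z0 + K * r"])
      (auto simp: T0_def simp del: box_real intro!: continuous_intros integral_continuous_on_param
          g_cont[unfolded cbox_interval[symmetric]] that norm_triangle_mono T0_norm)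
  define T where "T = (\<lambda>u. Bcontfun (T0 u))"
  have T_apply: "apply_bcontfun (T u) = T0 u" if "u \<in> A" for u
    unfolding T_def by (rule Bcontfun_inverse[OF T0_bc[OF that]])
  have "\<exists>!u\<in>A. T u = u"
  proof (rule Banach_fix[of A "1/2"])
    have "A = PiC UNIV (\<lambda>_. cball z0 R)" unfolding A_def by
        (auto simp: mem_PiC_iff Pi_iff simp del: mem_cball)
    then show "complete A" by (simp add: complete_eq_closed closed_PiC)
    have "const_bcontfun z0 \<in> A" using \<open>0 < R\<close> by (simp add: A_def const_bcontfun.rep_eq)
    then show "A \<noteq> {}" by blast
    show "T ` A \<subseteq> A"
    proof clarify
      fix u assume u: "u \<in> A"
      have "dist z0 (T0 u x) \<le> R" for x
        using T0_norm[OF u, of x] \<open>r * K \<le> R\<close> unfolding T0_def by (simp add: dist_norm mult.commute)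
      then show "T u \<in> A" using T_apply[OF u] unfolding A_def by simp
    qed
    fix u w assume uw: "u \<in> A" "w \<in> A"
    show "dist (T u) (T w) \<le> 1/2 * dist u w"
    proof (rule dist_bound)
      fix x
      have d: "norm (g u x t - g w x t) \<le> dist u w / 2" for t
      proof -
        let ?p = "t *\<^sub>R \<rho> x"
        have "norm (g u x t - g w x t) = norm (blinfun_apply (H (apply_bcontfun u ?p)
            - H (apply_bcontfun w ?p)) (\<rho> x))"
          by (simp add: g_def blinfun.bilinear_simps)
        also have "\<dots> \<le> (K * norm (apply_bcontfun u ?p - apply_bcontfun w ?p)) * r"
          using uw \<open>0 < K\<close> \<rho>_norm by (intro order_trans[OF norm_blinfun mult_mono] lip) (auto simp: A_def)
        also have "\<dots> \<le> (K * dist u w) * r"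
          using \<open>0 < K\<close> \<open>0 < r\<close> dist_bounded[of u ?p w] by (intro mult_right_mono mult_left_mono)
              (auto simp: dist_norm)
        also have "\<dots> = (r * K) * dist u w" by simp
        also have "\<dots> \<le> 1/2 * dist u w" using \<open>r * K \<le> 1/2\<close> by (intro mult_right_mono) auto
        finally show ?thesis by simp
      qed
      have "norm (integral (cbox 0 1) (\<lambda>t. g u x t - g w x t)) \<le> dist u w / 2"
        using integral_bound[of 0 1 "\<lambda>t. g u x t - g w x t" "dist u w / 2"] d
          continuous_on_diff[OF g_line[OF uw(1)] g_line[OF uw(2)]] by simp
      then show "dist (apply_bcontfun (T u) x) (apply_bcontfun (T w) x) \<le> 1/2 * dist u w"
        using integral_diff[OF integrable_continuous_real[OF g_line[OF uw(1)]]
            integrable_continuous_real[OF g_line[OF uw(2)]], of x x]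
        by (simp add: T_apply uw T0_def dist_norm)
    qed
  qed auto
  then obtain u where u: "u \<in> A" "T u = u" by blast
  define y where "y = apply_bcontfun u"
  have y_cont: "continuous_on UNIV y" unfolding y_def by simp
  have y_in: "y v \<in> cball z0 R" for v using u(1) unfolding y_def A_def by blast
  have fix_eq: "y v = z0 + integral {0..1} (\<lambda>t. blinfun_apply (H (y (t *\<^sub>R v))) v)" if "norm v \<le> r" for v
  proof -
    have "y v = T0 u v" unfolding y_def using T_apply[OF u(1)] u(2) by simp
    then show ?thesis using \<rho>_id[OF that] by (simp add: T0_def g_def y_def)
  qed
  show ?thesis
  proof (rule that[of y])
    show "y 0 = z0" using fix_eq[of 0] \<open>0 < r\<close> by simp
    fix v :: 'e and t :: real assume v: "norm v \<le> r" and t: "t \<in> {0..1}"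
    define h where "h = (\<lambda>t. blinfun_apply (H (y (t *\<^sub>R v))) v)"
    define G where "G = (\<lambda>s. integral {0..s} h)"
    have "continuous_on {0..1} (\<lambda>t :: real. y (t *\<^sub>R v))"
      by (rule continuous_on_compose2[OF y_cont]) (auto intro!: continuous_intros)
    then have h_cont: "continuous_on {0..1} h" unfolding h_def
      using y_in by (intro bounded_bilinear.continuous_on[OF bounded_bilinear_blinfun_apply]
          continuous_on_const
        continuous_on_compose2[OF H_cont]) auto
    have G: "(G has_vector_derivative h s) (at s within {0..1})" if "s \<in> {0..1}" for s
      unfolding G_def by (rule integral_has_vector_derivative[OF h_cont that])
    \<comment> \<open>The fixed point equation at the endpoint \<open>s v\<close> integrates over
      \<open>[0, 1]\<close> with direction \<open>s v\<close>; substituting \<open>s * t\<close>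
      turns this into the integral over \<open>[0, s]\<close> along the ray of
      \<open>v\<close>.\<close>
    have eq: "y (s *\<^sub>R v) = z0 + G s" if s: "s \<in> {0..1}" for s
    proof -
      have "((\<lambda>t. s *\<^sub>R h (s * t)) has_integral (G (s * 1) - G (s * 0))) {0..1}"
      proof (rule fundamental_theorem_of_calculus)
        fix t :: real assume t: "t \<in> {0..1}"
        have im: "(\<lambda>t. s * t) ` {0..1} \<subseteq> {0..1}" using s by (auto simp: mult_le_one)
        have st: "s * t \<in> {0..1}" using im t by blast
        have "((\<lambda>t. s * t) has_vector_derivative s) (at t within {0..1})"
          by (auto intro!: derivative_eq_intros simp: has_vector_derivative_def)
        from vector_diff_chain_within[OF this has_vector_derivative_within_subset[OF G[OF st] im]]
        show "((\<lambda>t. G (s * t)) has_vector_derivative s *\<^sub>R h (s * t)) (at t within {0..1})" by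
            (simp add: o_def)
      qed simp
      moreover have "G 0 = 0" unfolding G_def by simp
      ultimately have "integral {0..1} (\<lambda>t. s *\<^sub>R h (s * t)) = G s" by (intro integral_unique) simp
      moreover have "norm (s *\<^sub>R v) \<le> r" using s v mult_left_le_one_le[of "norm v" s] by simp
      ultimately show ?thesis using fix_eq[of "s *\<^sub>R v"] by
          (simp add: h_def blinfun.scaleR_right mult.commute)
    qed
    have "((\<lambda>s. z0 + G s) has_vector_derivative h t) (at t within {0..1})"
      using has_vector_derivative_add[OF has_vector_derivative_const G[OF t]] by simp
    then have "((\<lambda>t. y (t *\<^sub>R v)) has_vector_derivative h t) (at t within {0..1})"
      by (rule has_vector_derivative_transform[OF t, rotated]) (use eq in auto)
    then show "((\<lambda>t. y (t *\<^sub>R v)) has_vector_derivative blinfun_apply (H (y (t *\<^sub>R v))) v) (at t within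
        {0..1})"
      unfolding h_def .
  qed (use y_cont y_in in auto)
qed

text \<open>The radial equation determines \<open>y\<close> along each ray only; integrability makes
  \<open>H (y b)\<close> its derivative in all directions. The condition \<open>sym\<close> is
  required just at values of \<open>y\<close>, so that it may be verified for the constructed
  solution.\<close>

lemma ray_ode_differentiable:
  fixes H :: "'z::real_normed_vector \<Rightarrow> 'e::real_normed_vector \<Rightarrow>\<^sub>L 'z" and H' :: "'z \<Rightarrow> 'z \<Rightarrow>\<^sub>L 'e \<Rightarrow>\<^sub>L 'z"
  assumes "0 < K" "r * K \<le> 1/2" and y0: "y 0 = z0" and y_in: "\<And>v. norm v \<le> r \<Longrightarrow> y v \<in> B"
    and H: "\<And>z. z \<in> B \<Longrightarrow> norm (H z) \<le> K"
    and lip: "\<And>z z'. z \<in> B \<Longrightarrow> z' \<in> B \<Longrightarrow> norm (H z' - H z) \<le> K * norm (z' - z)"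
    and H': "\<And>z. z \<in> B \<Longrightarrow> (H has_derivative blinfun_apply (H' z)) (at z)" "\<And>z. z \<in> B \<Longrightarrow> norm (H' z) \<le> K"
    and taylor: "\<And>z z'. z \<in> B \<Longrightarrow> z' \<in> B \<Longrightarrow>
      norm (H z' - H z - blinfun_apply (H' z) (z' - z)) \<le> K * (norm (z' - z))\<^sup>2"
    and ode: "\<And>v t. norm v \<le> r \<Longrightarrow> t \<in> {0..1} \<Longrightarrow>
       ((\<lambda>t. y (t *\<^sub>R v)) has_vector_derivative blinfun_apply (H (y (t *\<^sub>R v))) v) (at t within {0..1})"
    and sym: "\<And>v u w. norm v \<le> r \<Longrightarrow> blinfun_apply (blinfun_apply (H' (y v)) (blinfun_apply (H (y v)) u)) w
       = blinfun_apply (blinfun_apply (H' (y v)) (blinfun_apply (H (y v)) w)) u"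
    and b: "norm b < r"
  shows "(y has_derivative blinfun_apply (H (y b))) (at b)"
proof -
  have r: "0 < r" using b norm_ge_zero[of b] by linarith
  have seg: "norm (t *\<^sub>R v) \<le> r" if "norm v \<le> r" "t \<in> {0..1}" for v :: 'e and t :: real
    using that mult_left_le_one_le[of "norm v" t] by simp
  \<comment> \<open>Lipschitz dependence on the endpoint makes the Taylor remainder of
    \<open>H\<close> quadratic in \<open>a - b\<close>.\<close>
  have y_lip: "norm (y (t *\<^sub>R a) - y (t *\<^sub>R b)) \<le> 2 * (K * norm (a - b))"
    if a: "norm a \<le> r" and t: "t \<in> {0..1}" for a t
  proof (rule vector_derivative_sup_bound[where e = "\<lambda>t. y (t *\<^sub>R a) - y (t *\<^sub>R b)", OF _ _ _ t])
    fix t :: real assume t: "t \<in> {0..1}"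
    show "((\<lambda>t. y (t *\<^sub>R a) - y (t *\<^sub>R b)) has_vector_derivative
      (blinfun_apply (H (y (t *\<^sub>R a))) a - blinfun_apply (H (y (t *\<^sub>R b))) b)) (at t within {0..1})"
      using a b t by (intro has_vector_derivative_diff ode) auto
    have ya: "y (t *\<^sub>R a) \<in> B" and yb: "y (t *\<^sub>R b) \<in> B" using y_in seg a b t by auto
    have eq: "blinfun_apply (H (y (t *\<^sub>R a))) a - blinfun_apply (H (y (t *\<^sub>R b))) b
      = blinfun_apply (H (y (t *\<^sub>R a)) - H (y (t *\<^sub>R b))) a + blinfun_apply (H (y (t *\<^sub>R b))) (a - b)"
      by (simp add: blinfun.bilinear_simps)
    have 1: "norm (blinfun_apply (H (y (t *\<^sub>R a)) - H (y (t *\<^sub>R b))) a)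
        \<le> norm (y (t *\<^sub>R a) - y (t *\<^sub>R b)) / 2"
    proof -
      have "norm (blinfun_apply (H (y (t *\<^sub>R a)) - H (y (t *\<^sub>R b))) a)
          \<le> (K * norm (y (t *\<^sub>R a) - y (t *\<^sub>R b))) * r"
        using a \<open>0 < K\<close> by (intro order_trans[OF norm_blinfun mult_mono] lip ya yb) auto
      also have "\<dots> = (r * K) * norm (y (t *\<^sub>R a) - y (t *\<^sub>R b))" by simp
      also have "\<dots> \<le> 1/2 * norm (y (t *\<^sub>R a) - y (t *\<^sub>R b))" using assms(2) by (intro mult_right_mono) auto
      finally show ?thesis by simp
    qed
    have 2: "norm (blinfun_apply (H (y (t *\<^sub>R b))) (a - b)) \<le> K * norm (a - b)"
      by (intro order_trans[OF norm_blinfun mult_right_mono] H yb) auto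
    show "norm (blinfun_apply (H (y (t *\<^sub>R a))) a - blinfun_apply (H (y (t *\<^sub>R b))) b)
      \<le> norm (y (t *\<^sub>R a) - y (t *\<^sub>R b)) / 2 + K * norm (a - b)"
      unfolding eq by (rule norm_triangle_mono[OF 1 2])
  qed simp
  \<comment> \<open>With the Lipschitz constant \<open>2 * K\<close> of \<open>y\<close>, the Taylor
    remainder of \<open>H\<close> applied to \<open>a\<close> yields the first summand, and the
    first-order change of \<open>H\<close> applied to \<open>a - b\<close> the second.\<close>
  define C where "C = 4 * (K * K * K) * r + 2 * (K * K)"
  have C: "C > 0" unfolding C_def using \<open>0 < K\<close> r by (auto intro!: add_pos_pos)
  text \<open>
    By symmetry the candidate \<open>H (y (t b)) (t w)\<close> satisfies the linearization of the equation of
    \<open>y (t a) - y (t b)\<close>, so that their difference \<open>e\<close> is driven by a quadratic error only.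
  \<close>
  have main: "norm (y a - y b - blinfun_apply (H (y b)) (a - b)) \<le> 2 * (C * (norm (a - b) * norm (a - b)))"
    if a: "norm a \<le> r" for a
  proof -
    let ?w = "a - b"
    let ?e = "\<lambda>t. y (t *\<^sub>R a) - y (t *\<^sub>R b) - blinfun_apply (H (y (t *\<^sub>R b))) (t *\<^sub>R ?w)"
    let ?e' = "\<lambda>t. blinfun_apply (H (y (t *\<^sub>R a))) a - blinfun_apply (H (y (t *\<^sub>R b))) b -
        (blinfun_apply (H (y (t *\<^sub>R b))) ?w +
         blinfun_apply (blinfun_apply (H' (y (t *\<^sub>R b))) (blinfun_apply (H (y (t *\<^sub>R b))) b)) (t *\<^sub>R ?w))"
    have "norm (?e 1) \<le> 2 * (C * (norm ?w * norm ?w))"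
    proof (rule vector_derivative_sup_bound[where e = ?e and e' = ?e'])
      fix t :: real assume t: "t \<in> {0..1}"
      have ya: "y (t *\<^sub>R a) \<in> B" and yb: "y (t *\<^sub>R b) \<in> B" using y_in seg a b t by auto
      let ?Y = "y (t *\<^sub>R b)"
      have yd: "((\<lambda>t. y (t *\<^sub>R b)) has_derivative (\<lambda>h. h *\<^sub>R blinfun_apply (H ?Y) b)) (at t within {0..1})"
        using ode[of b t] b t by (simp add: has_vector_derivative_def)
      have Hd: "((\<lambda>t. H (y (t *\<^sub>R b))) has_derivative (\<lambda>h. blinfun_apply (H' ?Y) (h *\<^sub>R blinfun_apply (H
          ?Y) b))) (at t within {0..1})"
        using has_derivative_compose[OF yd, OF H'(1)[OF yb]] .
      have wd: "((\<lambda>t. t *\<^sub>R ?w) has_derivative (\<lambda>h. h *\<^sub>R ?w)) (at t within {0..1})"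
        by (auto intro!: derivative_eq_intros)
      have "((\<lambda>t. blinfun_apply (H (y (t *\<^sub>R b))) (t *\<^sub>R ?w)) has_vector_derivative
         (blinfun_apply (H ?Y) ?w + blinfun_apply (blinfun_apply (H' ?Y) (blinfun_apply (H ?Y) b)) (t *\<^sub>R
             ?w))) (at t within {0..1})"
        using bounded_bilinear.FDERIV[OF bounded_bilinear_blinfun_apply Hd wd]
        by (simp add: has_vector_derivative_def blinfun.bilinear_simps algebra_simps)
      then show "(?e has_vector_derivative ?e' t) (at t within {0..1})"
        using a b t by (intro has_vector_derivative_diff ode) auto
      let ?d = "y (t *\<^sub>R a) - ?Y"
      have s: "blinfun_apply (blinfun_apply (H' ?Y) (blinfun_apply (H ?Y) b)) (t *\<^sub>R ?w)
          = blinfun_apply (blinfun_apply (H' ?Y) (blinfun_apply (H ?Y) (t *\<^sub>R ?w))) b"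
        by (rule sym) (use seg b t in auto)
      \<comment> \<open>Writing \<open>a\<close> as \<open>b + ?w\<close> in the first-order term
        leaves the Taylor remainder, a term quadratic in \<open>?w\<close>, and, after the exchange
        in \<open>s\<close>, a term linear in \<open>?e t\<close> that is absorbed because
        \<open>r * K \<le> 1/2\<close>.\<close>
      have eq: "?e' t = blinfun_apply (H (y (t *\<^sub>R a)) - H ?Y - blinfun_apply (H' ?Y) ?d) a
          + blinfun_apply (blinfun_apply (H' ?Y) ?d) ?w + blinfun_apply (blinfun_apply (H' ?Y) (?e t)) b"
        unfolding s by (simp add: blinfun.bilinear_simps algebra_simps)
      have d: "norm ?d \<le> 2 * (K * norm ?w)" by (rule y_lip[OF a t])
      have 1: "norm (blinfun_apply (H (y (t *\<^sub>R a)) - H ?Y - blinfun_apply (H' ?Y) ?d) a)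
          \<le> (K * (2 * (K * norm ?w))\<^sup>2) * r"
      proof (rule order_trans[OF norm_blinfun mult_mono])
        show "norm (H (y (t *\<^sub>R a)) - H ?Y - blinfun_apply (H' ?Y) ?d) \<le> K * (2 * (K * norm ?w))\<^sup>2"
          by (rule order_trans[OF taylor[OF yb ya]]) (rule mult_left_mono[OF power_mono[OF d norm_ge_zero]
              less_imp_le[OF \<open>0 < K\<close>]])
      qed (use a \<open>0 < K\<close> in auto)
      have 2: "norm (blinfun_apply (blinfun_apply (H' ?Y) ?d) ?w) \<le> (K * (2 * (K * norm ?w))) * norm ?w"
        using d \<open>0 < K\<close> by (intro order_trans[OF norm_blinfun mult_right_mono] order_trans[OF norm_blinfun
            mult_mono] H'(2) yb) auto
      have 3: "norm (blinfun_apply (blinfun_apply (H' ?Y) (?e t)) b) \<le> norm (?e t) / 2"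
      proof -
        have "norm (blinfun_apply (blinfun_apply (H' ?Y) (?e t)) b) \<le> (K * norm (?e t)) * r"
          using b \<open>0 < K\<close> by (intro order_trans[OF norm_blinfun mult_mono] order_trans[OF norm_blinfun
              mult_right_mono] H'(2) yb) auto
        also have "\<dots> = (r * K) * norm (?e t)" by simp
        also have "\<dots> \<le> 1/2 * norm (?e t)" using assms(2) by (intro mult_right_mono) auto
        finally show ?thesis by simp
      qed
      have "norm (?e' t) \<le> (K * (2 * (K * norm ?w))\<^sup>2) * r + (K * (2 * (K * norm ?w))) * norm ?w
          + norm (?e t) / 2"
        unfolding eq by (rule norm_triangle_mono[OF norm_triangle_mono[OF 1 2] 3])
      also have "\<dots> = norm (?e t) / 2 + C * (norm ?w * norm ?w)"
        unfolding C_def by (simp add: algebra_simps power2_eq_square)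
      finally show "norm (?e' t) \<le> norm (?e t) / 2 + C * (norm ?w * norm ?w)" .
    qed auto
    then show ?thesis by simp
  qed
  show ?thesis unfolding has_derivative_at_alt
  proof (intro conjI allI impI)
    fix \<epsilon> :: real assume "\<epsilon> > 0"
    show "\<exists>d>0. \<forall>a. norm (a - b) < d \<longrightarrow> norm (y a - y b - blinfun_apply (H (y b)) (a - b)) \<le> \<epsilon> * norm (a - b)"
    proof (intro exI[of _ "min (r - norm b) (\<epsilon> / (2 * C))"] conjI allI impI)
      fix a assume a: "norm (a - b) < min (r - norm b) (\<epsilon> / (2 * C))"
      have "norm a \<le> r" using a norm_triangle_sub[of a b] by simp
      from main[OF this] have "norm (y a - y b - blinfun_apply (H (y b)) (a - b))
          \<le> (norm (a - b) * (2 * C)) * norm (a - b)"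
        by (simp add: ac_simps)
      also have "\<dots> \<le> \<epsilon> * norm (a - b)"
        using a C by (intro mult_right_mono) (auto simp: pos_less_divide_eq)
      finally show "norm (y a - y b - blinfun_apply (H (y b)) (a - b)) \<le> \<epsilon> * norm (a - b)" .
    qed (use b C \<open>\<epsilon> > 0\<close> in auto)
  qed (rule blinfun.bounded_linear_right)
qed

lemma blinfun_differentiable_bound:
  assumes "convex B" and f: "\<And>z. z \<in> B \<Longrightarrow> (f has_derivative blinfun_apply (f' z)) (at z)"
    and K: "\<And>z. z \<in> B \<Longrightarrow> norm (f' z) \<le> K" and z: "z \<in> B" "z' \<in> B"
  shows "norm (f z' - f z) \<le> K * norm (z' - z)"
proof (rule differentiable_bound[OF assms(1) _ _ z(2,1)])
  show "(f has_derivative blinfun_apply (f' x)) (at x within B)" if "x \<in> B" for x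
    by (rule has_derivative_at_withinI[OF f[OF that]])
  show "onorm (blinfun_apply (f' x)) \<le> K" if "x \<in> B" for x
    using K[OF that] by (simp add: norm_blinfun.rep_eq)
qed

lemma smooth_on_locally_bounded_at:
  assumes "smooth_on U f" "z0 \<in> U"
  obtains R K where "0 < R" "0 < K" "cball z0 R \<subseteq> U" "\<And>z. z \<in> cball z0 R \<Longrightarrow> norm (f z) \<le> K"
proof -
  obtain d where d: "d > 0" "cball z0 d \<subseteq> U"
    using smooth_on_open[OF assms(1)] assms(2) open_contains_cball by blast
  have "isCont f z0" using smooth_on_differentiable[OF assms] differentiable_imp_continuous_within by blast
  then obtain e where e: "e > 0" "\<And>z. dist z z0 < e \<Longrightarrow> dist (f z) (f z0) < 1"
    unfolding continuous_at_eps_delta by (metis zero_less_one)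
  show ?thesis
  proof (rule that[of "min d (e / 2)" "norm (f z0) + 1"])
    fix z assume "z \<in> cball z0 (min d (e / 2))"
    then have "dist z z0 < e" using e(1) by (auto simp: dist_commute)
    from e(2)[OF this] show "norm (f z) \<le> norm (f z0) + 1"
      using norm_triangle_sub[of "f z" "f z0"] by (simp add: dist_norm)
  qed (use d e in \<open>auto simp: add_nonneg_pos\<close>)
qed

text \<open>A conditional Frobenius theorem: the radial solution \<open>y\<close> is returned
  unconditionally, and integrability is a premise of the last clause, restricted to the values of
  \<open>y\<close>. For affine maps it can be proved only along \<open>y\<close>, by means of the
  radial equation. The number \<open>\<epsilon>\<close> lets the caller limit both the radius and
  the deviation from \<open>z0\<close>.\<close>

lemma frobenius:
  fixes H :: "'z::banach \<Rightarrow> 'e::real_normed_vector \<Rightarrow>\<^sub>L 'z"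
  assumes H: "smooth_on U H" and z0: "z0 \<in> U" and "\<epsilon> > 0"
    and H': "\<And>z. z \<in> U \<Longrightarrow> (H has_derivative blinfun_apply (H' z)) (at z)"
  obtains r y where "0 < r" "r \<le> \<epsilon>" "y 0 = z0" "\<And>v. norm v \<le> r \<Longrightarrow> y v \<in> U" "\<And>v. norm v \<le> r \<Longrightarrow> dist z0 (y v) \<le> \<epsilon>"
    "\<And>v t. norm v \<le> r \<Longrightarrow> t \<in> {0..1} \<Longrightarrow>
       ((\<lambda>t. y (t *\<^sub>R v)) has_vector_derivative blinfun_apply (H (y (t *\<^sub>R v))) v) (at t within {0..1})"
    "\<And>v. (\<And>v u w. norm v \<le> r \<Longrightarrow> blinfun_apply (blinfun_apply (H' (y v)) (blinfun_apply (H (y v)) u)) w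
       = blinfun_apply (blinfun_apply (H' (y v)) (blinfun_apply (H (y v)) w)) u) \<Longrightarrow>
     norm v < r \<Longrightarrow> (y has_derivative blinfun_apply (H (y v))) (at v)"
proof -
  have o: "open U" by (rule smooth_on_open[OF H])
  obtain H1 where H1: "smooth_on U H1" "\<And>z. z \<in> U \<Longrightarrow> (H has_derivative blinfun_apply (H1 z)) (at z)"
    by (rule smooth_on_blinfun_derivative[OF H]) blast
  \<comment> \<open>\<open>H'\<close> is given merely as some derivative; uniqueness identifies it
    on \<open>U\<close> with the smooth one.\<close>
  have "H1 z = H' z" if "z \<in> U" for z
    using has_derivative_unique[OF H1(2)[OF that] H'[OF that]] by (simp add: blinfun_apply_inject)
  then have sH': "smooth_on U H'" by (rule smooth_on_cong[OF H1(1)])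
  obtain H2 where H2: "smooth_on U H2" "\<And>z. z \<in> U \<Longrightarrow> (H' has_derivative blinfun_apply (H2 z)) (at z)"
    by (rule smooth_on_blinfun_derivative[OF sH']) blast
  obtain R0 K0 where 0: "0 < R0" "0 < K0" "cball z0 R0 \<subseteq> U" "\<And>z. z \<in> cball z0 R0 \<Longrightarrow> norm (H z) \<le> K0"
    by (rule smooth_on_locally_bounded_at[OF H z0]) blast
  obtain R1 K1 where 1: "0 < R1" "0 < K1" "cball z0 R1 \<subseteq> U" "\<And>z. z \<in> cball z0 R1 \<Longrightarrow> norm (H' z) \<le> K1"
    by (rule smooth_on_locally_bounded_at[OF sH' z0]) blast
  obtain R2 K2 where 2: "0 < R2" "0 < K2" "cball z0 R2 \<subseteq> U" "\<And>z. z \<in> cball z0 R2 \<Longrightarrow> norm (H2 z) \<le> K2"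
    by (rule smooth_on_locally_bounded_at[OF H2(1) z0]) blast
  define R where "R = min (min R0 \<epsilon>) (min R1 R2)"
  define K where "K = K0 + K1 + K2"
  define B where "B = cball z0 R"
  have R: "R > 0" "R \<le> R0" "R \<le> R1" "R \<le> R2" "R \<le> \<epsilon>" unfolding R_def using 0 1 2 \<open>\<epsilon> > 0\<close> by auto
  have K: "K > 0" unfolding K_def using 0 1 2 by simp
  have BU: "B \<subseteq> U" unfolding B_def using R(2) 0(3) by auto
  have nH: "norm (H z) \<le> K" and nH': "norm (H' z) \<le> K" and nH2: "norm (H2 z) \<le> K" if "z \<in> B" for z
    using 0(2) 1(2) 2(2) 0(4)[of z] 1(4)[of z] 2(4)[of z] that R unfolding K_def B_def by auto
  have cB: "convex B" unfolding B_def by simp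
  have lip: "norm (H z' - H z) \<le> K * norm (z' - z)" if "z \<in> B" "z' \<in> B" for z z'
    using H' nH' BU that by (intro blinfun_differentiable_bound[OF cB, where f' = H']) blast+
  have lip': "norm (H' z' - H' z) \<le> K * norm (z' - z)" if "z \<in> B" "z' \<in> B" for z z'
    using H2(2) nH2 BU that by (intro blinfun_differentiable_bound[OF cB, where f' = H2]) blast+
  have taylor: "norm (H z' - H z - blinfun_apply (H' z) (z' - z)) \<le> K * (norm (z' - z))\<^sup>2" if zz: "z \<in> B"
      "z' \<in> B" for z z'
  proof -
    have seg: "closed_segment z z' \<subseteq> B" using zz unfolding B_def by (simp add: closed_segment_subset)
    have "norm (H z' - H z - blinfun_apply (H' z) (z' - z)) \<le> norm (z' - z) * (K * norm (z' - z))"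
    proof (rule differentiable_bound_linearization[of z z' "closed_segment z z'" H "\<lambda>z. blinfun_apply (H'
        z)" z])
      show "z + t *\<^sub>R (z' - z) \<in> closed_segment z z'" if "t \<in> {0..1}" for t
        using that unfolding closed_segment_def by (auto intro!: exI[of _ t] simp: algebra_simps)
      fix x assume x: "x \<in> closed_segment z z'"
      show "(H has_derivative blinfun_apply (H' x)) (at x within closed_segment z z')"
        by (rule has_derivative_at_withinI[OF H']) (use x seg BU in blast)
      have "norm (H' x - H' z) \<le> K * norm (z' - z)"
        using lip'[of z x] zz(1) x seg mult_left_mono[OF segment_bound(1)[OF x] less_imp_le[OF K]]
        by (meson order_trans subsetD)
      then show "onorm (blinfun_apply (H' x) - blinfun_apply (H' z)) \<le> K * norm (z' - z)"
        by (simp add: norm_blinfun.rep_eq minus_blinfun.rep_eq fun_diff_def)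
    qed simp
    then show ?thesis by (simp add: power2_eq_square ac_simps)
  qed
  \<comment> \<open>The quotients \<open>R / K\<close> and \<open>1 / (2 * K)\<close> give
    \<open>r * K \<le> R\<close>, by which solutions stay in \<open>B\<close>, and
    \<open>r * K \<le> 1/2\<close> for contraction and absorption.\<close>
  define r where "r = min \<epsilon> (min (R / K) (1 / (2 * K)))"
  have r: "0 < r" "r \<le> \<epsilon>" "r * K \<le> R" "r * K \<le> 1/2"
  proof -
    have "r * K \<le> R / K * K" "r * K \<le> 1 / (2 * K) * K" unfolding r_def using K
        by (intro mult_right_mono; simp)+
    then show "r * K \<le> R" "r * K \<le> 1/2" using K by auto
  qed (use \<open>\<epsilon> > 0\<close> R K in \<open>auto simp: r_def\<close>)
  obtain y where y: "continuous_on UNIV y" "y 0 = z0" "\<And>v. y v \<in> B"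
    "\<And>v t. norm v \<le> r \<Longrightarrow> t \<in> {0..1} \<Longrightarrow>
       ((\<lambda>t. y (t *\<^sub>R v)) has_vector_derivative blinfun_apply (H (y (t *\<^sub>R v))) v) (at t within {0..1})"
  proof (rule ray_ode_exists[where ?z0.0 = z0 and H = H, OF r(1) K R(1) r(3,4)])
    show "norm (H z) \<le> K" if "z \<in> cball z0 R" for z
      using nH that unfolding B_def by blast
    show "norm (H z' - H z) \<le> K * norm (z' - z)" if "z \<in> cball z0 R" "z' \<in> cball z0 R" for z z'
      using lip that unfolding B_def by blast
    fix y :: "'e \<Rightarrow> 'z"
    assume "continuous_on UNIV y" "y 0 = z0" "\<And>v. y v \<in> cball z0 R"
      "\<And>v t. norm v \<le> r \<Longrightarrow> t \<in> {0..1} \<Longrightarrow>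
       ((\<lambda>t. y (t *\<^sub>R v)) has_vector_derivative blinfun_apply (H (y (t *\<^sub>R v))) v) (at t within {0..1})"
    then show thesis unfolding B_def[symmetric] by (rule that)
  qed
  show ?thesis
  proof (rule that[of r y])
    show "(y has_derivative blinfun_apply (H (y v))) (at v)"
      if "\<And>v u w. norm v \<le> r \<Longrightarrow> blinfun_apply (blinfun_apply (H' (y v)) (blinfun_apply (H (y v)) u)) w
       = blinfun_apply (blinfun_apply (H' (y v)) (blinfun_apply (H (y v)) w)) u" "norm v < r" for v
      by (rule ray_ode_differentiable[where K = K and B = B
          and r = r, OF K r(4) y(2) y(3) nH lip H' nH' taylor y(4) that])
        (use BU in auto)
    show "dist z0 (y v) \<le> \<epsilon>" for v using y(3)[of v] R(5) unfolding B_def by simp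
  qed (use r y BU in auto)
qed

section \<open>Affine maps between open subsets of Banach spaces\<close>

text \<open>
  Here \<open>B\<close> and \<open>D\<close> are the values at a point of the local representative of the connection and of its
  derivative, and \<open>Dv\<close> and \<open>Sv\<close> are the derivatives of these two in a direction \<open>v\<close>.
\<close>

definition local_torsion :: "('a::real_normed_vector \<Rightarrow>\<^sub>L 'a \<Rightarrow>\<^sub>L 'a) \<Rightarrow> 'a \<Rightarrow> 'a \<Rightarrow> 'a" where
  "local_torsion B u v = B u v - B v u"

definition local_curvature ::
    "('a::real_normed_vector \<Rightarrow>\<^sub>L 'a \<Rightarrow>\<^sub>L 'a) \<Rightarrow> ('a \<Rightarrow>\<^sub>L 'a \<Rightarrow>\<^sub>L 'a \<Rightarrow>\<^sub>L 'a) \<Rightarrow> 'a \<Rightarrow> 'a \<Rightarrow> 'a \<Rightarrow> 'a" where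
  "local_curvature B D a b c = D b c a - D a c b + B (B c b) a - B (B c a) b"

definition local_curvature_derivative ::
    "('a::real_normed_vector \<Rightarrow>\<^sub>L 'a \<Rightarrow>\<^sub>L 'a) \<Rightarrow> ('a \<Rightarrow>\<^sub>L 'a \<Rightarrow>\<^sub>L 'a \<Rightarrow>\<^sub>L 'a) \<Rightarrow>
     ('a \<Rightarrow>\<^sub>L 'a \<Rightarrow>\<^sub>L 'a \<Rightarrow>\<^sub>L 'a) \<Rightarrow> ('a \<Rightarrow>\<^sub>L 'a \<Rightarrow>\<^sub>L 'a) \<Rightarrow> 'a \<Rightarrow> 'a \<Rightarrow> 'a \<Rightarrow> 'a" where
  "local_curvature_derivative B D Sv Dv a b c =
     Sv b c a - Sv a c b + Dv (B c b) a + B (Dv c b) a - Dv (B c a) b - B (Dv c a) b"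

text \<open>For fields with constant coordinates \<open>a\<close>, the covariant derivative in
  direction \<open>v\<close> is \<open>- \<beta> x a v\<close>. Hence the last two assumptions are
  the vanishing of the covariant derivatives of torsion and curvature, with the ordinary derivative
  isolated on the left. As the curvature contains \<open>\<beta>'\<close>, its derivative contains
  \<open>\<beta>''\<close>.\<close>

locale locally_parallel =
  fixes V :: "'a::real_normed_vector set" and \<beta> :: "'a \<Rightarrow> 'a \<Rightarrow>\<^sub>L 'a \<Rightarrow>\<^sub>L 'a"
    and \<beta>' :: "'a \<Rightarrow> 'a \<Rightarrow>\<^sub>L 'a \<Rightarrow>\<^sub>L 'a \<Rightarrow>\<^sub>L 'a" and \<beta>'' :: "'a \<Rightarrow> 'a \<Rightarrow>\<^sub>L 'a \<Rightarrow>\<^sub>L 'a \<Rightarrow>\<^sub>L 'a \<Rightarrow>\<^sub>L 'a"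
  assumes smooth: "smooth_on V \<beta>" "smooth_on V \<beta>'"
    and deriv: "\<And>x. x \<in> V \<Longrightarrow> (\<beta> has_derivative blinfun_apply (\<beta>' x)) (at x)"
      "\<And>x. x \<in> V \<Longrightarrow> (\<beta>' has_derivative blinfun_apply (\<beta>'' x)) (at x)"
    and torsion_parallel: "\<And>x v a b. x \<in> V \<Longrightarrow> local_torsion (\<beta>' x v) a b =
      \<beta> x (local_torsion (\<beta> x) a b) v - local_torsion (\<beta> x) (\<beta> x a v) b - local_torsion (\<beta> x) a (\<beta> x b v)"
    and curvature_parallel: "\<And>x v a b c. x \<in> V \<Longrightarrow>
        local_curvature_derivative (\<beta> x) (\<beta>' x) (\<beta>'' x v) (\<beta>' x v) a b c =
      \<beta> x (local_curvature (\<beta> x) (\<beta>' x) a b c) v - local_curvature (\<beta> x) (\<beta>' x) (\<beta> x a v) b c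
      - local_curvature (\<beta> x) (\<beta>' x) a (\<beta> x b v) c - local_curvature (\<beta> x) (\<beta>' x) a b (\<beta> x c v)"

lemma local_torsion_diff:
  "local_torsion B (a - a') b = local_torsion B a b - local_torsion B a' b"
  "local_torsion B a (b - b') = local_torsion B a b - local_torsion B a b'"
  by (simp_all add: local_torsion_def blinfun.bilinear_simps)

lemma local_curvature_diff:
  "local_curvature B D (a - a') b c = local_curvature B D a b c - local_curvature B D a' b c"
  "local_curvature B D a (b - b') c = local_curvature B D a b c - local_curvature B D a b' c"
  "local_curvature B D a b (c - c') = local_curvature B D a b c - local_curvature B D a b c'"
  by (simp_all add: local_curvature_def blinfun.bilinear_simps)

lemma norm_blinfun_apply2: "norm (blinfun_apply (blinfun_apply T u) v) \<le> norm T * norm u * norm v"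
  by (meson norm_blinfun order_trans mult_right_mono norm_ge_zero)

lemma norm_blinfun_le:
  assumes "norm T \<le> K" "norm u \<le> m"
  shows "norm (blinfun_apply T u) \<le> K * m"
  by (rule order_trans[OF norm_blinfun mult_mono]) (use assms order_trans[OF norm_ge_zero] in auto)

lemma norm_local_torsion:
  assumes "norm B \<le> K"
  shows "norm (local_torsion B a b) \<le> 2 * K * (norm a * norm b)"
proof -
  have "norm (B a b) \<le> K * norm a * norm b" "norm (B b a) \<le> K * norm b * norm a"
    by (intro norm_blinfun_le assms order_refl)+
  from order_trans[OF norm_triangle_ineq4 add_mono[OF this]] show ?thesis
    unfolding local_torsion_def by (simp add: algebra_simps)
qed

lemma norm_local_curvature:
  assumes "norm B \<le> K" "norm D \<le> K"
  shows "norm (local_curvature B D a b c) \<le> (2 * K + 2 * (K * K)) * (norm a * norm b * norm c)"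
proof -
  have "norm (D b c a) \<le> K * norm b * norm c * norm a" "norm (D a c b) \<le> K * norm a * norm c * norm b"
    "norm (B (B c b) a) \<le> K * (K * norm c * norm b) * norm a"
        "norm (B (B c a) b) \<le> K * (K * norm c * norm a) * norm b"
    by (intro norm_blinfun_le assms order_refl)+
  note * = norm_triangle_mono[OF order_trans[OF norm_triangle_ineq4 add_mono[OF this(1,2)]] this(3)] this(4)
  show ?thesis unfolding local_curvature_def
    using order_trans[OF norm_triangle_ineq4 add_mono[OF *]] by (simp add: algebra_simps)
qed

section \<open>Torsion and curvature along curves\<close>

lemma has_vector_derivative_blinfun_apply:
  assumes "(f has_vector_derivative f') (at t within S)" "(g has_vector_derivative g') (at t within S)"
  shows "((\<lambda>t. blinfun_apply (f t) (g t)) has_vector_derivative blinfun_apply (f t) g'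
      + blinfun_apply f' (g t)) (at t within S)"
  by (rule bounded_bilinear.has_vector_derivative[OF bounded_bilinear_blinfun_apply assms])

lemma has_vector_derivative_compose_blinfun:
  assumes "(X has_vector_derivative X') (at t within S)" "(f has_derivative blinfun_apply f') (at (X t))"
  shows "((\<lambda>t. f (X t)) has_vector_derivative blinfun_apply f' X') (at t within S)"
  using has_derivative_compose[OF assms(1)[unfolded has_vector_derivative_def], OF assms(2)]
  by (simp add: has_vector_derivative_def blinfun.scaleR_right)

lemma has_vector_derivative_local_torsion:
  assumes "(B has_vector_derivative B') (at t within S)" "(a has_vector_derivative a') (at t within S)"
    "(b has_vector_derivative b') (at t within S)"
  shows "((\<lambda>t. local_torsion (B t) (a t) (b t)) has_vector_derivative
    local_torsion B' (a t) (b t) + local_torsion (B t) a' (b t) + local_torsion (B t) (a t) b') (at t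
        within S)"
proof -
  note app = has_vector_derivative_blinfun_apply
  show ?thesis unfolding local_torsion_def
    by (rule has_vector_derivative_eq_rhs[OF has_vector_derivative_diff[OF
          app[OF app[OF assms(1,2)] assms(3)] app[OF app[OF assms(1,3)] assms(2)]]])
      (simp add: blinfun.bilinear_simps algebra_simps)
qed

lemma has_vector_derivative_local_curvature:
  assumes "(B has_vector_derivative B') (at t within S)" "(D has_vector_derivative D') (at t within S)"
    "(a has_vector_derivative a') (at t within S)" "(b has_vector_derivative b') (at t within S)"
    "(c has_vector_derivative c') (at t within S)"
  shows "((\<lambda>t. local_curvature (B t) (D t) (a t) (b t) (c t)) has_vector_derivative
    local_curvature_derivative (B t) (D t) D' B' (a t) (b t) (c t) + local_curvature (B t) (D t) a' (b t)
        (c t)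
    + local_curvature (B t) (D t) (a t) b' (c t) + local_curvature (B t) (D t) (a t) (b t) c') (at t
        within S)"
proof -
  note app = has_vector_derivative_blinfun_apply
  note B = assms(1) and D = assms(2) and a = assms(3) and b = assms(4) and c = assms(5)
  show ?thesis unfolding local_curvature_def local_curvature_derivative_def
    by (rule has_vector_derivative_eq_rhs[OF has_vector_derivative_diff[OF has_vector_derivative_add[OF
        has_vector_derivative_diff[OF
          app[OF app[OF app[OF D b] c] a] app[OF app[OF app[OF D a] c] b]]
          app[OF app[OF B app[OF app[OF B c] b]] a]] app[OF app[OF B app[OF app[OF B c] a]] b]]])
      (simp add: blinfun.bilinear_simps algebra_simps)
qed

text \<open>By the mean value inequality the bound for the family halves at each step, which replaces Gronwall's
    lemma.\<close>

lemma vector_derivative_family_zero: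
  fixes \<phi> :: "'i \<Rightarrow> real \<Rightarrow> 'z::real_normed_vector"
  assumes d: "\<And>i t. t \<in> {0..1} \<Longrightarrow> (\<phi> i has_vector_derivative \<phi>' i t) (at t within {0..1})"
    and zero: "\<And>i. \<phi> i 0 = 0" and n: "\<And>i. n i \<ge> 0"
    and M: "\<And>i t. t \<in> {0..1} \<Longrightarrow> norm (\<phi> i t) \<le> M * n i"
    and halve: "\<And>m i t. (\<And>i t. t \<in> {0..1} \<Longrightarrow> norm (\<phi> i t) \<le> m * n i) \<Longrightarrow> m \<ge> 0 \<Longrightarrow> t \<in> {0..1} \<Longrightarrow>
        norm (\<phi>' i t) \<le> m / 2 * n i"
    and t: "t \<in> {0..1}"
  shows "\<phi> i t = 0"
proof -
  have "norm (\<phi> i t) \<le> \<bar>M\<bar> / 2 ^ k * n i" if "t \<in> {0..1}" for i t k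
    using that
  proof (induction k arbitrary: i t)
    case (0 i t)
    have "M * n i \<le> \<bar>M\<bar> * n i" using n by (intro mult_right_mono) auto
    then show ?case using M[OF 0, of i] by simp
  next
    case (Suc k i t)
    let ?b = "\<bar>M\<bar> / 2 ^ k / 2 * n i"
    have b: "?b \<ge> 0" using n by simp
    have "norm (\<phi> i t - \<phi> i 0) \<le> ?b * norm (t - 0)"
    proof (rule differentiable_bound[of "{0..1}" "\<phi> i" "\<lambda>t h. h *\<^sub>R \<phi>' i t"])
      fix s :: real assume s: "s \<in> {0..1}"
      show "(\<phi> i has_derivative (\<lambda>h. h *\<^sub>R \<phi>' i s)) (at s within {0..1})"
        using d[OF s] by (simp add: has_vector_derivative_def)
      have *: "norm (\<phi>' i s) \<le> ?b" by (rule halve[OF Suc.IH]) (use s in auto)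
      show "onorm (\<lambda>h. h *\<^sub>R \<phi>' i s) \<le> ?b"
      proof (rule onorm_bound[OF b])
        show "norm (h *\<^sub>R \<phi>' i s) \<le> ?b * norm h" for h
          using mult_right_mono[OF * norm_ge_zero[of h]] by (simp add: mult.commute)
      qed
    qed (use Suc.prems in auto)
    also have "\<dots> \<le> ?b * 1" using Suc.prems b by (intro mult_left_mono) auto
    finally show ?case using zero by simp
  qed
  from this[OF t, of i] have *: "norm (\<phi> i t) \<le> (\<bar>M\<bar> * n i) * (1/2) ^ k" for k by (simp add: power_divide)
  have "(\<lambda>k. (\<bar>M\<bar> * n i) * (1/2) ^ k) \<longlonglongrightarrow> (\<bar>M\<bar> * n i) * 0"
    by (intro tendsto_mult tendsto_const LIMSEQ_realpow_zero) auto
  then have "norm (\<phi> i t) \<le> (\<bar>M\<bar> * n i) * 0"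
    by (rule LIMSEQ_le_const) (use * in blast)
  then show ?thesis by simp
qed

text \<open>Composing the bilinear maps with \<open>L\<close> produces an operator that takes the
  argument \<open>u\<close> of \<open>L\<close> first and the direction \<open>v\<close> second; the
  derivative of \<open>L\<close> has to take the direction first.\<close>

definition blinfun_flip :: "('a::real_normed_vector \<Rightarrow>\<^sub>L 'b::real_normed_vector \<Rightarrow>\<^sub>L 'c::real_normed_vector)
    \<Rightarrow> 'b \<Rightarrow>\<^sub>L 'a \<Rightarrow>\<^sub>L 'c" where
  "blinfun_flip T = Blinfun (\<lambda>b. Blinfun (\<lambda>a. T a b))"

lemma blinfun_flip_inner: "blinfun_apply (Blinfun (\<lambda>a. blinfun_apply (blinfun_apply T a) b)) a
    = blinfun_apply (blinfun_apply T a) b"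
proof -
  have "bounded_linear (\<lambda>a. blinfun_apply (blinfun_apply T a) b)"
    using bounded_linear_compose[OF blinfun.bounded_linear_left[of b] blinfun.bounded_linear_right[of T]]
        by simp
  then show ?thesis by (simp add: bounded_linear_Blinfun_apply)
qed

lemma blinfun_flip_apply [simp]: "blinfun_apply (blinfun_apply (blinfun_flip T) b) a
    = blinfun_apply (blinfun_apply T a) b"
proof -
  have "bounded_linear (\<lambda>b. Blinfun (\<lambda>a. blinfun_apply (blinfun_apply T a) b))"
  proof (rule bounded_linear_intro[of _ "norm T"])
    show "norm (Blinfun (\<lambda>a. blinfun_apply (blinfun_apply T a) b)) \<le> norm b * norm T" for b
      by (rule norm_blinfun_bound) (auto simp: blinfun_flip_inner intro: order_trans[OF
          norm_blinfun_apply2] simp: ac_simps)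
  qed (rule blinfun_eqI, simp only: blinfun_flip_inner plus_blinfun.rep_eq scaleR_blinfun.rep_eq, simp
      only: blinfun.add_right blinfun.scaleR_right)+
  then show ?thesis unfolding blinfun_flip_def by (simp add: bounded_linear_Blinfun_apply blinfun_flip_inner)
qed

lemma bounded_linear_blinfun_flip: "bounded_linear blinfun_flip"
proof (rule bounded_linear_intro[of _ 1])
  show "norm (blinfun_flip T) \<le> norm T * 1" for T :: "'a \<Rightarrow>\<^sub>L 'b \<Rightarrow>\<^sub>L 'c"
  proof (rule norm_blinfun_bound)
    show "norm (blinfun_apply (blinfun_flip T) b) \<le> norm T * 1 * norm b" for b
      by (rule norm_blinfun_bound) (auto intro: order_trans[OF norm_blinfun_apply2] simp: ac_simps)
  qed simp
qed (auto intro!: blinfun_eqI simp: blinfun.bilinear_simps)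

lemma smooth_on_add:
  assumes "smooth_on S f" "smooth_on S g"
  shows "smooth_on S (\<lambda>x. f x + g x)"
  using smooth_on_bounded_linear[OF _ smooth_on_Pair[OF assms], of "\<lambda>p. fst p + snd p"]
  by (simp add: bounded_linear_add bounded_linear_fst bounded_linear_snd)

text \<open>
  The system \<open>df = L\<close>, \<open>dL(v)u = \<beta>\<^sub>2(Lu, Lv) - L \<beta>\<^sub>1(u, v)\<close>, which says that \<open>L\<close> is the derivative of
  \<open>f\<close> and is parallel, as an autonomous total differential equation for \<open>(x, f, L)\<close>.
\<close>

definition affine_system ::
    "('e::real_normed_vector \<Rightarrow> 'e \<Rightarrow>\<^sub>L 'e \<Rightarrow>\<^sub>L 'e) \<Rightarrow> ('f::real_normed_vector \<Rightarrow> 'f \<Rightarrow>\<^sub>L 'f \<Rightarrow>\<^sub>L 'f) \<Rightarrow>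
     'e \<times> 'f \<times> ('e \<Rightarrow>\<^sub>L 'f) \<Rightarrow> 'e \<Rightarrow>\<^sub>L ('e \<times> 'f \<times> ('e \<Rightarrow>\<^sub>L 'f))" where
  "affine_system \<beta>1 \<beta>2 = (\<lambda>(x, p, L). Blinfun (\<lambda>v. (v, 0, 0)) + ((Blinfun (\<lambda>q. (0, q, 0)) o\<^sub>L L)
     + (Blinfun (\<lambda>T. (0, 0, T)) o\<^sub>L blinfun_flip (
         (bounded_bilinear.prod_left blinfun_compose L o\<^sub>L (\<beta>2 p o\<^sub>L L))
         - (bounded_bilinear.prod_right blinfun_compose L o\<^sub>L \<beta>1 x)))))"

lemma bounded_linear_injections:
  "bounded_linear (\<lambda>v :: 'a::real_normed_vector. (v, 0 :: 'b::real_normed_vector, 0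
      :: 'c::real_normed_vector))"
  "bounded_linear (\<lambda>v :: 'b::real_normed_vector. (0 :: 'a::real_normed_vector, v, 0
      :: 'c::real_normed_vector))"
  "bounded_linear (\<lambda>v :: 'c::real_normed_vector. (0 :: 'a::real_normed_vector, 0
      :: 'b::real_normed_vector, v))"
  by (intro bounded_linear_Pair bounded_linear_ident bounded_linear_zero)+

lemma affine_system_apply:
  "fst (affine_system \<beta>1 \<beta>2 (x, p, L) v) = v"
  "fst (snd (affine_system \<beta>1 \<beta>2 (x, p, L) v)) = L v"
  "snd (snd (affine_system \<beta>1 \<beta>2 (x, p, L) v)) u = \<beta>2 p (L u) (L v) - L (\<beta>1 x u v)"
  by (simp_all add: affine_system_def blinfun.bilinear_simps bounded_linear_Blinfun_apply
      bounded_linear_injections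
      bounded_bilinear.prod_left.rep_eq[OF bounded_bilinear_blinfun_compose]
      bounded_bilinear.prod_right.rep_eq[OF bounded_bilinear_blinfun_compose])

lemma smooth_on_affine_system:
  assumes "smooth_on V1 \<beta>1" "smooth_on V2 \<beta>2"
  shows "smooth_on (V1 \<times> V2 \<times> UNIV) (affine_system \<beta>1 \<beta>2)"
proof -
  note o = smooth_on_open[OF assms(1)] smooth_on_open[OF assms(2)]
  let ?U = "V1 \<times> V2 \<times> (UNIV :: ('a \<Rightarrow>\<^sub>L 'b) set)"
  have oU: "open ?U" by (intro open_Times o open_UNIV)
  note id = smooth_on_id[OF oU]
  have x: "smooth_on ?U (\<lambda>z. \<beta>1 (fst z))"
    by (rule smooth_on_compose[OF assms(1) smooth_on_fst[OF id]]) auto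
  have p: "smooth_on ?U (\<lambda>z. \<beta>2 (fst (snd z)))"
    by (rule smooth_on_compose[OF assms(2) smooth_on_fst[OF smooth_on_snd[OF id]]]) auto
  have L: "smooth_on ?U (\<lambda>z. snd (snd z))"
    by (rule smooth_on_snd[OF smooth_on_snd[OF id]])
  note comp = smooth_on_bilinear[OF bounded_bilinear_blinfun_compose]
  note left = smooth_on_bounded_linear[OF bounded_bilinear.bounded_linear_prod_left[OF
      bounded_bilinear_blinfun_compose] L]
  note right = smooth_on_bounded_linear[OF bounded_bilinear.bounded_linear_prod_right[OF
      bounded_bilinear_blinfun_compose] L]
  show ?thesis unfolding affine_system_def split_beta
    by (intro smooth_on_add comp smooth_on_const[OF oU] L smooth_on_bounded_linear[OF
        bounded_linear_blinfun_flip]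
        smooth_on_diff x p left right)
qed

text \<open>The result in charts. The conclusion retains \<open>L\<close> together with the equation
  for its derivative, because this equation is the affinity of \<open>f\<close> in the
  charts.\<close>

lemma local_affine_map:
  fixes \<beta>1 :: "'e::banach \<Rightarrow> 'e \<Rightarrow>\<^sub>L 'e \<Rightarrow>\<^sub>L 'e" and \<beta>2 :: "'f::banach \<Rightarrow> 'f \<Rightarrow>\<^sub>L 'f \<Rightarrow>\<^sub>L 'f"
    and A :: "'e \<Rightarrow>\<^sub>L 'f"
  assumes c1: "locally_parallel V1 \<beta>1 \<beta>1' \<beta>1''" and c2: "locally_parallel V2 \<beta>2 \<beta>2' \<beta>2''"
    and x0: "x0 \<in> V1" and p0: "p0 \<in> V2"
    and tor0: "\<And>a b. A (local_torsion (\<beta>1 x0) a b) = local_torsion (\<beta>2 p0) (A a) (A b)"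
    and curv0: "\<And>a b c. A (local_curvature (\<beta>1 x0) (\<beta>1' x0) a b c)
        = local_curvature (\<beta>2 p0) (\<beta>2' p0) (A a) (A b) (A c)"
  obtains r f and L :: "'e \<Rightarrow> 'e \<Rightarrow>\<^sub>L 'f" where "0 < r" "ball x0 r \<subseteq> V1" "f ` ball x0 r \<subseteq> V2" "f x0 = p0"
      "L x0 = A" "smooth_on (ball x0 r) f"
    "\<And>x. x \<in> ball x0 r \<Longrightarrow> (f has_derivative blinfun_apply (L x)) (at x)"
    "\<And>x. x \<in> ball x0 r \<Longrightarrow> \<exists>L'. (L has_derivative blinfun_apply L') (at x) \<and>
       (\<forall>u v. L' v u = \<beta>2 (f x) (L x u) (L x v) - L x (\<beta>1 x u v))"
proof -
  interpret c1: locally_parallel V1 \<beta>1 \<beta>1' \<beta>1'' by (rule c1)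
  interpret c2: locally_parallel V2 \<beta>2 \<beta>2' \<beta>2'' by (rule c2)
  define U where "U = V1 \<times> V2 \<times> (UNIV :: ('e \<Rightarrow>\<^sub>L 'f) set)"
  define H where "H = affine_system \<beta>1 \<beta>2"
  have sH: "smooth_on U H" unfolding U_def H_def
      by (rule smooth_on_affine_system[OF c1.smooth(1) c2.smooth(1)])
  obtain H' where H': "\<And>z. z \<in> U \<Longrightarrow> (H has_derivative blinfun_apply (H' z)) (at z)"
    by (rule smooth_on_blinfun_derivative[OF sH]) blast
  have H_apply: "fst (H z v) = v" "fst (snd (H z v)) = snd (snd z) v"
    "snd (snd (H z v)) u = \<beta>2 (fst (snd z)) (snd (snd z) u) (snd (snd z) v)
        - snd (snd z) (\<beta>1 (fst z) u v)" for z v u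
    using affine_system_apply[of \<beta>1 \<beta>2 "fst z" "fst (snd z)" "snd (snd z)"] unfolding H_def by simp_all
  \<comment> \<open>Some derivative \<open>H'\<close> exists by smoothness. Its components are
    identified by differentiating the explicit formula for \<open>H (z + t dz) w\<close> at
    \<open>t = 0\<close>, which avoids differentiating the operator expression defining the
    system.\<close>
  have H'_eq: "fst (H' z dz w) = 0" "fst (snd (H' z dz w)) = snd (snd dz) w"
    "snd (snd (H' z dz w)) u = \<beta>2' p dp (L u) (L w) + \<beta>2 p (dL u) (L w) + \<beta>2 p (L u) (dL w)
        - dL (\<beta>1 x u w) - L (\<beta>1' x dx u w)"
    if z: "z = (x, p, L)" "z \<in> U" and dz: "dz = (dx, dp, dL)" for z x p L dz dx dp dL w u
  proof -
    have xp: "x \<in> V1" "p \<in> V2" using z by (auto simp: U_def)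
    have line: "((\<lambda>t. z + t *\<^sub>R dz) has_vector_derivative dz) (at 0)"
      by (auto intro!: derivative_eq_intros simp: has_vector_derivative_def)
    have Hw: "((\<lambda>t. H (z + t *\<^sub>R dz) w) has_vector_derivative H' z dz w) (at 0)"
      using has_vector_derivative_blinfun_apply[OF has_vector_derivative_compose_blinfun[OF line, of H "H'
          z"] has_vector_derivative_const, of w] H'[OF z(2)]
      by simp
    have lx: "((\<lambda>t. x + t *\<^sub>R dx) has_vector_derivative dx) (at 0)"
      and lp: "((\<lambda>t. p + t *\<^sub>R dp) has_vector_derivative dp) (at 0)"
      and lL: "((\<lambda>t. L + t *\<^sub>R dL) has_vector_derivative dL) (at 0)"
      by (auto intro!: derivative_eq_intros simp: has_vector_derivative_def)
    have b1: "((\<lambda>t. \<beta>1 (x + t *\<^sub>R dx)) has_vector_derivative \<beta>1' x dx) (at 0)"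
      by (rule has_vector_derivative_compose_blinfun[OF lx]) (use c1.deriv(1) xp in simp)
    have b2: "((\<lambda>t. \<beta>2 (p + t *\<^sub>R dp)) has_vector_derivative \<beta>2' p dp) (at 0)"
      by (rule has_vector_derivative_compose_blinfun[OF lp]) (use c2.deriv(1) xp in simp)
    note fst_d = bounded_linear.has_vector_derivative[OF bounded_linear_fst]
    note snd_d = bounded_linear.has_vector_derivative[OF bounded_linear_snd]
    note app = has_vector_derivative_blinfun_apply
    note uniq = vector_derivative_unique_at
    have "((\<lambda>t. fst (H (z + t *\<^sub>R dz) w)) has_vector_derivative fst (H' z dz w)) (at 0)"
        by (rule fst_d[OF Hw])
    then show "fst (H' z dz w) = 0"
      unfolding H_apply by (rule uniq) simp
    have "((\<lambda>t. fst (snd (H (z + t *\<^sub>R dz) w))) has_vector_derivative fst (snd (H' z dz w))) (at 0)"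
      by (rule fst_d[OF snd_d[OF Hw]])
    then have 1: "((\<lambda>t. (L + t *\<^sub>R dL) w) has_vector_derivative fst (snd (H' z dz w))) (at 0)"
      unfolding H_apply z(1) dz by simp
    have 2: "((\<lambda>t. (L + t *\<^sub>R dL) w) has_vector_derivative dL w) (at 0)"
      using app[OF lL has_vector_derivative_const, of w] by simp
    show "fst (snd (H' z dz w)) = snd (snd dz) w" using uniq[OF 1 2] dz by simp
    have "((\<lambda>t. snd (snd (H (z + t *\<^sub>R dz) w)) u) has_vector_derivative snd (snd (H' z dz w)) u) (at 0)"
      using app[OF snd_d[OF snd_d[OF Hw]] has_vector_derivative_const, of u] by simp
    then have 3: "((\<lambda>t. \<beta>2 (p + t *\<^sub>R dp) ((L + t *\<^sub>R dL) u) ((L + t *\<^sub>R dL) w) - (L + t *\<^sub>R dL) (\<beta>1 (x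
        + t *\<^sub>R dx) u w))
        has_vector_derivative snd (snd (H' z dz w)) u) (at 0)"
      unfolding H_apply z(1) dz by simp
    have 4: "((\<lambda>t. \<beta>2 (p + t *\<^sub>R dp) ((L + t *\<^sub>R dL) u) ((L + t *\<^sub>R dL) w) - (L + t *\<^sub>R dL) (\<beta>1 (x
        + t *\<^sub>R dx) u w))
        has_vector_derivative \<beta>2' p dp (L u) (L w) + \<beta>2 p (dL u) (L w) + \<beta>2 p (L u) (dL w) - dL (\<beta>1 x u w)
            - L (\<beta>1' x dx u w)) (at 0)"
      by (rule has_vector_derivative_eq_rhs[OF has_vector_derivative_diff[OF
            app[OF app[OF b2 app[OF lL has_vector_derivative_const]] app[OF lL has_vector_derivative_const]]
            app[OF lL app[OF app[OF b1 has_vector_derivative_const] has_vector_derivative_const]]]])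
        (simp add: blinfun.bilinear_simps algebra_simps)
    show "snd (snd (H' z dz w)) u = \<beta>2' p dp (L u) (L w) + \<beta>2 p (dL u) (L w) + \<beta>2 p (L u) (dL w)
        - dL (\<beta>1 x u w) - L (\<beta>1' x dx u w)"
      by (rule uniq[OF 3 4])
  qed
  define z0 where "z0 = (x0, p0, A)"
  have z0: "z0 \<in> U" unfolding z0_def U_def using x0 p0 by simp
  text \<open>The defect of integrability is the defect of intertwining the curvatures, up to that
      for the torsions.\<close>
  have sym: "H' z (H z v) w = H' z (H z w) v"
    if z: "z = (x, p, L)" "z \<in> U"
      and tor: "\<And>a b. L (local_torsion (\<beta>1 x) a b) = local_torsion (\<beta>2 p) (L a) (L b)"
      and curv: "\<And>a b c. L (local_curvature (\<beta>1 x) (\<beta>1' x) a b c)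
          = local_curvature (\<beta>2 p) (\<beta>2' p) (L a) (L b) (L c)"
    for z x p L v w
  proof -
    define K where "K = (\<lambda>v. snd (snd (H z v)))"
    have K: "K v u = \<beta>2 p (L u) (L v) - L (\<beta>1 x u v)" for v u unfolding K_def H_apply using z by simp
    have Hz: "H z v = (v, L v, K v)" for v by (intro prod_eqI) (simp_all add: H_apply K_def z(1))
    note e = H'_eq[OF z Hz]
    have t: "\<beta>2 p (L a) (L b) - \<beta>2 p (L b) (L a) = L (\<beta>1 x a b) - L (\<beta>1 x b a)" for a b
      using tor[of a b] by (simp add: local_torsion_def blinfun.bilinear_simps)
    have Ksym: "K v w = K w v" using t[of w v] by (simp add: K algebra_simps)
    have "snd (snd (H' z (H z v) w)) u = snd (snd (H' z (H z w) v)) u" for u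
    proof -
      have "snd (snd (H' z (H z v) w)) u - snd (snd (H' z (H z w) v)) u
        = L (local_curvature (\<beta>1 x) (\<beta>1' x) v w u) - local_curvature (\<beta>2 p) (\<beta>2' p) (L v) (L w) (L u)
          + \<beta>2 p (L u) (K v w - K w v)"
        unfolding e(3) unfolding K local_curvature_def by (simp add: blinfun.bilinear_simps)
      then show ?thesis using curv Ksym by (simp add: blinfun.bilinear_simps)
    qed
    then have "snd (snd (H' z (H z v) w)) = snd (snd (H' z (H z w) v))" by (rule blinfun_eqI)
    then show ?thesis using Ksym by (simp add: prod_eq_iff e(1,2)) (simp add: Hz)
  qed
  obtain R1 K1 where b1: "0 < R1" "0 < K1" "cball x0 R1 \<subseteq> V1" "\<And>x. x \<in> cball x0 R1 \<Longrightarrow> norm (\<beta>1 x) \<le> K1"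
    by (rule smooth_on_locally_bounded_at[OF c1.smooth(1) x0]) blast
  obtain R2 K2 where b2: "0 < R2" "0 < K2" "cball p0 R2 \<subseteq> V2" "\<And>x. x \<in> cball p0 R2 \<Longrightarrow> norm (\<beta>2 x) \<le> K2"
    by (rule smooth_on_locally_bounded_at[OF c2.smooth(1) p0]) blast
  obtain R3 K3 where b3: "0 < R3" "0 < K3" "cball x0 R3 \<subseteq> V1" "\<And>x. x \<in> cball x0 R3 \<Longrightarrow> norm (\<beta>1' x) \<le> K3"
    by (rule smooth_on_locally_bounded_at[OF c1.smooth(2) x0]) blast
  obtain R4 K4 where b4: "0 < R4" "0 < K4" "cball p0 R4 \<subseteq> V2" "\<And>x. x \<in> cball p0 R4 \<Longrightarrow> norm (\<beta>2' x) \<le> K4"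
    by (rule smooth_on_locally_bounded_at[OF c2.smooth(2) p0]) blast
  \<comment> \<open>A common bound for both connections, their derivatives and the
    \<open>L\<close>-component, which stays within distance 1 of \<open>A\<close>; hence the summand
    \<open>norm A + 1\<close>.\<close>
  define K where "K = K1 + K2 + K3 + K4 + (norm A + 1)"
  have K: "K > 0" unfolding K_def using b1(2) b2(2) b3(2) b4(2) norm_ge_zero[of A] by linarith
  \<comment> \<open>The coefficient of the linear equation for the curvature defect:
    \<open>K * K\<close> from \<open>\<beta>2\<close> together with the \<open>L\<close>-component,
    and one \<open>K\<close> for each of the three slots. The torsion defect has two slots and is
    covered as well.\<close>
  define C where "C = K * K + 3 * K"
  have C: "C > 0" "2 * K + K * K \<le> C" unfolding C_def using K by (auto intro: add_pos_pos)
  \<comment> \<open>Confines the solution to all balls on which bounds are known and, as the radius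
    is at most \<open>\<epsilon>\<close>, gives \<open>r * C \<le> 1/2\<close>.\<close>
  define \<epsilon> where "\<epsilon> = Min {1, R1, R2, R3, R4, 1 / (2 * C)}"
  have \<epsilon>: "\<epsilon> > 0" "\<epsilon> \<le> 1" "\<epsilon> \<le> R1" "\<epsilon> \<le> R2" "\<epsilon> \<le> R3" "\<epsilon> \<le> R4" "\<epsilon> \<le> 1 / (2 * C)"
    unfolding \<epsilon>_def using b1 b2 b3 b4 C by auto
  obtain r y where r: "0 < r" "r \<le> \<epsilon>" and y0: "y 0 = z0" and yU: "\<And>v. norm v \<le> r \<Longrightarrow> y v \<in> U"
    and yd: "\<And>v. norm v \<le> r \<Longrightarrow> dist z0 (y v) \<le> \<epsilon>"
    and ode: "\<And>v t. norm v \<le> r \<Longrightarrow> t \<in> {0..1} \<Longrightarrow>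
       ((\<lambda>t. y (t *\<^sub>R v)) has_vector_derivative blinfun_apply (H (y (t *\<^sub>R v))) v) (at t within {0..1})"
    and tot: "\<And>v. (\<And>v u w. norm v \<le> r \<Longrightarrow> blinfun_apply (blinfun_apply (H' (y v)) (blinfun_apply (H (y v)) u)) w
       = blinfun_apply (blinfun_apply (H' (y v)) (blinfun_apply (H (y v)) w)) u) \<Longrightarrow>
     norm v < r \<Longrightarrow> (y has_derivative blinfun_apply (H (y v))) (at v)"
    by (rule frobenius[OF sH z0 \<epsilon>(1) H']) blast+
  have rC: "r * C \<le> 1/2"
  proof -
    have "r * C \<le> 1 / (2 * C) * C" using r \<epsilon>(7) C(1) by (intro mult_right_mono) auto
    then show ?thesis using C(1) by simp
  qed
  define X where "X = (\<lambda>v. fst (y v))"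
  define P where "P = (\<lambda>v. fst (snd (y v)))"
  define \<Lambda> where "\<Lambda> = (\<lambda>v. snd (snd (y v)))"
  have y_eq: "y v = (X v, P v, \<Lambda> v)" for v unfolding X_def P_def \<Lambda>_def by simp
  have bounds: "X v \<in> V1" "P v \<in> V2" "norm (\<beta>1 (X v)) \<le> K" "norm (\<beta>2 (P v)) \<le> K" "norm (\<beta>1' (X v)) \<le> K"
      "norm (\<beta>2' (P v)) \<le> K"
    "norm (\<Lambda> v) \<le> K" if v: "norm v \<le> r" for v
  proof -
    show "X v \<in> V1" "P v \<in> V2" using yU[OF v] unfolding y_eq U_def by auto
    have d: "dist z0 (y v) \<le> \<epsilon>" by (rule yd[OF v])
    have dX: "dist x0 (X v) \<le> \<epsilon>" and dP: "dist p0 (P v) \<le> \<epsilon>" and dL: "dist A (\<Lambda> v) \<le> \<epsilon>"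
      using order_trans[OF dist_fst_le d] order_trans[OF dist_fst_le order_trans[OF dist_snd_le d]]
        order_trans[OF dist_snd_le order_trans[OF dist_snd_le d]]
      unfolding X_def P_def \<Lambda>_def z0_def by simp_all
    show "norm (\<beta>1 (X v)) \<le> K" "norm (\<beta>2 (P v)) \<le> K" "norm (\<beta>1' (X v)) \<le> K" "norm (\<beta>2' (P v)) \<le> K"
      using b1(4)[of "X v"] b2(4)[of "P v"] b3(4)[of "X v"] b4(4)[of "P v"] dX dP \<epsilon> b1(2) b2(2) b3(2)
          b4(2) norm_ge_zero[of A]
      unfolding K_def mem_cball by linarith+
    have "norm (\<Lambda> v) \<le> norm A + dist A (\<Lambda> v)"
      using norm_triangle_sub[of "\<Lambda> v" A] by (simp add: dist_norm norm_minus_commute)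
    then show "norm (\<Lambda> v) \<le> K" using dL \<epsilon>(2) b1(2) b2(2) b3(2) b4(2) unfolding K_def by linarith
  qed
  have seg: "norm (t *\<^sub>R v) \<le> r" if "norm v \<le> r" "t \<in> {0..1}" for v :: 'e and t :: real
    using that mult_left_le_one_le[of "norm v" t] by simp
  have curves: "((\<lambda>t. X (t *\<^sub>R v)) has_vector_derivative v) (at t within {0..1})"
    "((\<lambda>t. P (t *\<^sub>R v)) has_vector_derivative \<Lambda> (t *\<^sub>R v) v) (at t within {0..1})"
    "((\<lambda>t. \<Lambda> (t *\<^sub>R v) u) has_vector_derivative
       \<beta>2 (P (t *\<^sub>R v)) (\<Lambda> (t *\<^sub>R v) u) (\<Lambda> (t *\<^sub>R v) v) - \<Lambda> (t *\<^sub>R v) (\<beta>1 (X (t *\<^sub>R v)) u v)) (at t within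
           {0..1})"
    "((\<lambda>t. \<Lambda> (t *\<^sub>R v)) has_vector_derivative snd (snd (H (y (t *\<^sub>R v)) v))) (at t within {0..1})"
    if v: "norm v \<le> r" and t: "t \<in> {0..1}" for v t u
  proof -
    note o = ode[OF v t]
    show "((\<lambda>t. X (t *\<^sub>R v)) has_vector_derivative v) (at t within {0..1})"
      using bounded_linear.has_vector_derivative[OF bounded_linear_fst o] unfolding X_def H_apply .
    show "((\<lambda>t. P (t *\<^sub>R v)) has_vector_derivative \<Lambda> (t *\<^sub>R v) v) (at t within {0..1})"
      using bounded_linear.has_vector_derivative[OF bounded_linear_fst
          bounded_linear.has_vector_derivative[OF bounded_linear_snd o]]
      unfolding P_def \<Lambda>_def H_apply .
    show L: "((\<lambda>t. \<Lambda> (t *\<^sub>R v)) has_vector_derivative snd (snd (H (y (t *\<^sub>R v)) v))) (at t within {0..1})"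
      using bounded_linear.has_vector_derivative[OF bounded_linear_snd
          bounded_linear.has_vector_derivative[OF bounded_linear_snd o]]
      unfolding \<Lambda>_def .
    show "((\<lambda>t. \<Lambda> (t *\<^sub>R v) u) has_vector_derivative
       \<beta>2 (P (t *\<^sub>R v)) (\<Lambda> (t *\<^sub>R v) u) (\<Lambda> (t *\<^sub>R v) v) - \<Lambda> (t *\<^sub>R v) (\<beta>1 (X (t *\<^sub>R v)) u v)) (at t within
           {0..1})"
      using has_vector_derivative_blinfun_apply[OF L has_vector_derivative_const, of u]
      unfolding H_apply P_def \<Lambda>_def X_def by simp
  qed
  have b1d: "((\<lambda>t. \<beta>1 (X (t *\<^sub>R v))) has_vector_derivative \<beta>1' (X (t *\<^sub>R v)) v) (at t within {0..1})"
    "((\<lambda>t. \<beta>1' (X (t *\<^sub>R v))) has_vector_derivative \<beta>1'' (X (t *\<^sub>R v)) v) (at t within {0..1})"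
    "((\<lambda>t. \<beta>2 (P (t *\<^sub>R v))) has_vector_derivative \<beta>2' (P (t *\<^sub>R v)) (\<Lambda> (t *\<^sub>R v) v)) (at t within {0..1})"
    "((\<lambda>t. \<beta>2' (P (t *\<^sub>R v))) has_vector_derivative \<beta>2'' (P (t *\<^sub>R v)) (\<Lambda> (t *\<^sub>R v) v)) (at t within {0..1})"
    if v: "norm v \<le> r" and t: "t \<in> {0..1}" for v t
    by (rule has_vector_derivative_compose_blinfun[OF curves(1)[OF v t] c1.deriv(1)[OF bounds(1)[OF seg[OF
        v t]]]]
        has_vector_derivative_compose_blinfun[OF curves(1)[OF v t] c1.deriv(2)[OF bounds(1)[OF seg[OF v t]]]]
        has_vector_derivative_compose_blinfun[OF curves(2)[OF v t] c2.deriv(1)[OF bounds(2)[OF seg[OF v t]]]]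
        has_vector_derivative_compose_blinfun[OF curves(2)[OF v t] c2.deriv(2)[OF bounds(2)[OF seg[OF v
            t]]]])+
  have tor: "\<Lambda> v (local_torsion (\<beta>1 (X v)) a b) = local_torsion (\<beta>2 (P v)) (\<Lambda> v a) (\<Lambda> v b)"
      if v: "norm v \<le> r" for v a b
  proof -
    define \<phi> where "\<phi> = (\<lambda>(a, b) t. \<Lambda> (t *\<^sub>R v) (local_torsion (\<beta>1 (X (t *\<^sub>R v))) a b)
       - local_torsion (\<beta>2 (P (t *\<^sub>R v))) (\<Lambda> (t *\<^sub>R v) a) (\<Lambda> (t *\<^sub>R v) b))"
    \<comment> \<open>The right-hand side of the equation for the torsion defect. Substituting the
      equations for \<open>\<Lambda>\<close> and for the parallel torsions, all terms regroup into
      the defect itself, composed with the connections: a homogeneous linear system.\<close>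
    define \<phi>' where "\<phi>' = (\<lambda>(a, b) t. \<beta>2 (P (t *\<^sub>R v)) (\<phi> (a, b) t) (\<Lambda> (t *\<^sub>R v) v)
       - \<phi> (\<beta>1 (X (t *\<^sub>R v)) a v, b) t - \<phi> (a, \<beta>1 (X (t *\<^sub>R v)) b v) t)"
    \<comment> \<open>The equation couples the defect at different argument vectors, so it is
      treated for all pairs at once. The weight \<open>norm a * norm b\<close> takes the place of an
      operator norm, and \<open>M\<close> is the crude bound obtained from \<open>K\<close>.\<close>
    have "\<phi> (a, b) 1 = 0"
    proof (rule vector_derivative_family_zero[where \<phi>' = \<phi>' and n = "\<lambda>(a, b). norm a * norm b"
        and M = "K * (2 * K) + 2 * K * (K * K)"])
      fix i :: "'e \<times> 'e" and t :: real assume t: "t \<in> {0..1}"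
      obtain a b where i: "i = (a, b)" by (cases i) auto
      note tv = seg[OF v t]
      let ?x = "X (t *\<^sub>R v)" and ?p = "P (t *\<^sub>R v)" and ?L = "\<Lambda> (t *\<^sub>R v)"
      note D = has_vector_derivative_diff[OF
          has_vector_derivative_blinfun_apply[OF curves(4)[OF v t]
            has_vector_derivative_local_torsion[OF b1d(1)[OF v t] has_vector_derivative_const[of a]
                has_vector_derivative_const[of b]]]
          has_vector_derivative_local_torsion[OF b1d(3)[OF v t] curves(3)[OF v t, of a] curves(3)[OF v t,
              of b]]]
      show "(\<phi> i has_vector_derivative \<phi>' i t) (at t within {0..1})"
        unfolding i \<phi>_def \<phi>'_def prod.case
        by (rule has_vector_derivative_eq_rhs[OF D])
          (simp add: H_apply y_eq c1.torsion_parallel[OF bounds(1)[OF tv]] c2.torsion_parallel[OF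
              bounds(2)[OF tv]]
            local_torsion_diff local_torsion_diff(1)[of _ 0 0, simplified] local_torsion_diff(2)[of _ _ 0
                0, simplified] blinfun.bilinear_simps)
      show "norm (\<phi> i t) \<le> (K * (2 * K) + 2 * K * (K * K)) * (case i of (a, b) \<Rightarrow> norm a * norm b)"
      proof -
        have 1: "norm (?L (local_torsion (\<beta>1 ?x) a b)) \<le> K * (2 * K * (norm a * norm b))"
          by (intro norm_blinfun_le norm_local_torsion bounds tv)
        have "norm (local_torsion (\<beta>2 ?p) (?L a) (?L b)) \<le> 2 * K * (norm (?L a) * norm (?L b))"
          by (intro norm_local_torsion bounds tv)
        also have "\<dots> \<le> 2 * K * ((K * norm a) * (K * norm b))"
          using K by (intro mult_left_mono mult_mono norm_blinfun_le bounds tv order_refl) auto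
        finally have 2: "norm (local_torsion (\<beta>2 ?p) (?L a) (?L b)) \<le> 2 * K * ((K * norm a) * (K * norm b))" .
        show ?thesis unfolding i \<phi>_def prod.case
          using order_trans[OF norm_triangle_ineq4 add_mono[OF 1 2]] by (simp add: algebra_simps)
      qed
    next
      fix m :: real and i :: "'e \<times> 'e" and t :: real assume m: "\<And>i t. t \<in> {0..1} \<Longrightarrow>
          norm (\<phi> i t) \<le> m * (case i of (a, b) \<Rightarrow> norm a * norm b)" "m \<ge> 0" and t: "t \<in> {0..1}"
      obtain a b where i: "i = (a, b)" by (cases i) auto
      note tv = seg[OF v t]
      let ?x = "X (t *\<^sub>R v)" and ?p = "P (t *\<^sub>R v)" and ?L = "\<Lambda> (t *\<^sub>R v)"
      have n: "norm (\<beta>1 ?x a v) \<le> K * norm a * r" for a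
        by (intro norm_blinfun_le bounds tv order_refl v)
      have 1: "norm (\<beta>2 ?p (\<phi> (a, b) t) (?L v)) \<le> K * (m * (norm a * norm b)) * (K * r)"
        using m(1)[OF t, of "(a, b)"] by (intro norm_blinfun_le bounds tv v) auto
      have 2: "norm (\<phi> (\<beta>1 ?x a v, b) t) \<le> m * ((K * norm a * r) * norm b)"
        using m(1)[OF t, of "(\<beta>1 ?x a v, b)"] mult_left_mono[OF mult_right_mono[OF n norm_ge_zero] m(2)]
            by (fastforce intro: order_trans)
      have 3: "norm (\<phi> (a, \<beta>1 ?x b v) t) \<le> m * (norm a * (K * norm b * r))"
        using m(1)[OF t, of "(a, \<beta>1 ?x b v)"] mult_left_mono[OF mult_left_mono[OF n norm_ge_zero] m(2)]
            by (fastforce intro: order_trans)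
      have "norm (\<phi>' i t) \<le> K * (m * (norm a * norm b)) * (K * r) + m * ((K * norm a * r) * norm b) + m
          * (norm a * (K * norm b * r))"
        unfolding i \<phi>'_def prod.case
        by (intro order_trans[OF norm_triangle_ineq4] add_mono 1 2 3)
      also have "\<dots> = (r * (2 * K + K * K)) * (m * (norm a * norm b))" by (simp add: algebra_simps)
      also have "\<dots> \<le> 1/2 * (m * (norm a * norm b))"
        using rC mult_left_mono[OF C(2) less_imp_le[OF r(1)]] m(2) by (intro mult_right_mono) auto
      finally show "norm (\<phi>' i t) \<le> m / 2 * (case i of (a, b) \<Rightarrow> norm a * norm b)" unfolding i by simp
    qed (auto simp: \<phi>_def y0 X_def P_def \<Lambda>_def z0_def tor0)
    then show ?thesis unfolding \<phi>_def by simp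
  qed
  have curv: "\<Lambda> v (local_curvature (\<beta>1 (X v)) (\<beta>1' (X v)) a b c)
      = local_curvature (\<beta>2 (P v)) (\<beta>2' (P v)) (\<Lambda> v a) (\<Lambda> v b) (\<Lambda> v c)"
    if v: "norm v \<le> r" for v a b c
  proof -
    define \<phi> where "\<phi> = (\<lambda>(a, b, c) t. \<Lambda> (t *\<^sub>R v) (local_curvature (\<beta>1 (X (t *\<^sub>R v))) (\<beta>1' (X (t *\<^sub>R v)))
        a b c)
       - local_curvature (\<beta>2 (P (t *\<^sub>R v))) (\<beta>2' (P (t *\<^sub>R v))) (\<Lambda> (t *\<^sub>R v) a) (\<Lambda> (t *\<^sub>R v) b) (\<Lambda> (t *\<^sub>R
           v) c))"
    \<comment> \<open>The same linear system with three slots; the second derivatives of the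
      connections disappear through the parallel curvatures.\<close>
    define \<phi>' where "\<phi>' = (\<lambda>(a, b, c) t. \<beta>2 (P (t *\<^sub>R v)) (\<phi> (a, b, c) t) (\<Lambda> (t *\<^sub>R v) v)
       - \<phi> (\<beta>1 (X (t *\<^sub>R v)) a v, b, c) t - \<phi> (a, \<beta>1 (X (t *\<^sub>R v)) b v, c) t - \<phi> (a, b, \<beta>1 (X (t *\<^sub>R v)) c
           v) t)"
    let ?C = "2 * K + 2 * (K * K)"
    have "\<phi> (a, b, c) 1 = 0"
    proof (rule vector_derivative_family_zero[where \<phi>' = \<phi>' and n = "\<lambda>(a, b, c). norm a * norm b * norm c"
        and M = "K * ?C + ?C * (K * K * K)"])
      fix i :: "'e \<times> 'e \<times> 'e" and t :: real assume t: "t \<in> {0..1}"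
      obtain a b c where i: "i = (a, b, c)" by (cases i) auto
      note tv = seg[OF v t]
      let ?x = "X (t *\<^sub>R v)" and ?p = "P (t *\<^sub>R v)" and ?L = "\<Lambda> (t *\<^sub>R v)"
      note D = has_vector_derivative_diff[OF
          has_vector_derivative_blinfun_apply[OF curves(4)[OF v t]
            has_vector_derivative_local_curvature[OF b1d(1,2)[OF v t] has_vector_derivative_const[of a]
                has_vector_derivative_const[of b] has_vector_derivative_const[of c]]]
          has_vector_derivative_local_curvature[OF b1d(3,4)[OF v t] curves(3)[OF v t, of a] curves(3)[OF v
              t, of b] curves(3)[OF v t, of c]]]
      show "(\<phi> i has_vector_derivative \<phi>' i t) (at t within {0..1})"
        unfolding i \<phi>_def \<phi>'_def prod.case
        by (rule has_vector_derivative_eq_rhs[OF D])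
          (simp add: H_apply y_eq c1.curvature_parallel[OF bounds(1)[OF tv]] c2.curvature_parallel[OF
              bounds(2)[OF tv]]
            local_curvature_diff local_curvature_diff(1)[of _ _ 0 0, simplified]
                local_curvature_diff(2)[of _ _ _ 0 0, simplified]
            local_curvature_diff(3)[of _ _ _ _ 0 0, simplified] blinfun.bilinear_simps)
      show "norm (\<phi> i t) \<le> (K * ?C + ?C * (K * K * K)) * (case i of (a, b, c) \<Rightarrow> norm a * norm b * norm c)"
      proof -
        have 1: "norm (?L (local_curvature (\<beta>1 ?x) (\<beta>1' ?x) a b c)) \<le> K * (?C * (norm a * norm b * norm c))"
          by (intro norm_blinfun_le norm_local_curvature bounds tv)
        have "norm (local_curvature (\<beta>2 ?p) (\<beta>2' ?p) (?L a) (?L b) (?L c))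
            \<le> ?C * (norm (?L a) * norm (?L b) * norm (?L c))"
          by (intro norm_local_curvature bounds tv)
        also have "\<dots> \<le> ?C * ((K * norm a) * (K * norm b) * (K * norm c))"
          using K by (intro mult_left_mono mult_mono norm_blinfun_le bounds tv order_refl) auto
        finally have 2: "norm (local_curvature (\<beta>2 ?p) (\<beta>2' ?p) (?L a) (?L b) (?L c))
            \<le> ?C * ((K * norm a) * (K * norm b) * (K * norm c))" .
        show ?thesis unfolding i \<phi>_def prod.case
          using order_trans[OF norm_triangle_ineq4 add_mono[OF 1 2]] by (simp add: algebra_simps)
      qed
    next
      fix m :: real and i :: "'e \<times> 'e \<times> 'e" and t :: real
      assume m: "\<And>i t. t \<in> {0..1} \<Longrightarrow> norm (\<phi> i t) \<le> m * (case i of (a, b, c) \<Rightarrow> norm a * norm b * norm c)"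
          "m \<ge> 0" and t: "t \<in> {0..1}"
      obtain a b c where i: "i = (a, b, c)" by (cases i) auto
      note tv = seg[OF v t]
      let ?x = "X (t *\<^sub>R v)" and ?p = "P (t *\<^sub>R v)" and ?L = "\<Lambda> (t *\<^sub>R v)"
      have n: "norm (\<beta>1 ?x a v) \<le> K * norm a * r" for a
        by (intro norm_blinfun_le bounds tv order_refl v)
      \<comment> \<open>The family bound restated with upper bounds for the arguments, so that any
        one slot may be occupied by a value of \<open>\<beta>1\<close>.\<close>
      have m': "norm (\<phi> (a, b, c) t) \<le> m * (A * B * C)" if "norm a \<le> A" "norm b \<le> B" "norm c \<le> C"
          for a b c A B C
      proof -
        have "norm a * norm b * norm c \<le> A * B * C"
          using that order_trans[OF norm_ge_zero that(1)] order_trans[OF norm_ge_zero that(2)]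
          by (intro mult_mono) (auto intro: mult_nonneg_nonneg)
        from mult_left_mono[OF this m(2)] show ?thesis using m(1)[OF t, of "(a, b, c)"] by simp
      qed
      have 1: "norm (\<beta>2 ?p (\<phi> (a, b, c) t) (?L v)) \<le> K * (m * (norm a * norm b * norm c)) * (K * r)"
        by (intro norm_blinfun_le bounds tv v m' order_refl)
      have 2: "norm (\<phi> (\<beta>1 ?x a v, b, c) t) \<le> m * ((K * norm a * r) * norm b * norm c)"
          by (intro m' n order_refl)
      have 3: "norm (\<phi> (a, \<beta>1 ?x b v, c) t) \<le> m * (norm a * (K * norm b * r) * norm c)"
          by (intro m' n order_refl)
      have 4: "norm (\<phi> (a, b, \<beta>1 ?x c v) t) \<le> m * (norm a * norm b * (K * norm c * r))"
          by (intro m' n order_refl)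
      have "norm (\<phi>' i t) \<le> K * (m * (norm a * norm b * norm c)) * (K * r) + m * ((K * norm a * r)
          * norm b * norm c)
          + m * (norm a * (K * norm b * r) * norm c) + m * (norm a * norm b * (K * norm c * r))"
        unfolding i \<phi>'_def prod.case
        by (intro order_trans[OF norm_triangle_ineq4] add_mono 1 2 3 4)
      also have "\<dots> = (r * C) * (m * (norm a * norm b * norm c))" unfolding C_def by (simp add: algebra_simps)
      also have "\<dots> \<le> 1/2 * (m * (norm a * norm b * norm c))"
        using rC m(2) by (intro mult_right_mono) auto
      finally show "norm (\<phi>' i t) \<le> m / 2 * (case i of (a, b, c) \<Rightarrow> norm a * norm b * norm c)" unfolding i
          by simp
    qed (auto simp: \<phi>_def y0 X_def P_def \<Lambda>_def z0_def curv0)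
    then show ?thesis unfolding \<phi>_def by simp
  qed
  have yH: "(y has_derivative blinfun_apply (H (y v))) (at v)" if "norm v < r" for v
    by (rule tot[OF _ that], rule sym[OF y_eq]) (use yU tor curv in auto)
  \<comment> \<open>The position component of the autonomous system has derivative \<open>v\<close>
    along the ray, so it is the true position; the sup bound with constant 0 shows this.\<close>
  have X: "X v = x0 + v" if v: "norm v \<le> r" for v
  proof -
    have "norm (X (1 *\<^sub>R v) - x0 - 1 *\<^sub>R v) \<le> 2 * 0"
    proof (rule vector_derivative_sup_bound[where e = "\<lambda>t. X (t *\<^sub>R v) - x0 - t *\<^sub>R v" and e' = "\<lambda>t. 0"])
      fix t :: real assume t: "t \<in> {0..1}"
      have "((\<lambda>t. t *\<^sub>R v) has_vector_derivative v) (at t within {0..1})"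
        by (auto intro!: derivative_eq_intros simp: has_vector_derivative_def)
      from has_vector_derivative_diff[OF has_vector_derivative_diff[OF curves(1)[OF v t]
          has_vector_derivative_const[of x0]] this]
      show "((\<lambda>t. X (t *\<^sub>R v) - x0 - t *\<^sub>R v) has_vector_derivative 0) (at t within {0..1})" by simp
    qed (auto simp: X_def y0 z0_def)
    then show ?thesis by (simp add: algebra_simps)
  qed
  \<comment> \<open>On the open ball the total equation holds at every point, so the bootstrapping
    lemma applies to the whole triple.\<close>
  have sy: "smooth_on (ball 0 r) y"
    by (rule smooth_on_ode[OF sH]) (use yU yH in auto)
  have s: "smooth_on (ball x0 r) (\<lambda>x. y (x - x0))"
    by (rule smooth_on_compose[OF sy]) (auto intro!: smooth_on_diff smooth_on_id smooth_on_const simp: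
        dist_norm norm_minus_commute)
  have sd: "((\<lambda>x. y (x - x0)) has_derivative blinfun_apply (H (y (x - x0)))) (at x)" if "x \<in> ball x0 r" for x
  proof -
    have "((\<lambda>x. x - x0) has_derivative (\<lambda>h. h)) (at x)" by (auto intro!: derivative_eq_intros)
    from has_derivative_compose[OF this, OF yH] that show ?thesis by (simp add: dist_norm norm_minus_commute)
  qed
  show ?thesis
  proof (rule that[of r "\<lambda>x. P (x - x0)" "\<lambda>x. \<Lambda> (x - x0)"])
    show "ball x0 r \<subseteq> V1"
    proof
      fix x assume "x \<in> ball x0 r"
      then have n: "norm (x - x0) \<le> r" by (simp add: dist_norm norm_minus_commute)
      show "x \<in> V1" using bounds(1)[OF n] X[OF n] by simp
    qed
    show "(\<lambda>x. P (x - x0)) ` ball x0 r \<subseteq> V2" using bounds(2) by (auto simp: dist_norm norm_minus_commute)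
    show "P (x0 - x0) = p0" "\<Lambda> (x0 - x0) = A" by (simp_all add: P_def \<Lambda>_def y0 z0_def)
    show "smooth_on (ball x0 r) (\<lambda>x. P (x - x0))" unfolding P_def
        by (rule smooth_on_fst[OF smooth_on_snd[OF s]])
    fix x assume x: "x \<in> ball x0 r"
    then have n: "norm (x - x0) \<le> r" by (simp add: dist_norm norm_minus_commute)
    have "((\<lambda>x. P (x - x0)) has_derivative (\<lambda>h. fst (snd (H (y (x - x0)) h)))) (at x)"
      unfolding P_def by (rule has_derivative_fst[OF has_derivative_snd[OF sd[OF x]]])
    then show "((\<lambda>x. P (x - x0)) has_derivative blinfun_apply (\<Lambda> (x - x0))) (at x)"
      unfolding H_apply \<Lambda>_def by simp
    have "((\<lambda>x. \<Lambda> (x - x0)) has_derivative (\<lambda>h. snd (snd (H (y (x - x0)) h)))) (at x)"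
      unfolding \<Lambda>_def by (rule has_derivative_snd[OF has_derivative_snd[OF sd[OF x]]])
    moreover have "blinfun_apply (Blinfun (\<lambda>h. snd (snd (H (y (x - x0)) h))))
        = (\<lambda>h. snd (snd (H (y (x - x0)) h)))"
      by (intro bounded_linear_Blinfun_apply bounded_linear_snd_comp blinfun.bounded_linear_right)
    ultimately show "\<exists>L'. ((\<lambda>x. \<Lambda> (x - x0)) has_derivative blinfun_apply L') (at x) \<and>
       (\<forall>u v. L' v u = \<beta>2 (P (x - x0)) (\<Lambda> (x - x0) u) (\<Lambda> (x - x0) v) - \<Lambda> (x - x0) (\<beta>1 x u v))"
      using X[OF n] by (intro exI[of _ "Blinfun (\<lambda>h. snd (snd (H (y (x - x0)) h)))"]) (simp add: H_apply y_eq)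
  qed (use r in auto)
qed

section \<open>Tangent maps in charts\<close>

lemma smooth_on_tangent:
  assumes "smooth_on S t"
  shows "smooth_on (S \<times> UNIV) (\<lambda>(y, a). (t y, frechet_derivative t (at y) a))"
proof -
  obtain t' where t': "smooth_on S t'" "\<And>x. x \<in> S \<Longrightarrow> (t has_derivative blinfun_apply (t' x)) (at x)"
    by (rule smooth_on_blinfun_derivative[OF assms]) blast
  have o: "open (S \<times> (UNIV :: 'a set))" by (intro open_Times smooth_on_open[OF assms] open_UNIV)
  note id = smooth_on_id[OF o]
  have 1: "smooth_on (S \<times> (UNIV :: 'a set)) (\<lambda>p. t (fst p))"
    by (rule smooth_on_compose[OF assms smooth_on_fst[OF id]]) auto
  have 2: "smooth_on (S \<times> (UNIV :: 'a set)) (\<lambda>p. t' (fst p))"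
    by (rule smooth_on_compose[OF t'(1) smooth_on_fst[OF id]]) auto
  show ?thesis
    by (rule smooth_on_cong[OF smooth_on_Pair[OF 1 smooth_on_bilinear[OF bounded_bilinear_blinfun_apply 2
        smooth_on_snd[OF id]]]])
      (auto simp: frechet_derivative_at[OF t'(2), symmetric])
qed

lemma frechet_derivative_eqI: "(f has_derivative f') (at x) \<Longrightarrow> frechet_derivative f (at x) = f'"
  by (rule frechet_derivative_at[symmetric])

text \<open>The second tangent map in coordinates: the second derivative \<open>t''\<close> enters
  the last component only. Since \<open>t'\<close> may be any operator-valued derivative that is
  differentiable at the one point \<open>y\<close>, this serves chart changes as well as the local
  solution with its \<open>L\<close>.\<close>

lemma tangent_has_derivative:
  fixes t' :: "'a::real_normed_vector \<Rightarrow> 'a \<Rightarrow>\<^sub>L 'b::real_normed_vector"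
  assumes "open S" "y \<in> S" and t: "\<And>x. x \<in> S \<Longrightarrow> (t has_derivative blinfun_apply (t' x)) (at x)"
    and t': "(t' has_derivative blinfun_apply t'') (at y)"
  shows "((\<lambda>(y, a). (t y, frechet_derivative t (at y) a)) has_derivative
    (\<lambda>(w, z). (t' y w, t'' w a + t' y z))) (at (y, a))"
proof -
  have f: "((\<lambda>p. fst p) has_derivative (\<lambda>h. fst h)) (at (y, a))"
      and s: "((\<lambda>p. snd p) has_derivative (\<lambda>h. snd h)) (at (y, a))"
    by (auto intro!: derivative_eq_intros)
  have 1: "((\<lambda>p. t (fst p)) has_derivative (\<lambda>h. t' y (fst h))) (at (y, a))"
    using has_derivative_compose[OF f, of t "blinfun_apply (t' y)"] t[OF assms(2)] by simp
  have 2: "((\<lambda>p. t' (fst p)) has_derivative (\<lambda>h. t'' (fst h))) (at (y, a))"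
    using has_derivative_compose[OF f, of t' "blinfun_apply t''"] t' by simp
  have 3: "((\<lambda>p. (t (fst p), t' (fst p) (snd p))) has_derivative (\<lambda>h. (t' y (fst h), t' y (snd h)
      + t'' (fst h) a))) (at (y, a))"
    using has_derivative_Pair[OF 1 bounded_bilinear.FDERIV[OF bounded_bilinear_blinfun_apply 2 s]] by simp
  have "((\<lambda>(y, a). (t y, frechet_derivative t (at y) a)) has_derivative (\<lambda>h. (t' y (fst h), t' y (snd h)
      + t'' (fst h) a))) (at (y, a))"
    by (rule has_derivative_transform_within_open[OF 3, of "S \<times> UNIV"])
      (use assms(1,2) in \<open>auto simp: frechet_derivative_eqI[OF t] intro: open_Times\<close>)
  then show ?thesis by (simp add: case_prod_unfold add.commute)
qed

lemma charts_at_iff: "c \<in> charts_at M x \<longleftrightarrow> c \<in> M \<and> x \<in> cdom c"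
  by (simp add: charts_at_def)

lemma cinv_in_cdom: "y \<in> cmap c ` cdom c \<Longrightarrow> cinv c y \<in> cdom c"
  unfolding cinv_def by (rule inv_into_into)

lemma cmap_cinv: "y \<in> cmap c ` cdom c \<Longrightarrow> cmap c (cinv c y) = y"
  unfolding cinv_def by (rule f_inv_into_f)

text \<open>For fixed \<open>a\<close>, as a function of \<open>x\<close>, this is the field on the
  chart domain whose coordinates in \<open>c\<close> are constantly \<open>a\<close>.\<close>

definition coord_vector :: "('m, 'e::real_normed_vector) chart set \<Rightarrow> ('m, 'e) chart \<Rightarrow> 'm \<Rightarrow> 'e \<Rightarrow> ('m, 'e)
    tvec" where
  "coord_vector M c x a = (\<lambda>d. if d \<in> charts_at M x then frechet_derivative (cmap d \<circ> cinv c) (at (cmap c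
      x)) a else 0)"

lemma cdom_tangent_chart: "cdom (tangent_chart M c) = {u \<in> tangent_bundle M. fst u \<in> cdom c}"
  by (simp add: tangent_chart_def)

lemma cmap_tangent_chart: "cmap (tangent_chart M c) (x, v) = (cmap c x, v c)"
  by (simp add: tangent_chart_def)

lemma points_tangent_atlas: "points (tangent_atlas M) = tangent_bundle M"
  by (auto simp: points_def tangent_atlas_def cdom_tangent_chart tangent_bundle_def)

lemma tangent_charts_at_iff:
  "C \<in> charts_at (tangent_atlas M) (x, v) \<longleftrightarrow> (\<exists>c\<in>charts_at M x. C = tangent_chart M c) \<and> v \<in> tangent_space M x"
  by (auto simp: charts_at_iff tangent_atlas_def cdom_tangent_chart tangent_bundle_def points_def)

locale banach_atlas =
  fixes M :: "('m, 'e::banach) chart set"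
  assumes manifold: "banach_manifold M"
begin

lemma inj_cmap: "c \<in> M \<Longrightarrow> inj_on (cmap c) (cdom c)"
  and open_overlap: "c \<in> M \<Longrightarrow> d \<in> M \<Longrightarrow> open (cmap c ` (cdom c \<inter> cdom d))"
  and smooth_transition: "c \<in> M \<Longrightarrow> d \<in> M \<Longrightarrow> smooth_on (cmap c ` (cdom c \<inter> cdom d)) (cmap d \<circ> cinv c)"
  using manifold unfolding banach_manifold_def by blast+

lemma open_image: "c \<in> M \<Longrightarrow> open (cmap c ` cdom c)"
  using open_overlap[of c c] by simp

lemma cinv_cmap: "c \<in> M \<Longrightarrow> x \<in> cdom c \<Longrightarrow> cinv c (cmap c x) = x"
  unfolding cinv_def by (rule inv_into_f_f[OF inj_cmap])

lemma transition_has_derivative: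
  assumes "c \<in> charts_at M x" "d \<in> charts_at M x"
  shows "((cmap d \<circ> cinv c) has_derivative frechet_derivative (cmap d \<circ> cinv c) (at (cmap c x))) (at (cmap
      c x))"
  using assms by (intro smooth_on_has_derivative[OF smooth_transition]) (auto simp: charts_at_iff)

lemma transition_cocycle:
  assumes c: "c \<in> charts_at M x" and d: "d \<in> charts_at M x" and e: "e \<in> charts_at M x"
  shows "frechet_derivative (cmap e \<circ> cinv d) (at (cmap d x)) (frechet_derivative (cmap d \<circ> cinv c) (at
      (cmap c x)) a)
    = frechet_derivative (cmap e \<circ> cinv c) (at (cmap c x)) a"
proof -
  let ?S = "cmap c ` (cdom c \<inter> cdom d)"
  have M: "c \<in> M" "d \<in> M" and x: "x \<in> cdom c" "x \<in> cdom d" using c d by (auto simp: charts_at_iff)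
  have pt: "(cmap d \<circ> cinv c) (cmap c x) = cmap d x" using M x by (simp add: cinv_cmap)
  have "((\<lambda>y. (cmap e \<circ> cinv d) ((cmap d \<circ> cinv c) y)) has_derivative
     (\<lambda>a. frechet_derivative (cmap e \<circ> cinv d) (at (cmap d x)) (frechet_derivative (cmap d \<circ> cinv c) (at
         (cmap c x)) a))) (at (cmap c x))"
    by (rule has_derivative_compose[OF transition_has_derivative[OF c d], unfolded pt, OF
        transition_has_derivative[OF d e]])
  then have "((cmap e \<circ> cinv c) has_derivative
     (\<lambda>a. frechet_derivative (cmap e \<circ> cinv d) (at (cmap d x)) (frechet_derivative (cmap d \<circ> cinv c) (at
         (cmap c x)) a))) (at (cmap c x))"
    by (rule has_derivative_transform_within_open[OF _ open_overlap[OF M]]) (use M x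
        in \<open>auto simp: cinv_cmap\<close>)
  from frechet_derivative_eqI[OF this] show ?thesis by simp
qed

lemma transition_refl:
  assumes "c \<in> charts_at M x"
  shows "frechet_derivative (cmap c \<circ> cinv c) (at (cmap c x)) a = a"
proof -
  have c: "c \<in> M" "x \<in> cdom c" using assms by (auto simp: charts_at_iff)
  have "((cmap c \<circ> cinv c) has_derivative (\<lambda>a. a)) (at (cmap c x))"
    by (rule has_derivative_transform_within_open[OF has_derivative_ident open_image[OF c(1)]])
      (use c in \<open>auto simp: cinv_cmap\<close>)
  from frechet_derivative_eqI[OF this] show ?thesis by simp
qed

lemma coord_vector_in: "c \<in> charts_at M x \<Longrightarrow> coord_vector M c x a \<in> tangent_space M x"
  unfolding tangent_space_def coord_vector_def by (auto simp: transition_cocycle)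

lemma coord_vector_self: "c \<in> charts_at M x \<Longrightarrow> coord_vector M c x a c = a"
  by (simp add: coord_vector_def transition_refl)

lemma tangent_space_eq_coord_vector:
  assumes "v \<in> tangent_space M x" "c \<in> charts_at M x"
  shows "v = coord_vector M c x (v c)"
proof (rule ext)
  fix d
  have "v d = frechet_derivative (cmap d \<circ> cinv c) (at (cmap c x)) (v c)" if "d \<in> charts_at M x"
    using assms that unfolding tangent_space_def by blast
  moreover have "v d = 0" if "d \<notin> charts_at M x" using assms(1) that unfolding tangent_space_def by blast
  ultimately show "v d = coord_vector M c x (v c) d" unfolding coord_vector_def by simp
qed

lemma tangent_space_eqI:
  assumes "v \<in> tangent_space M x" "w \<in> tangent_space M x" "c \<in> charts_at M x" "v c = w c"
  shows "v = w"
  using assms tangent_space_eq_coord_vector by metis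

lemma tangent_space_diff:
  assumes "v \<in> tangent_space M x" "w \<in> tangent_space M x"
  shows "v - w \<in> tangent_space M x"
proof -
  have "(v - w) d = frechet_derivative (cmap d \<circ> cinv c) (at (cmap c x)) ((v - w) c)"
    if c: "c \<in> charts_at M x" and d: "d \<in> charts_at M x" for c d
  proof -
    have "v d = frechet_derivative (cmap d \<circ> cinv c) (at (cmap c x)) (v c)"
      "w d = frechet_derivative (cmap d \<circ> cinv c) (at (cmap c x)) (w c)"
      using assms c d unfolding tangent_space_def by blast+
    then show ?thesis
      using linear_diff[OF has_derivative_linear[OF transition_has_derivative[OF c d]], of "v c" "w c"]
          by simp
  qed
  moreover have "(v - w) d = 0" if "d \<notin> charts_at M x" for d
    using assms that unfolding tangent_space_def by simp
  ultimately show ?thesis unfolding tangent_space_def by blast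
qed

lemma tangent_chart_image:
  assumes "c \<in> M" "A \<subseteq> cdom c"
  shows "cmap (tangent_chart M c) ` {u \<in> tangent_bundle M. fst u \<in> A} = cmap c ` A \<times> UNIV"
proof (intro equalityI subsetI)
  fix p assume "p \<in> cmap c ` A \<times> (UNIV :: 'e set)"
  then obtain x a where x: "p = (cmap c x, a)" "x \<in> A" by auto
  have c: "c \<in> charts_at M x" using assms x by (auto simp: charts_at_iff)
  have "(x, coord_vector M c x a) \<in> tangent_bundle M"
    using coord_vector_in[OF c] c by (auto simp: tangent_bundle_def points_def charts_at_iff)
  then show "p \<in> cmap (tangent_chart M c) ` {u \<in> tangent_bundle M. fst u \<in> A}"
    using x coord_vector_self[OF c] by (auto intro!: image_eqI[of _ _ "(x, coord_vector M c x a)"] simp: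
        cmap_tangent_chart)
qed (auto simp: cmap_tangent_chart)

lemma inj_tangent_chart:
  assumes "c \<in> M"
  shows "inj_on (cmap (tangent_chart M c)) (cdom (tangent_chart M c))"
proof (rule inj_onI)
  fix u w assume u: "u \<in> cdom (tangent_chart M c)" and w: "w \<in> cdom (tangent_chart M c)"
    and eq: "cmap (tangent_chart M c) u = cmap (tangent_chart M c) w"
  obtain x v y v' where xy: "u = (x, v)" "w = (y, v')" by (cases u, cases w)
  have mem: "x \<in> cdom c" "y \<in> cdom c" "v \<in> tangent_space M x" "v' \<in> tangent_space M y"
    using u w xy by (auto simp: cdom_tangent_chart tangent_bundle_def)
  have eq': "cmap c x = cmap c y" "v c = v' c" using eq xy by (auto simp: cmap_tangent_chart)
  have "x = y" using inj_cmap[OF assms] mem eq'(1) by (auto dest: inj_onD)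
  then have "v = v'" using mem assms eq' by (intro tangent_space_eqI[of v x v' c]) (auto simp: charts_at_iff)
  then show "u = w" using xy \<open>x = y\<close> by simp
qed

lemma cinv_tangent_chart:
  assumes "c \<in> M" "x \<in> cdom c"
  shows "cinv (tangent_chart M c) (cmap c x, a) = (x, coord_vector M c x a)"
proof -
  have c: "c \<in> charts_at M x" using assms by (auto simp: charts_at_iff)
  have "(x, coord_vector M c x a) \<in> cdom (tangent_chart M c)"
    using coord_vector_in[OF c] assms by (auto simp: cdom_tangent_chart tangent_bundle_def points_def)
  moreover have "cmap (tangent_chart M c) (x, coord_vector M c x a) = (cmap c x, a)"
    by (simp add: cmap_tangent_chart coord_vector_self[OF c])
  ultimately show ?thesis unfolding cinv_def by (rule inv_into_f_eq[OF inj_tangent_chart[OF assms(1)]])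
qed

text \<open>With this, everything proved for an atlas can be used with the tangent bundle as base
  manifold, hence for the values of a connection in the second tangent bundle.\<close>

lemma banach_manifold_tangent_atlas: "banach_manifold (tangent_atlas M)"
proof -
  have dom: "cdom (tangent_chart M c) \<inter> cdom (tangent_chart M d)
      = {u \<in> tangent_bundle M. fst u \<in> cdom c \<inter> cdom d}" for c d
    by (auto simp: cdom_tangent_chart)
  have im: "cmap (tangent_chart M c) ` (cdom (tangent_chart M c) \<inter> cdom (tangent_chart M d))
      = cmap c ` (cdom c \<inter> cdom d) \<times> UNIV"
    if "c \<in> M" for c d unfolding dom by (rule tangent_chart_image[OF that]) auto
  have "smooth_on (cmap c ` (cdom c \<inter> cdom d) \<times> UNIV) (cmap (tangent_chart M d) \<circ> cinv (tangent_chart M c))"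
    if "c \<in> M" "d \<in> M" for c d
    by (rule smooth_on_cong[OF smooth_on_tangent[OF smooth_transition[OF that]]])
      (use that in \<open>auto simp: cinv_tangent_chart cmap_tangent_chart coord_vector_def charts_at_iff
          cinv_cmap\<close>)
  moreover have "open (cmap (tangent_chart M c) ` cdom (tangent_chart M c))" if "c \<in> M" for c
    using im[OF that, of c] open_image[OF that] by (simp add: open_Times)
  moreover have "open (cmap c ` (cdom c \<inter> cdom d) \<times> (UNIV :: 'e set))" if "c \<in> M" "d \<in> M" for c d
    by (intro open_Times open_overlap that open_UNIV)
  ultimately show ?thesis
    unfolding banach_manifold_def tangent_atlas_def by (auto simp: im inj_tangent_chart)
qed

lemma open_subset_cdom: "c \<in> M \<Longrightarrow> open_subset M (cdom c)"
  unfolding open_subset_def points_def using open_overlap by (auto simp: Int_commute)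

end

lemma smooth_map_rep:
  "smooth_map M N W f \<Longrightarrow> c \<in> M \<Longrightarrow> d \<in> N \<Longrightarrow> smooth_on (cmap c ` {x \<in> W \<inter> cdom c. f x \<in> cdom d}) (cmap d \<circ> f \<circ>
      cinv c)"
  unfolding smooth_map_def by blast

lemma smooth_map_rep_has_derivative:
  assumes "smooth_map M N W f" "x \<in> W" "c \<in> charts_at M x" "d \<in> charts_at N (f x)"
  shows "((cmap d \<circ> f \<circ> cinv c) has_derivative frechet_derivative (cmap d \<circ> f \<circ> cinv c) (at (cmap c x)))
      (at (cmap c x))"
  using assms by (intro smooth_on_has_derivative[OF smooth_map_rep[OF assms(1)]]) (auto simp: charts_at_iff)

text \<open>The definition uses an arbitrarily chosen chart at \<open>x\<close>; the chain rule for
  the chart change shows that any other chart gives the same value.\<close>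

lemma (in banach_atlas) tangent_at_eq:
  assumes f: "smooth_map M N W f" and x: "x \<in> W" and c: "c \<in> charts_at M x" and d: "d \<in> charts_at N (f x)"
    and v: "v \<in> tangent_space M x"
  shows "tangent_at M N f x v d = frechet_derivative (cmap d \<circ> f \<circ> cinv c) (at (cmap c x)) (v c)"
proof -
  define c0 where "c0 = (SOME c. c \<in> charts_at M x)"
  have c0: "c0 \<in> charts_at M x" unfolding c0_def using c by (rule someI)
  have mem: "c0 \<in> M" "c \<in> M" "x \<in> cdom c0" "x \<in> cdom c" using c c0 by (auto simp: charts_at_iff)
  have pt: "(cmap c \<circ> cinv c0) (cmap c0 x) = cmap c x" using mem by (simp add: cinv_cmap)
  have "((\<lambda>y. (cmap d \<circ> f \<circ> cinv c) ((cmap c \<circ> cinv c0) y)) has_derivative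
     (\<lambda>a. frechet_derivative (cmap d \<circ> f \<circ> cinv c) (at (cmap c x)) (frechet_derivative (cmap c \<circ> cinv c0)
         (at (cmap c0 x)) a))) (at (cmap c0 x))"
    by (rule has_derivative_compose[OF transition_has_derivative[OF c0 c], unfolded pt, OF
        smooth_map_rep_has_derivative[OF f x c d]])
  then have "((cmap d \<circ> f \<circ> cinv c0) has_derivative
     (\<lambda>a. frechet_derivative (cmap d \<circ> f \<circ> cinv c) (at (cmap c x)) (frechet_derivative (cmap c \<circ> cinv c0)
         (at (cmap c0 x)) a))) (at (cmap c0 x))"
    by (rule has_derivative_transform_within_open[OF _ open_overlap[OF mem(1,2)]]) (use mem
        in \<open>auto simp: cinv_cmap\<close>)
  moreover have "v c = frechet_derivative (cmap c \<circ> cinv c0) (at (cmap c0 x)) (v c0)"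
    using v c c0 unfolding tangent_space_def by blast
  ultimately show ?thesis
    using d unfolding tangent_at_def Let_def c0_def[symmetric] by (simp add: frechet_derivative_eqI)
qed

lemma (in banach_atlas) tangent_at_in:
  assumes N: "banach_manifold N" and f: "smooth_map M N W f" and x: "x \<in> W" and v: "v \<in> tangent_space M x"
  shows "tangent_at M N f x v \<in> tangent_space N (f x)"
proof -
  interpret N: banach_atlas N by (rule banach_atlas.intro[OF N])
  have "x \<in> points M" using f x unfolding smooth_map_def open_subset_def by blast
  then obtain c where c: "c \<in> charts_at M x" by (auto simp: points_def charts_at_iff)
  have "tangent_at M N f x v e = frechet_derivative (cmap e \<circ> cinv d) (at (cmap d (f x))) (tangent_at M N
      f x v d)"
    if d: "d \<in> charts_at N (f x)" and e: "e \<in> charts_at N (f x)" for d e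
  proof -
    have mem: "c \<in> M" "d \<in> N" "x \<in> cdom c" "f x \<in> cdom d" using c d by (auto simp: charts_at_iff)
    have pt: "(cmap d \<circ> f \<circ> cinv c) (cmap c x) = cmap d (f x)" using mem by (simp add: cinv_cmap)
    have "((\<lambda>y. (cmap e \<circ> cinv d) ((cmap d \<circ> f \<circ> cinv c) y)) has_derivative
       (\<lambda>a. frechet_derivative (cmap e \<circ> cinv d) (at (cmap d (f x))) (frechet_derivative (cmap d \<circ> f \<circ>
           cinv c) (at (cmap c x)) a))) (at (cmap c x))"
      by (rule has_derivative_compose[OF smooth_map_rep_has_derivative[OF f x c d], unfolded pt, OF
          N.transition_has_derivative[OF d e]])
    then have "((cmap e \<circ> f \<circ> cinv c) has_derivative
       (\<lambda>a. frechet_derivative (cmap e \<circ> cinv d) (at (cmap d (f x))) (frechet_derivative (cmap d \<circ> f \<circ>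
           cinv c) (at (cmap c x)) a))) (at (cmap c x))"
      by (rule has_derivative_transform_within_open[OF _ smooth_on_open[OF smooth_map_rep[OF f mem(1,2)]]])
        (use mem x in \<open>auto simp: cinv_cmap N.cinv_cmap\<close>)
    then show ?thesis by (simp add: tangent_at_eq[OF f x c _ v] d e frechet_derivative_eqI)
  qed
  moreover have "tangent_at M N f x v d = 0" if "d \<notin> charts_at N (f x)" for d
    using that by (simp add: tangent_at_def Let_def)
  ultimately show ?thesis unfolding tangent_space_def by blast
qed

text \<open>Affinity involves the tangent map of the tangent map, whose coordinates can be computed
  in any chart only once the inner one is known to be smooth.\<close>

lemma (in banach_atlas) smooth_map_tangent_map:
  assumes N: "banach_manifold N" and f: "smooth_map M N W f"
  shows "smooth_map (tangent_atlas M) (tangent_atlas N) {u \<in> tangent_bundle M. fst u \<in> W} (tangent_map M N f)"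
proof -
  interpret N: banach_atlas N by (rule banach_atlas.intro[OF N])
  let ?W = "{u \<in> tangent_bundle M. fst u \<in> W}"
  have open_W: "open (cmap c ` (W \<inter> cdom c))" if "c \<in> M" for c
    using f that unfolding smooth_map_def open_subset_def by blast
  have fW: "f ` W \<subseteq> points N" using f unfolding smooth_map_def by blast
  have Tf: "tangent_map M N f u \<in> tangent_bundle N" "fst (tangent_map M N f u) = f (fst u)" if "u \<in> ?W" for u
    using that tangent_at_in[OF N f] fW by (auto simp: tangent_map_def tangent_bundle_def)
  have "open_subset (tangent_atlas M) ?W"
    unfolding open_subset_def
  proof (intro conjI ballI)
    show "?W \<subseteq> points (tangent_atlas M)" by (auto simp: points_tangent_atlas)
    fix C assume "C \<in> tangent_atlas M"
    then obtain c where c: "C = tangent_chart M c" "c \<in> M" by (auto simp: tangent_atlas_def)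
    have "?W \<inter> cdom C = {u \<in> tangent_bundle M. fst u \<in> W \<inter> cdom c}" unfolding c by
        (auto simp: cdom_tangent_chart)
    then have "cmap C ` (?W \<inter> cdom C) = cmap c ` (W \<inter> cdom c) \<times> UNIV"
      unfolding c using tangent_chart_image[OF c(2), of "W \<inter> cdom c"] by simp
    then show "open (cmap C ` (?W \<inter> cdom C))" using open_W[OF c(2)] by (simp add: open_Times)
  qed
  moreover have "tangent_map M N f ` ?W \<subseteq> points (tangent_atlas N)"
    unfolding points_tangent_atlas using Tf(1) by blast
  moreover have "smooth_on (cmap C ` {u \<in> ?W \<inter> cdom C. tangent_map M N f u \<in> cdom D}) (cmap D \<circ>
      tangent_map M N f \<circ> cinv C)"
    if "C \<in> tangent_atlas M" "D \<in> tangent_atlas N" for C D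
  proof -
    from that obtain c d where c: "C = tangent_chart M c" "c \<in> M" and d: "D = tangent_chart N d" "d \<in> N"
      by (auto simp: tangent_atlas_def)
    let ?A = "{x \<in> W \<inter> cdom c. f x \<in> cdom d}"
    have "{u \<in> ?W \<inter> cdom C. tangent_map M N f u \<in> cdom D} = {u \<in> tangent_bundle M. fst u \<in> ?A}"
      unfolding c d cdom_tangent_chart using Tf by auto
    then have im: "cmap C ` {u \<in> ?W \<inter> cdom C. tangent_map M N f u \<in> cdom D} = cmap c ` ?A \<times> UNIV"
      unfolding c using tangent_chart_image[OF c(2), of ?A] by auto
    have "(case p of (y, a) \<Rightarrow> ((cmap d \<circ> f \<circ> cinv c) y, frechet_derivative (cmap d \<circ> f \<circ> cinv c) (at y) a))
        = (cmap D \<circ> tangent_map M N f \<circ> cinv C) p" if p: "p \<in> cmap c ` ?A \<times> UNIV" for p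
    proof -
      obtain x a where x: "p = (cmap c x, a)" "x \<in> ?A" using p by auto
      have cx: "c \<in> charts_at M x" and dx: "d \<in> charts_at N (f x)" using x c d by (auto simp: charts_at_iff)
      show ?thesis using x c(2) tangent_at_eq[OF f _ cx dx coord_vector_in[OF cx]] coord_vector_self[OF cx]
        unfolding c d by (simp add: cinv_tangent_chart cmap_tangent_chart tangent_map_def cinv_cmap)
    qed
    then show ?thesis unfolding im
      by (rule smooth_on_cong[OF smooth_on_tangent[OF smooth_map_rep[OF f c(2) d(2)]]])
  qed
  ultimately show ?thesis unfolding smooth_map_def by blast
qed

section \<open>Vector fields\<close>

context banach_atlas
begin

lemma vector_field_local_rep:
  assumes "vector_field M U \<xi>" "c \<in> M"
  shows "smooth_on (cmap c ` (U \<inter> cdom c)) (local_rep c \<xi>)"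
proof -
  have U: "U \<subseteq> points M" and T: "\<And>x. x \<in> U \<Longrightarrow> \<xi> x \<in> tangent_space M x"
    using assms(1) unfolding vector_field_def open_subset_def by blast+
  have s: "smooth_map M (tangent_atlas M) U (\<lambda>x. (x, \<xi> x))" using assms(1) unfolding vector_field_def by blast
  have Tc: "tangent_chart M c \<in> tangent_atlas M" using assms(2) by (simp add: tangent_atlas_def)
  have set_eq: "{x \<in> U \<inter> cdom c. (x, \<xi> x) \<in> cdom (tangent_chart M c)} = U \<inter> cdom c"
    using U T by (auto simp: cdom_tangent_chart tangent_bundle_def)
  from smooth_map_rep[OF s assms(2) Tc] show ?thesis unfolding set_eq
    by (rule smooth_on_cong[OF smooth_on_snd]) (simp add: local_rep_def cmap_tangent_chart)
qed

text \<open>Every tangent vector thus extends to a vector field near its point. The descriptions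
  defining torsion and curvature quantify over such extensions and would determine nothing without
  one.\<close>

lemma vector_field_coord_vector:
  assumes c: "c \<in> M"
  shows "vector_field M (cdom c) (\<lambda>x. coord_vector M c x a)"
  unfolding vector_field_def
proof (intro conjI ballI)
  show "open_subset M (cdom c)" by (rule open_subset_cdom[OF c])
  show T: "coord_vector M c x a \<in> tangent_space M x" if "x \<in> cdom c" for x
    using c that by (intro coord_vector_in) (simp add: charts_at_iff)
  show "smooth_map M (tangent_atlas M) (cdom c) (\<lambda>x. (x, coord_vector M c x a))"
    unfolding smooth_map_def
  proof (intro conjI ballI)
    show "open_subset M (cdom c)" by (rule open_subset_cdom[OF c])
    show "(\<lambda>x. (x, coord_vector M c x a)) ` cdom c \<subseteq> points (tangent_atlas M)"
      unfolding points_tangent_atlas using T c by (auto simp: tangent_bundle_def points_def)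
    fix d E assume d: "d \<in> M" and "E \<in> tangent_atlas M"
    then obtain e where e: "E = tangent_chart M e" "e \<in> M" by (auto simp: tangent_atlas_def)
    let ?A = "cdom c \<inter> cdom d \<inter> cdom e"
    have set_eq: "{x \<in> cdom c \<inter> cdom d. (x, coord_vector M c x a) \<in> cdom E} = ?A"
      using T c unfolding e by (auto simp: cdom_tangent_chart tangent_bundle_def points_def)
    have "cmap d ` ?A = cmap d ` (cdom d \<inter> cdom c) \<inter> cmap d ` (cdom d \<inter> cdom e)"
      using inj_on_image_Int[OF inj_cmap[OF d], of "cdom d \<inter> cdom c" "cdom d \<inter> cdom e"] by (auto simp: Int_ac)
    then have o: "open (cmap d ` ?A)" using open_overlap d c e by auto
    have 1: "smooth_on (cmap d ` ?A) (cmap e \<circ> cinv d)"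
      by (rule smooth_on_subset[OF smooth_transition[OF d e(2)] o]) auto
    have 2: "smooth_on (cmap d ` ?A) (cmap c \<circ> cinv d)"
      by (rule smooth_on_subset[OF smooth_transition[OF d c] o]) auto
    \<comment> \<open>In the chart \<open>d\<close> of the base and the chart of \<open>e\<close> on
      the bundle, the field is the chart change from \<open>d\<close> to \<open>c\<close>, paired
      with the constant \<open>a\<close>, followed by the tangent map of the chart change from
      \<open>c\<close> to \<open>e\<close>.\<close>
    note 3 = smooth_on_snd[OF smooth_on_compose[OF smooth_on_tangent[OF smooth_transition[OF c e(2)]]
        smooth_on_Pair[OF 2 smooth_on_const[OF o, of a]]]]
    have 4: "smooth_on (cmap d ` ?A) (\<lambda>y. frechet_derivative (cmap e \<circ> cinv c) (at ((cmap c \<circ> cinv d) y)) a)"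
      by (rule smooth_on_cong[OF 3]) (use c d in \<open>auto simp: cinv_cmap\<close>)
    show "smooth_on (cmap d ` {x \<in> cdom c \<inter> cdom d. (x, coord_vector M c x a) \<in> cdom E}) (cmap E \<circ> (\<lambda>x.
        (x, coord_vector M c x a)) \<circ> cinv d)"
      unfolding set_eq
      by (rule smooth_on_cong[OF smooth_on_Pair[OF 1 4]])
        (use d e in \<open>auto simp: cinv_cmap cmap_tangent_chart coord_vector_def charts_at_iff\<close>)
  qed
qed

lemma local_rep_coord_vector:
  assumes "c \<in> M" "y \<in> cmap c ` cdom c"
  shows "local_rep c (\<lambda>x. coord_vector M c x a) y = a"
  using assms cinv_in_cdom[of y c] unfolding local_rep_def by (intro coord_vector_self)
      (auto simp: charts_at_iff)

end

section \<open>Affine connections in charts\<close>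

lemma second_tangent_coords_eq:
  assumes "fst u = (x, v)"
  shows "second_tangent_coords M c u = ((cmap c x, v c), snd u (tangent_chart M c))"
  using assms by (cases u) (simp add: second_tangent_coords_def cmap_tangent_chart)

lemma has_derivative_blinfun_apply_const:
  assumes "(f has_derivative f') F"
  shows "((\<lambda>y. blinfun_apply (f y) u) has_derivative (\<lambda>h. blinfun_apply (f' h) u)) F"
  using bounded_linear.has_derivative[OF blinfun.bounded_linear_left assms] .

locale affine_atlas = banach_atlas M for M :: "('m, 'e::banach) chart set" +
  fixes B :: "('m, 'e) connection"
  assumes connection: "affine_connection M B"
begin

lemma connection_in:
  assumes "x \<in> points M" "v \<in> tangent_space M x" "w \<in> tangent_space M x"
  shows "fst (B (x, v, w)) = (x, v)" "snd (B (x, v, w)) \<in> tangent_space (tangent_atlas M) (x, v)"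
proof -
  have "(x, v, w) \<in> whitney_sum M" using assms by (simp add: whitney_sum_def)
  then have *: "B (x, v, w) \<in> tangent_bundle (tangent_atlas M)" "fst (B (x, v, w)) = (x, v)"
    using connection unfolding affine_connection_def by blast+
  then show "fst (B (x, v, w)) = (x, v)" "snd (B (x, v, w)) \<in> tangent_space (tangent_atlas M) (x, v)"
    by (auto simp: tangent_bundle_def)
qed

text \<open>Since the covariant derivative subtracts \<open>B\<close>, this is the negative of the
  classical Christoffel symbol, with the direction of differentiation as last argument.\<close>

definition christoffel :: "('m, 'e) chart \<Rightarrow> 'e \<Rightarrow> 'e \<Rightarrow>\<^sub>L 'e \<Rightarrow>\<^sub>L 'e" where
  "christoffel c = (SOME \<beta> :: 'e \<Rightarrow> 'e \<Rightarrow>\<^sub>L 'e \<Rightarrow>\<^sub>L 'e. smooth_on (cmap c ` cdom c) \<beta> \<and>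
        (\<forall>(x, v, w)\<in>whitney_sum M. x \<in> cdom c \<longrightarrow>
           second_tangent_coords M c (B (x, v, w))
               = ((cmap c x, v c), (w c, blinfun_apply (blinfun_apply (\<beta> (cmap c x)) (v c)) (w c)))))"

lemma christoffel:
  assumes "c \<in> M"
  shows "smooth_on (cmap c ` cdom c) (christoffel c)"
    and "\<And>x v w. x \<in> cdom c \<Longrightarrow> v \<in> tangent_space M x \<Longrightarrow> w \<in> tangent_space M x \<Longrightarrow>
      second_tangent_coords M c (B (x, v, w))
          = ((cmap c x, v c), (w c, christoffel c (cmap c x) (v c) (w c)))"
proof -
  have "\<exists>\<beta> :: 'e \<Rightarrow> 'e \<Rightarrow>\<^sub>L 'e \<Rightarrow>\<^sub>L 'e. smooth_on (cmap c ` cdom c) \<beta> \<and>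
        (\<forall>(x, v, w)\<in>whitney_sum M. x \<in> cdom c \<longrightarrow>
           second_tangent_coords M c (B (x, v, w))
               = ((cmap c x, v c), (w c, blinfun_apply (blinfun_apply (\<beta> (cmap c x)) (v c)) (w c))))"
    using connection assms unfolding affine_connection_def by blast
  from someI_ex[OF this] have *: "smooth_on (cmap c ` cdom c) (christoffel c)"
    "\<forall>(x, v, w)\<in>whitney_sum M. x \<in> cdom c \<longrightarrow>
        second_tangent_coords M c (B (x, v, w))
            = ((cmap c x, v c), (w c, christoffel c (cmap c x) (v c) (w c)))"
    unfolding christoffel_def by blast+
  show "smooth_on (cmap c ` cdom c) (christoffel c)" by (rule *(1))
  fix x v w assume "x \<in> cdom c" "v \<in> tangent_space M x" "w \<in> tangent_space M x"
  then show "second_tangent_coords M c (B (x, v, w))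
      = ((cmap c x, v c), (w c, christoffel c (cmap c x) (v c) (w c)))"
    using *(2) assms by (auto simp: whitney_sum_def points_def)
qed

lemma connection_coord:
  assumes c: "c \<in> charts_at M x" and v: "v \<in> tangent_space M x" and w: "w \<in> tangent_space M x"
  shows "snd (B (x, v, w)) (tangent_chart M c) = (w c, christoffel c (cmap c x) (v c) (w c))"
proof -
  have mem: "c \<in> M" "x \<in> cdom c" "x \<in> points M" using c by (auto simp: charts_at_iff points_def)
  show ?thesis
    using christoffel(2)[OF mem(1,2) v w] second_tangent_coords_eq[OF connection_in(1)[OF mem(3) v w], of
        M c] by simp
qed

text \<open>Values of \<open>B\<close> are vectors of the second tangent bundle and so change by the
  second tangent map of the chart change. Its last component adds the term with \<open>t''\<close>,
  the inhomogeneous part of the classical transformation law.\<close>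

lemma christoffel_transition:
  assumes c: "c \<in> charts_at M x" and d: "d \<in> charts_at M x" and v: "v \<in> tangent_space M x"
      and w: "w \<in> tangent_space M x"
    and t: "\<And>y. y \<in> cmap c ` (cdom c \<inter> cdom d) \<Longrightarrow>
        ((cmap d \<circ> cinv c) has_derivative blinfun_apply (t' y)) (at y)"
    and t': "(t' has_derivative blinfun_apply t'') (at (cmap c x))"
  shows "christoffel d (cmap d x) (v d) (w d)
      = t'' (w c) (v c) + t' (cmap c x) (christoffel c (cmap c x) (v c) (w c))"
proof -
  interpret T: banach_atlas "tangent_atlas M" by (rule banach_atlas.intro[OF banach_manifold_tangent_atlas])
  have mem: "c \<in> M" "d \<in> M" "x \<in> cdom c" "x \<in> cdom d" "x \<in> points M" using c d by
      (auto simp: charts_at_iff points_def)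
  let ?C = "tangent_chart M c" and ?D = "tangent_chart M d" and ?\<tau> = "snd (B (x, v, w))"
  have C: "?C \<in> charts_at (tangent_atlas M) (x, v)" and D: "?D \<in> charts_at (tangent_atlas M) (x, v)"
    using c d v by (auto simp: tangent_charts_at_iff)
  have eq: "?\<tau> ?D = frechet_derivative (cmap ?D \<circ> cinv ?C) (at (cmap ?C (x, v))) (?\<tau> ?C)"
    using connection_in(2)[OF mem(5) v w] C D unfolding tangent_space_def by blast
  have p: "cmap c x \<in> cmap c ` (cdom c \<inter> cdom d)" using mem by blast
  note o = open_overlap[OF mem(1,2)]
  have "((cmap ?D \<circ> cinv ?C) has_derivative (\<lambda>(w, z). (t' (cmap c x) w, t'' w (v c)
      + t' (cmap c x) z))) (at (cmap c x, v c))"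
    by (rule has_derivative_transform_within_open[OF tangent_has_derivative[OF o p t t'] open_Times[OF o
        open_UNIV]])
      (use mem in \<open>auto simp: cinv_tangent_chart cmap_tangent_chart coord_vector_def charts_at_iff cinv_cmap\<close>)
  from frechet_derivative_eqI[OF this] eq
  have "snd (?\<tau> ?D) = t'' (w c) (v c) + t' (cmap c x) (christoffel c (cmap c x) (v c) (w c))"
    by (simp add: cmap_tangent_chart connection_coord[OF c v w])
  then show ?thesis by (simp add: connection_coord[OF d v w])
qed

lemma transition_derivatives:
  assumes c: "c \<in> charts_at M x" and d: "d \<in> charts_at M x"
  obtains t' t'' where "\<And>y. y \<in> cmap c ` (cdom c \<inter> cdom d) \<Longrightarrow>
      ((cmap d \<circ> cinv c) has_derivative blinfun_apply (t' y)) (at y)"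
    "(t' has_derivative blinfun_apply t'') (at (cmap c x))"
    "\<And>u v. t'' u v = t'' v u"
    "\<And>v. v \<in> tangent_space M x \<Longrightarrow> v d = t' (cmap c x) (v c)"
proof -
  have mem: "c \<in> M" "d \<in> M" "x \<in> cdom c" "x \<in> cdom d" using c d by (auto simp: charts_at_iff)
  have p: "cmap c x \<in> cmap c ` (cdom c \<inter> cdom d)" using mem by blast
  obtain t' where t': "smooth_on (cmap c ` (cdom c \<inter> cdom d)) t'"
    "\<And>y. y \<in> cmap c ` (cdom c \<inter> cdom d) \<Longrightarrow> ((cmap d \<circ> cinv c) has_derivative blinfun_apply (t' y)) (at y)"
    by (rule smooth_on_blinfun_derivative[OF smooth_transition[OF mem(1,2)]]) blast
  obtain s where s: "\<And>y. y \<in> cmap c ` (cdom c \<inter> cdom d) \<Longrightarrow> (t' has_derivative blinfun_apply (s y)) (at y)"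
    by (rule smooth_on_blinfun_derivative[OF t'(1)]) blast
  show ?thesis
  proof (rule that[OF t'(2) s[OF p]])
    show "s (cmap c x) u v = s (cmap c x) v u" for u v
      by (rule symmetric_second_derivative[OF open_overlap[OF mem(1,2)] p t'(2) s[OF p]])
    fix v assume "v \<in> tangent_space M x"
    then have "v d = frechet_derivative (cmap d \<circ> cinv c) (at (cmap c x)) (v c)"
      using c d unfolding tangent_space_def by blast
    then show "v d = t' (cmap c x) (v c)" using frechet_derivative_eqI[OF t'(2)[OF p]] by simp
  qed
qed

section \<open>Covariant derivative and Lie bracket as tangent vectors\<close>

lemma vector_field_in: "vector_field M U \<xi> \<Longrightarrow> x \<in> U \<Longrightarrow> \<xi> x \<in> tangent_space M x"
  unfolding vector_field_def by blast

text \<open>The curvature differentiates a covariant derivative once more. For this, tangency near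
  \<open>x\<close> and differentiability of the coordinates at \<open>x\<close> suffice, so
  covariant derivatives need not be shown to be smooth sections.\<close>

definition differentiable_field_at :: "'m set \<Rightarrow> 'm \<Rightarrow> ('m \<Rightarrow> ('m, 'e) tvec) \<Rightarrow> bool" where
  "differentiable_field_at U x \<xi> \<longleftrightarrow> open_subset M U \<and> x \<in> U \<and> (\<forall>z\<in>U. \<xi> z \<in> tangent_space M z) \<and>
     (\<forall>c\<in>charts_at M x. local_rep c \<xi> differentiable at (cmap c x))"

lemma vector_field_differentiable:
  assumes "vector_field M U \<xi>" "x \<in> U"
  shows "differentiable_field_at U x \<xi>"
  unfolding differentiable_field_at_def
proof (intro conjI ballI)
  fix c assume c: "c \<in> charts_at M x"
  show "local_rep c \<xi> differentiable at (cmap c x)"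
    by (rule smooth_on_differentiable[OF vector_field_local_rep[OF assms(1)]]) (use c assms(2)
        in \<open>auto simp: charts_at_iff\<close>)
qed (use assms in \<open>auto simp: vector_field_def\<close>)

lemma differentiable_field_in: "differentiable_field_at U x \<xi> \<Longrightarrow> \<xi> x \<in> tangent_space M x"
  unfolding differentiable_field_at_def by blast

lemma local_rep_has_derivative:
  assumes \<xi>: "differentiable_field_at U x \<xi>" and c: "c \<in> charts_at M x"
  shows "(local_rep c \<xi> has_derivative frechet_derivative (local_rep c \<xi>) (at (cmap c x))) (at (cmap c x))"
  using \<xi> c unfolding differentiable_field_at_def by (simp add: frechet_derivative_works)

lemma local_rep_at: "c \<in> charts_at M x \<Longrightarrow> local_rep c \<xi> (cmap c x) = \<xi> x c"
  by (simp add: local_rep_def charts_at_iff cinv_cmap)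

text \<open>Near \<open>x\<close> the coordinates in \<open>d\<close> at the transformed point equal
  \<open>t'\<close> applied to those in \<open>c\<close>; both sides are differentiated, by the
  chain rule and by the product rule.\<close>

lemma local_rep_transition_derivative:
  assumes \<xi>: "differentiable_field_at U x \<xi>" and c: "c \<in> charts_at M x" and d: "d \<in> charts_at M x"
    and t: "\<And>y. y \<in> cmap c ` (cdom c \<inter> cdom d) \<Longrightarrow>
        ((cmap d \<circ> cinv c) has_derivative blinfun_apply (t' y)) (at y)"
    and t': "(t' has_derivative blinfun_apply t'') (at (cmap c x))"
  shows "frechet_derivative (local_rep d \<xi>) (at (cmap d x)) (t' (cmap c x) w) =
    t'' w (\<xi> x c) + t' (cmap c x) (frechet_derivative (local_rep c \<xi>) (at (cmap c x)) w)"
proof -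
  have mem: "c \<in> M" "d \<in> M" "x \<in> cdom c" "x \<in> cdom d" using c d by (auto simp: charts_at_iff)
  have p: "cmap c x \<in> cmap c ` (cdom c \<inter> cdom d)" using mem by blast
  have U: "open_subset M U" and x: "x \<in> U" and in_T: "\<And>z. z \<in> U \<Longrightarrow> \<xi> z \<in> tangent_space M z"
    using \<xi> unfolding differentiable_field_at_def by blast+
  let ?S = "cmap c ` (cdom c \<inter> cdom d) \<inter> cmap c ` (U \<inter> cdom c)"
  have o: "open ?S" using open_overlap[OF mem(1,2)] U mem(1) unfolding open_subset_def
      by (intro open_Int) auto
  have pS: "cmap c x \<in> ?S" using mem x by blast
  have pt: "(cmap d \<circ> cinv c) (cmap c x) = cmap d x" using mem by (simp add: cinv_cmap)
  have 1: "((\<lambda>y. local_rep d \<xi> ((cmap d \<circ> cinv c) y)) has_derivative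
     (\<lambda>w. frechet_derivative (local_rep d \<xi>) (at (cmap d x)) (t' (cmap c x) w))) (at (cmap c x))"
    by (rule has_derivative_compose[OF t[OF p], unfolded pt, OF local_rep_has_derivative[OF \<xi> d]])
  have 2: "((\<lambda>y. t' y (local_rep c \<xi> y)) has_derivative
     (\<lambda>w. t' (cmap c x) (frechet_derivative (local_rep c \<xi>) (at (cmap c x)) w)
         + t'' w (\<xi> x c))) (at (cmap c x))"
    using bounded_bilinear.FDERIV[OF bounded_bilinear_blinfun_apply t' local_rep_has_derivative[OF \<xi> c]]
    by (simp add: local_rep_at[OF c])
  have eq: "t' y (local_rep c \<xi> y) = local_rep d \<xi> ((cmap d \<circ> cinv c) y)" if y: "y \<in> ?S" for y
  proof -
    obtain z where z: "y = cmap c z" "z \<in> cdom c" "z \<in> cdom d" using y by blast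
    have "z \<in> U" using y z(1,2) inj_cmap[OF mem(1)] by (auto dest: inj_onD)
    then have "\<xi> z \<in> tangent_space M z" by (rule in_T)
    moreover have "c \<in> charts_at M z" "d \<in> charts_at M z" using mem z by (auto simp: charts_at_iff)
    ultimately have "\<xi> z d = frechet_derivative (cmap d \<circ> cinv c) (at (cmap c z)) (\<xi> z c)"
      unfolding tangent_space_def by blast
    then show ?thesis using frechet_derivative_eqI[OF t] y z mem by (simp add: local_rep_def cinv_cmap)
  qed
  have "((\<lambda>y. local_rep d \<xi> ((cmap d \<circ> cinv c) y)) has_derivative
     (\<lambda>w. t' (cmap c x) (frechet_derivative (local_rep c \<xi>) (at (cmap c x)) w)
         + t'' w (\<xi> x c))) (at (cmap c x))"
    by (rule has_derivative_transform_within_open[OF 2 o pS eq])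
  from fun_cong[OF has_derivative_unique[OF 1 this], of w] show ?thesis by simp
qed

lemma cov_deriv_at_coord:
  assumes c: "c \<in> charts_at M x" and \<eta>: "\<eta> x \<in> tangent_space M x" and v: "v \<in> tangent_space M x"
  shows "cov_deriv_at M B x v \<eta> c = frechet_derivative (local_rep c \<eta>) (at (cmap c x)) (v c)
      - christoffel c (cmap c x) (\<eta> x c) (v c)"
  using c christoffel(2)[of c x "\<eta> x" v] \<eta> v by (simp add: cov_deriv_at_def charts_at_iff)

text \<open>Under a chart change the derivative of the coordinates and the connection term produce
  the same expression in \<open>t''\<close>, which cancels in their difference.\<close>

lemma cov_deriv_at_in:
  assumes \<eta>: "differentiable_field_at U x \<eta>" and v: "v \<in> tangent_space M x"
  shows "cov_deriv_at M B x v \<eta> \<in> tangent_space M x"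
proof -
  note \<eta>x = differentiable_field_in[OF \<eta>]
  have "cov_deriv_at M B x v \<eta> d = frechet_derivative (cmap d \<circ> cinv c) (at (cmap c x)) (cov_deriv_at M B
      x v \<eta> c)"
    if c: "c \<in> charts_at M x" and d: "d \<in> charts_at M x" for c d
  proof -
    obtain t' t'' where t: "\<And>y. y \<in> cmap c ` (cdom c \<inter> cdom d) \<Longrightarrow>
        ((cmap d \<circ> cinv c) has_derivative blinfun_apply (t' y)) (at y)"
      "(t' has_derivative blinfun_apply t'') (at (cmap c x))"
      "\<And>v. v \<in> tangent_space M x \<Longrightarrow> v d = t' (cmap c x) (v c)"
      by (rule transition_derivatives[OF c d]) blast
    have "cmap c x \<in> cmap c ` (cdom c \<inter> cdom d)" using c d by (auto simp: charts_at_iff)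
    note f = frechet_derivative_eqI[OF t(1)[OF this]]
    show ?thesis
      unfolding cov_deriv_at_coord[where \<eta> = \<eta>, OF c \<eta>x v] cov_deriv_at_coord[where \<eta> = \<eta>, OF d \<eta>x v] f
      using local_rep_transition_derivative[OF \<eta> c d t(1,2), of "v c"] christoffel_transition[OF c d \<eta>x v
          t(1,2)] t(3)[OF v]
      by (simp add: blinfun.bilinear_simps)
  qed
  moreover have "cov_deriv_at M B x v \<eta> c = 0" if "c \<notin> charts_at M x" for c
    using that by (simp add: cov_deriv_at_def)
  ultimately show ?thesis unfolding tangent_space_def by blast
qed

text \<open>The two expressions in \<open>t''\<close> have their arguments interchanged, so here the
  cancellation rests on the symmetry of the second derivative.\<close>

lemma lie_bracket_in:
  assumes \<xi>: "differentiable_field_at U x \<xi>" and \<eta>: "differentiable_field_at V x \<eta>"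
  shows "lie_bracket M \<xi> \<eta> x \<in> tangent_space M x"
proof -
  have "lie_bracket M \<xi> \<eta> x d = frechet_derivative (cmap d \<circ> cinv c) (at (cmap c x)) (lie_bracket M \<xi> \<eta> x c)"
    if c: "c \<in> charts_at M x" and d: "d \<in> charts_at M x" for c d
  proof -
    obtain t' t'' where t: "\<And>y. y \<in> cmap c ` (cdom c \<inter> cdom d) \<Longrightarrow>
        ((cmap d \<circ> cinv c) has_derivative blinfun_apply (t' y)) (at y)"
      "(t' has_derivative blinfun_apply t'') (at (cmap c x))" "\<And>u v. t'' u v = t'' v u"
      "\<And>v. v \<in> tangent_space M x \<Longrightarrow> v d = t' (cmap c x) (v c)"
      by (rule transition_derivatives[OF c d]) blast
    have "cmap c x \<in> cmap c ` (cdom c \<inter> cdom d)" using c d by (auto simp: charts_at_iff)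
    note f = frechet_derivative_eqI[OF t(1)[OF this]]
    show ?thesis
      using c d local_rep_transition_derivative[OF \<eta> c d t(1,2), of "\<xi> x c"]
        local_rep_transition_derivative[OF \<xi> c d t(1,2), of "\<eta> x c"]
        t(3)[of "\<xi> x c" "\<eta> x c"] t(4)[OF differentiable_field_in[OF \<xi>]] t(4)[OF differentiable_field_in[OF \<eta>]]
      unfolding f by (simp add: lie_bracket_def blinfun.bilinear_simps)
  qed
  moreover have "lie_bracket M \<xi> \<eta> x c = 0" if "c \<notin> charts_at M x" for c
    using that by (simp add: lie_bracket_def)
  ultimately show ?thesis unfolding tangent_space_def by blast
qed

section \<open>Torsion and curvature in charts\<close>

definition christoffel_derivative :: "('m, 'e) chart \<Rightarrow> 'e \<Rightarrow> 'e \<Rightarrow>\<^sub>L 'e \<Rightarrow>\<^sub>L 'e \<Rightarrow>\<^sub>L 'e" where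
  "christoffel_derivative c = (SOME \<beta>' :: 'e \<Rightarrow> 'e \<Rightarrow>\<^sub>L 'e \<Rightarrow>\<^sub>L 'e \<Rightarrow>\<^sub>L 'e. smooth_on (cmap c ` cdom c) \<beta>' \<and>
     (\<forall>y\<in>cmap c ` cdom c. (christoffel c has_derivative blinfun_apply (\<beta>' y)) (at y)))"

lemma christoffel_derivative:
  assumes "c \<in> M"
  shows "smooth_on (cmap c ` cdom c) (christoffel_derivative c)"
    and "\<And>y. y \<in> cmap c ` cdom c \<Longrightarrow> (christoffel c
        has_derivative blinfun_apply (christoffel_derivative c y)) (at y)"
proof -
  have "\<exists>\<beta>' :: 'e \<Rightarrow> 'e \<Rightarrow>\<^sub>L 'e \<Rightarrow>\<^sub>L 'e \<Rightarrow>\<^sub>L 'e. smooth_on (cmap c ` cdom c) \<beta>' \<and>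
     (\<forall>y\<in>cmap c ` cdom c. (christoffel c has_derivative blinfun_apply (\<beta>' y)) (at y))"
    by (rule smooth_on_blinfun_derivative[OF christoffel(1)[OF assms]]) blast
  from someI_ex[OF this] show "smooth_on (cmap c ` cdom c) (christoffel_derivative c)"
    "\<And>y. y \<in> cmap c ` cdom c \<Longrightarrow> (christoffel c
        has_derivative blinfun_apply (christoffel_derivative c y)) (at y)"
    unfolding christoffel_derivative_def by blast+
qed

text \<open>The derivatives of the coordinates cancel against the bracket. What remains depends on
  the values of the fields at \<open>x\<close> only, which makes the torsion a tensor.\<close>

lemma torsion_formula:
  assumes \<xi>: "vector_field M U \<xi>" and \<eta>: "vector_field M U \<eta>" and x: "x \<in> U"
  shows "cov_deriv M B \<xi> \<eta> x - cov_deriv M B \<eta> \<xi> x - lie_bracket M \<xi> \<eta> x =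
    (\<lambda>c. if c \<in> charts_at M x then local_torsion (christoffel c (cmap c x)) (\<xi> x c) (\<eta> x c) else 0)"
proof
  fix c
  note in_T = vector_field_in[OF \<xi> x] vector_field_in[OF \<eta> x]
  show "(cov_deriv M B \<xi> \<eta> x - cov_deriv M B \<eta> \<xi> x - lie_bracket M \<xi> \<eta> x) c =
    (if c \<in> charts_at M x then local_torsion (christoffel c (cmap c x)) (\<xi> x c) (\<eta> x c) else 0)"
  proof (cases "c \<in> charts_at M x")
    case True
    then show ?thesis by (simp add: cov_deriv_def cov_deriv_at_coord in_T lie_bracket_def local_torsion_def)
  next
    case False
    then show ?thesis by (simp add: cov_deriv_def cov_deriv_at_def lie_bracket_def)
  qed
qed

lemma const_field:
  assumes "c \<in> charts_at M x" "v \<in> tangent_space M x"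
  shows "vector_field M (cdom c) (\<lambda>x. coord_vector M c x (v c))" "x \<in> cdom c" "coord_vector M c x (v c) = v"
  using assms vector_field_coord_vector[of c "v c"] tangent_space_eq_coord_vector[OF assms(2,1)] by
      (auto simp: charts_at_iff)

text \<open>Resolves the definite description: the coordinate formula is valid for all extensions of
  the two vectors, and any other candidate is refuted on the extensions with constant coordinates.
  These also show that the value is a tangent vector.\<close>

lemma torsion_eq:
  assumes x: "x \<in> points M" and v: "v \<in> tangent_space M x" and w: "w \<in> tangent_space M x"
  shows "torsion M B x [v, w] = (\<lambda>c. if c \<in> charts_at M x then local_torsion (christoffel c (cmap c x)) (v
      c) (w c) else 0)" (is "_ = ?T")
    and "torsion M B x [v, w] \<in> tangent_space M x"
proof -
  obtain c where c: "c \<in> charts_at M x" using x by (auto simp: points_def charts_at_iff)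
  note fv = const_field[OF c v] and fw = const_field[OF c w]
  show *: "torsion M B x [v, w] = ?T"
    unfolding torsion_def
  proof (rule the_equality)
    show "\<forall>U \<xi> \<eta>. x \<in> U \<longrightarrow> vector_field M U \<xi> \<longrightarrow> vector_field M U \<eta> \<longrightarrow> [\<xi> x, \<eta> x] = [v, w] \<longrightarrow>
      ?T = cov_deriv M B \<xi> \<eta> x - cov_deriv M B \<eta> \<xi> x - lie_bracket M \<xi> \<eta> x"
      using torsion_formula by auto
    fix u assume u: "\<forall>U \<xi> \<eta>. x \<in> U \<longrightarrow> vector_field M U \<xi> \<longrightarrow> vector_field M U \<eta> \<longrightarrow> [\<xi> x, \<eta> x] = [v, w] \<longrightarrow>
      u = cov_deriv M B \<xi> \<eta> x - cov_deriv M B \<eta> \<xi> x - lie_bracket M \<xi> \<eta> x"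
    have "[coord_vector M c x (v c), coord_vector M c x (w c)] = [v, w]" using fv fw by simp
    from u[rule_format, OF fv(2,1) fw(1) this] torsion_formula[OF fv(1) fw(1) fv(2)] show "u = ?T"
      unfolding fv(3) fw(3) by simp
  qed
  have "?T = cov_deriv M B (\<lambda>x. coord_vector M c x (v c)) (\<lambda>x. coord_vector M c x (w c)) x
      - cov_deriv M B (\<lambda>x. coord_vector M c x (w c)) (\<lambda>x. coord_vector M c x (v c)) x
      - lie_bracket M (\<lambda>x. coord_vector M c x (v c)) (\<lambda>x. coord_vector M c x (w c)) x"
    using torsion_formula[OF fv(1) fw(1) fv(2)] unfolding fv(3) fw(3) by simp
  also have "\<dots> \<in> tangent_space M x"
    unfolding cov_deriv_def fv(3) fw(3)
    using vector_field_differentiable[OF fv(1,2)] vector_field_differentiable[OF fw(1,2)]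
    by (intro tangent_space_diff cov_deriv_at_in lie_bracket_in v w)
  finally show "torsion M B x [v, w] \<in> tangent_space M x" unfolding * .
qed

text \<open>Differentiating \<open>d\<zeta>(\<eta>) - B(\<zeta>, \<eta>)\<close> in coordinates once
  more requires two derivatives of \<open>\<zeta>\<close> and one each of \<open>\<eta>\<close> and
  of the connection.\<close>

lemma cov_deriv_local_rep:
  assumes \<eta>: "vector_field M U \<eta>" and \<zeta>: "vector_field M U \<zeta>" and x: "x \<in> U" and c: "c \<in> charts_at M x"
    and z': "\<And>y. y \<in> cmap c ` (U \<inter> cdom c) \<Longrightarrow> (local_rep c \<zeta> has_derivative blinfun_apply (z' y)) (at y)"
    and z'': "(z' has_derivative blinfun_apply z'') (at (cmap c x))"
    and e': "(local_rep c \<eta> has_derivative e') (at (cmap c x))"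
  shows "(local_rep c (cov_deriv M B \<eta> \<zeta>) has_derivative
    (\<lambda>w. z'' w (\<eta> x c) + z' (cmap c x) (e' w) - (christoffel_derivative c (cmap c x) w (\<zeta> x c) (\<eta> x c)
         + christoffel c (cmap c x) (z' (cmap c x) w) (\<eta> x c) + christoffel c (cmap c x) (\<zeta> x c) (e' w))))
             (at (cmap c x))"
proof -
  have mem: "c \<in> M" "x \<in> cdom c" using c by (auto simp: charts_at_iff)
  have U: "open_subset M U" using \<eta> unfolding vector_field_def by blast
  let ?S = "cmap c ` (U \<inter> cdom c)" and ?y = "cmap c x"
  have o: "open ?S" using U mem(1) unfolding open_subset_def by blast
  have p: "?y \<in> ?S" using x mem by blast
  note \<Gamma> = christoffel_derivative(2)[OF mem(1), of ?y]
  have z: "(local_rep c \<zeta> has_derivative blinfun_apply (z' ?y)) (at ?y)" by (rule z'[OF p])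
  note app = bounded_bilinear.FDERIV[OF bounded_bilinear_blinfun_apply]
  have d: "((\<lambda>y. z' y (local_rep c \<eta> y) - christoffel c y (local_rep c \<zeta> y) (local_rep c \<eta> y)) has_derivative
    (\<lambda>w. z' ?y (e' w) + z'' w (local_rep c \<eta> ?y) - (christoffel c ?y (local_rep c \<zeta> ?y) (e' w)
         + (christoffel c ?y (z' ?y w) + christoffel_derivative c ?y w (local_rep c \<zeta> ?y)) (local_rep c \<eta>
             ?y)))) (at ?y)"
    by (rule has_derivative_diff[OF app[OF z'' e'] app[OF app[OF \<Gamma> z] e']]) (use mem in blast)
  have eq: "z' y (local_rep c \<eta> y) - christoffel c y (local_rep c \<zeta> y) (local_rep c \<eta> y)
      = local_rep c (cov_deriv M B \<eta> \<zeta>) y"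
    if y: "y \<in> ?S" for y
  proof -
    obtain q where q: "y = cmap c q" "q \<in> U" "q \<in> cdom c" using y by blast
    have cq: "c \<in> charts_at M q" using q mem by (simp add: charts_at_iff)
    show ?thesis
      using frechet_derivative_eqI[OF z'[OF y]] q mem
      by (simp add: local_rep_def cinv_cmap cov_deriv_def
          cov_deriv_at_coord[where \<eta> = \<zeta>, OF cq vector_field_in[OF \<zeta> q(2)] vector_field_in[OF \<eta> q(2)]]
              local_rep_def[symmetric])
  qed
  have "(local_rep c (cov_deriv M B \<eta> \<zeta>) has_derivative
    (\<lambda>w. z' ?y (e' w) + z'' w (local_rep c \<eta> ?y) - (christoffel c ?y (local_rep c \<zeta> ?y) (e' w)
         + (christoffel c ?y (z' ?y w) + christoffel_derivative c ?y w (local_rep c \<zeta> ?y)) (local_rep c \<eta>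
             ?y)))) (at ?y)"
    by (rule has_derivative_transform_within_open[OF d o p eq])
  then show ?thesis by (simp add: local_rep_at[OF c] blinfun.bilinear_simps algebra_simps)
qed

lemma local_rep_second_derivative:
  assumes \<zeta>: "vector_field M U \<zeta>" and x: "x \<in> U" and c: "c \<in> charts_at M x"
  obtains z' z'' where "\<And>y. y \<in> cmap c ` (U \<inter> cdom c) \<Longrightarrow>
      (local_rep c \<zeta> has_derivative blinfun_apply (z' y)) (at y)"
    "(z' has_derivative blinfun_apply z'') (at (cmap c x))" "\<And>u v. z'' u v = z'' v u"
proof -
  have mem: "c \<in> M" "x \<in> cdom c" using c by (auto simp: charts_at_iff)
  let ?S = "cmap c ` (U \<inter> cdom c)"
  note s = vector_field_local_rep[OF \<zeta> mem(1)]
  have p: "cmap c x \<in> ?S" using x mem by blast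
  obtain z' where z': "smooth_on ?S z'" "\<And>y. y \<in> ?S \<Longrightarrow>
      (local_rep c \<zeta> has_derivative blinfun_apply (z' y)) (at y)"
    by (rule smooth_on_blinfun_derivative[OF s]) blast
  obtain z'' where z'': "\<And>y. y \<in> ?S \<Longrightarrow> (z' has_derivative blinfun_apply (z'' y)) (at y)"
    by (rule smooth_on_blinfun_derivative[OF z'(1)]) blast
  show ?thesis
    by (rule that[OF z'(2) z''[OF p]]) (auto intro: symmetric_second_derivative[OF smooth_on_open[OF s] p
        z'(2) z''[OF p]])
qed

lemma cov_deriv_differentiable:
  assumes \<eta>: "vector_field M U \<eta>" and \<zeta>: "vector_field M U \<zeta>" and x: "x \<in> U"
  shows "differentiable_field_at U x (cov_deriv M B \<eta> \<zeta>)"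
  unfolding differentiable_field_at_def
proof (intro conjI ballI)
  show "open_subset M U" using \<eta> unfolding vector_field_def by blast
  show "cov_deriv M B \<eta> \<zeta> z \<in> tangent_space M z" if "z \<in> U" for z
    unfolding cov_deriv_def by (rule cov_deriv_at_in[OF vector_field_differentiable[OF \<zeta> that]
        vector_field_in[OF \<eta> that]])
  fix c assume c: "c \<in> charts_at M x"
  obtain z' z'' where z: "\<And>y. y \<in> cmap c ` (U \<inter> cdom c) \<Longrightarrow>
      (local_rep c \<zeta> has_derivative blinfun_apply (z' y)) (at y)"
    "(z' has_derivative blinfun_apply z'') (at (cmap c x))"
    by (rule local_rep_second_derivative[OF \<zeta> x c]) blast
  show "local_rep c (cov_deriv M B \<eta> \<zeta>) differentiable at (cmap c x)"
    unfolding differentiable_def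
    using cov_deriv_local_rep[OF \<eta> \<zeta> x c z local_rep_has_derivative[OF vector_field_differentiable[OF \<eta> x]
        c]] by blast
qed (rule x)

text \<open>Second derivatives of \<open>\<zeta>\<close> cancel by symmetry, first derivatives of
  \<open>\<zeta>\<close> between the two iterated terms, and those of \<open>\<xi>\<close> and
  \<open>\<eta>\<close> against the bracket term. As for the torsion, only the values at
  \<open>x\<close> remain.\<close>

lemma curvature_formula:
  assumes \<xi>: "vector_field M U \<xi>" and \<eta>: "vector_field M U \<eta>" and \<zeta>: "vector_field M U \<zeta>" and x: "x \<in> U"
  shows "cov_deriv M B \<xi> (cov_deriv M B \<eta> \<zeta>) x - cov_deriv M B \<eta> (cov_deriv M B \<xi> \<zeta>) x
      - cov_deriv M B (lie_bracket M \<xi> \<eta>) \<zeta> x =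
    (\<lambda>c. if c \<in> charts_at M x then
       local_curvature (christoffel c (cmap c x)) (christoffel_derivative c (cmap c x)) (\<xi> x c) (\<eta> x c) (\<zeta>
           x c) else 0)" (is "?E = _")
    and "cov_deriv M B \<xi> (cov_deriv M B \<eta> \<zeta>) x - cov_deriv M B \<eta> (cov_deriv M B \<xi> \<zeta>) x
        - cov_deriv M B (lie_bracket M \<xi> \<eta>) \<zeta> x
      \<in> tangent_space M x"
proof -
  note d\<xi> = vector_field_differentiable[OF \<xi> x] and d\<eta> = vector_field_differentiable[OF \<eta> x]
      and d\<zeta> = vector_field_differentiable[OF \<zeta> x]
  note in_\<xi> = vector_field_in[OF \<xi> x] and in_\<eta> = vector_field_in[OF \<eta> x] and in_\<zeta> = vector_field_in[OF \<zeta> x]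
  note d1 = cov_deriv_differentiable[OF \<eta> \<zeta> x] and d2 = cov_deriv_differentiable[OF \<xi> \<zeta> x]
  note lie = lie_bracket_in[OF d\<xi> d\<eta>]
  show "?E \<in> tangent_space M x"
    unfolding cov_deriv_def[of _ _ \<xi> "cov_deriv M B \<eta> \<zeta>"] cov_deriv_def[of _ _ \<eta> "cov_deriv M B \<xi> \<zeta>"]
      cov_deriv_def[of _ _ "lie_bracket M \<xi> \<eta>" \<zeta>]
    by (intro tangent_space_diff cov_deriv_at_in[OF d1 in_\<xi>] cov_deriv_at_in[OF d2 in_\<eta>]
        cov_deriv_at_in[OF d\<zeta> lie])
  show "?E = (\<lambda>c. if c \<in> charts_at M x then
       local_curvature (christoffel c (cmap c x)) (christoffel_derivative c (cmap c x)) (\<xi> x c) (\<eta> x c) (\<zeta>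
           x c) else 0)"
  proof
    fix c
    show "?E c = (if c \<in> charts_at M x then
       local_curvature (christoffel c (cmap c x)) (christoffel_derivative c (cmap c x)) (\<xi> x c) (\<eta> x c) (\<zeta>
           x c) else 0)"
    proof (cases "c \<in> charts_at M x")
      case c: True
      obtain z' z'' where z: "\<And>y. y \<in> cmap c ` (U \<inter> cdom c) \<Longrightarrow>
          (local_rep c \<zeta> has_derivative blinfun_apply (z' y)) (at y)"
        "(z' has_derivative blinfun_apply z'') (at (cmap c x))" "\<And>u v. z'' u v = z'' v u"
        by (rule local_rep_second_derivative[OF \<zeta> x c]) blast
      have "cmap c x \<in> cmap c ` (U \<inter> cdom c)" using x c by (auto simp: charts_at_iff)
      note fz = frechet_derivative_eqI[OF z(1)[OF this]]
      note f1 = frechet_derivative_eqI[OF cov_deriv_local_rep[OF \<eta> \<zeta> x c z(1,2)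
          local_rep_has_derivative[OF d\<eta> c]]]
      note f2 = frechet_derivative_eqI[OF cov_deriv_local_rep[OF \<xi> \<zeta> x c z(1,2)
          local_rep_has_derivative[OF d\<xi> c]]]
      have v1: "cov_deriv M B \<eta> \<zeta> x c = z' (cmap c x) (\<eta> x c) - christoffel c (cmap c x) (\<zeta> x c) (\<eta> x c)"
        unfolding cov_deriv_def cov_deriv_at_coord[where \<eta> = \<zeta>, OF c in_\<zeta> in_\<eta>] fz ..
      have v2: "cov_deriv M B \<xi> \<zeta> x c = z' (cmap c x) (\<xi> x c) - christoffel c (cmap c x) (\<zeta> x c) (\<xi> x c)"
        unfolding cov_deriv_def cov_deriv_at_coord[where \<eta> = \<zeta>, OF c in_\<zeta> in_\<xi>] fz ..
      have 1: "cov_deriv M B \<xi> (cov_deriv M B \<eta> \<zeta>) x c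
          = frechet_derivative (local_rep c (cov_deriv M B \<eta> \<zeta>)) (at (cmap c x)) (\<xi> x c)
          - christoffel c (cmap c x) (cov_deriv M B \<eta> \<zeta> x c) (\<xi> x c)"
        unfolding cov_deriv_def[of _ _ \<xi> "cov_deriv M B \<eta> \<zeta>"]
            by (rule cov_deriv_at_coord[where \<eta>
            = "cov_deriv M B \<eta> \<zeta>", OF c differentiable_field_in[OF d1] in_\<xi>])
      have 2: "cov_deriv M B \<eta> (cov_deriv M B \<xi> \<zeta>) x c
          = frechet_derivative (local_rep c (cov_deriv M B \<xi> \<zeta>)) (at (cmap c x)) (\<eta> x c)
          - christoffel c (cmap c x) (cov_deriv M B \<xi> \<zeta> x c) (\<eta> x c)"
        unfolding cov_deriv_def[of _ _ \<eta> "cov_deriv M B \<xi> \<zeta>"]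
            by (rule cov_deriv_at_coord[where \<eta>
            = "cov_deriv M B \<xi> \<zeta>", OF c differentiable_field_in[OF d2] in_\<eta>])
      have 3: "cov_deriv M B (lie_bracket M \<xi> \<eta>) \<zeta> x c = z' (cmap c x) (lie_bracket M \<xi> \<eta> x c)
          - christoffel c (cmap c x) (\<zeta> x c) (lie_bracket M \<xi> \<eta> x c)"
        unfolding cov_deriv_def cov_deriv_at_coord[where \<eta> = \<zeta>, OF c in_\<zeta> lie] fz ..
      have 4: "lie_bracket M \<xi> \<eta> x c = frechet_derivative (local_rep c \<eta>) (at (cmap c x)) (\<xi> x c)
          - frechet_derivative (local_rep c \<xi>) (at (cmap c x)) (\<eta> x c)" using c by (simp add: lie_bracket_def)
      show ?thesis using c
        by (simp add: 1 2 3 4 v1 v2 f1 f2 z(3)[of "\<eta> x c" "\<xi> x c"] local_curvature_def blinfun.bilinear_simps)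
    next
      case False
      then show ?thesis by (simp add: cov_deriv_def cov_deriv_at_def)
    qed
  qed
qed

lemma curvature_eq:
  assumes x: "x \<in> points M" and v: "v \<in> tangent_space M x" and w: "w \<in> tangent_space M x"
      and u: "u \<in> tangent_space M x"
  shows "curvature M B x [v, w, u] = (\<lambda>c. if c \<in> charts_at M x then
       local_curvature (christoffel c (cmap c x)) (christoffel_derivative c (cmap c x)) (v c) (w c) (u c)
           else 0)" (is "_ = ?T")
    and "curvature M B x [v, w, u] \<in> tangent_space M x"
proof -
  obtain c where c: "c \<in> charts_at M x" using x by (auto simp: points_def charts_at_iff)
  note fv = const_field[OF c v] and fw = const_field[OF c w] and fu = const_field[OF c u]
  show *: "curvature M B x [v, w, u] = ?T"
    unfolding curvature_def
  proof (rule the_equality)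
    show "\<forall>U \<xi> \<eta> \<zeta>. x \<in> U \<longrightarrow> vector_field M U \<xi> \<longrightarrow> vector_field M U \<eta> \<longrightarrow> vector_field M U \<zeta> \<longrightarrow>
        [\<xi> x, \<eta> x, \<zeta> x] = [v, w, u] \<longrightarrow>
      ?T = cov_deriv M B \<xi> (cov_deriv M B \<eta> \<zeta>) x - cov_deriv M B \<eta> (cov_deriv M B \<xi> \<zeta>) x
          - cov_deriv M B (lie_bracket M \<xi> \<eta>) \<zeta> x"
      using curvature_formula(1) by auto
    fix t assume t: "\<forall>U \<xi> \<eta> \<zeta>. x \<in> U \<longrightarrow> vector_field M U \<xi> \<longrightarrow> vector_field M U \<eta> \<longrightarrow> vector_field M U \<zeta> \<longrightarrow>
        [\<xi> x, \<eta> x, \<zeta> x] = [v, w, u] \<longrightarrow>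
      t = cov_deriv M B \<xi> (cov_deriv M B \<eta> \<zeta>) x - cov_deriv M B \<eta> (cov_deriv M B \<xi> \<zeta>) x
          - cov_deriv M B (lie_bracket M \<xi> \<eta>) \<zeta> x"
    have "[coord_vector M c x (v c), coord_vector M c x (w c), coord_vector M c x (u c)] = [v, w, u]"
        using fv fw fu by simp
    from t[rule_format, OF fv(2,1) fw(1) fu(1) this] curvature_formula(1)[OF fv(1) fw(1) fu(1) fv(2)] show
        "t = ?T"
      unfolding fv(3) fw(3) fu(3) by simp
  qed
  show "curvature M B x [v, w, u] \<in> tangent_space M x"
    using curvature_formula[OF fv(1) fw(1) fu(1) fv(2)] unfolding * fv(3) fw(3) fu(3) by simp
qed

section \<open>Parallel torsion and curvature in charts\<close>

lemma cov_deriv_at_const: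
  assumes c: "c \<in> charts_at M x" and v: "v \<in> tangent_space M x"
  shows "cov_deriv_at M B x v (\<lambda>x. coord_vector M c x a) \<in> tangent_space M x"
    and "cov_deriv_at M B x v (\<lambda>x. coord_vector M c x a) c = - christoffel c (cmap c x) a (v c)"
proof -
  have mem: "c \<in> M" "x \<in> cdom c" using c by (auto simp: charts_at_iff)
  note F = vector_field_coord_vector[OF mem(1), of a]
  show "cov_deriv_at M B x v (\<lambda>x. coord_vector M c x a) \<in> tangent_space M x"
    by (rule cov_deriv_at_in[OF vector_field_differentiable[OF F mem(2)] v])
  have "(local_rep c (\<lambda>x. coord_vector M c x a) has_derivative (\<lambda>h. 0)) (at (cmap c x))"
    by (rule has_derivative_transform_within_open[OF has_derivative_const open_image[OF mem(1)]])
      (use mem local_rep_coord_vector in auto)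
  from frechet_derivative_eqI[OF this]
  show "cov_deriv_at M B x v (\<lambda>x. coord_vector M c x a) c = - christoffel c (cmap c x) a (v c)"
    using cov_deriv_at_coord[where \<eta> = "\<lambda>x. coord_vector M c x a", OF c coord_vector_in[OF c] v] by
        (simp add: coord_vector_self[OF c])
qed

text \<open>Parallelism is tested on fields with constant coordinates. For these the covariant
  derivative is minus the connection term, and the coordinates of the tensor are the local
  expressions whose ordinary derivatives are computed directly.\<close>

lemma parallel_locally:
  assumes tor: "parallel_on M B 2 (torsion M B) U" and curv: "parallel_on M B 3 (curvature M B) U"
    and U: "open_subset M U" and c: "c \<in> M"
  obtains \<Gamma>'' where "locally_parallel (cmap c ` (U \<inter> cdom c)) (christoffel c) (christoffel_derivative c) \<Gamma>''"
proof -
  let ?V = "cmap c ` (U \<inter> cdom c)" and ?\<Gamma> = "christoffel c" and ?\<Gamma>' = "christoffel_derivative c"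
  obtain \<Gamma>'' where \<Gamma>'': "\<And>y. y \<in> cmap c ` cdom c \<Longrightarrow> (?\<Gamma>' has_derivative blinfun_apply (\<Gamma>'' y)) (at y)"
    by (rule smooth_on_blinfun_derivative[OF christoffel_derivative(1)[OF c]]) blast
  have oV: "open ?V" using U c unfolding open_subset_def by blast
  have VC: "?V \<subseteq> cmap c ` cdom c" by blast
  define F where "F = (\<lambda>a x. coord_vector M c x a)"
  have F: "vector_field M (cdom c) (F a)" for a unfolding F_def by (rule vector_field_coord_vector[OF c])
  show ?thesis
  proof (rule that, unfold_locales)
    show "smooth_on ?V ?\<Gamma>" by (rule smooth_on_subset[OF christoffel(1)[OF c] oV VC])
    show "smooth_on ?V ?\<Gamma>'" by (rule smooth_on_subset[OF christoffel_derivative(1)[OF c] oV VC])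
    show "(?\<Gamma> has_derivative blinfun_apply (?\<Gamma>' y)) (at y)" if "y \<in> ?V" for y
      using christoffel_derivative(2)[OF c] that by blast
    show "(?\<Gamma>' has_derivative blinfun_apply (\<Gamma>'' y)) (at y)" if "y \<in> ?V" for y
      using \<Gamma>'' that by blast
  next
    fix y p q r assume "y \<in> ?V"
    then obtain x where x: "y = cmap c x" "x \<in> U" "x \<in> cdom c" by blast
    have cx: "c \<in> charts_at M x" and xp: "x \<in> points M" using x c by (auto simp: charts_at_iff points_def)
    let ?v = "coord_vector M c x p"
    have v: "?v \<in> tangent_space M x" "?v c = p" using coord_vector_in[OF cx] coord_vector_self[OF cx] by auto
    have y: "y \<in> cmap c ` cdom c" using x by blast
    note \<Gamma>d = christoffel_derivative(2)[OF c y]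
    have FT: "F a z \<in> tangent_space M z" "F a z c = a" if "z \<in> cdom c" for a z
      unfolding F_def using that c by (auto intro!: coord_vector_in coord_vector_self simp: charts_at_iff)
    let ?D = "\<lambda>a. cov_deriv_at M B x ?v (F a)"
    have D: "?D a \<in> tangent_space M x" "?D a c = - ?\<Gamma> y a p" for a
      using cov_deriv_at_const[OF cx v(1), of a] v(2) unfolding F_def x(1) by auto
    note app = has_derivative_blinfun_apply_const
    {
      have "cov_deriv_tensor M B (torsion M B) x ?v [F q, F r] = 0"
        using tor x v(1) F unfolding parallel_on_def by (auto simp: numeral_2_eq_2)
      then have "cov_deriv_tensor M B (torsion M B) x ?v [F q, F r] c = 0" by simp
      then have 0: "cov_deriv_at M B x ?v (\<lambda>y. torsion M B y [F q y, F r y]) c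
          - (torsion M B x [?D q, F r x] c + torsion M B x [F q x, ?D r] c) = 0"
        by (simp add: cov_deriv_tensor_def lessThan_Suc numeral_2_eq_2 add.commute)
      have rep: "local_rep c (\<lambda>y. torsion M B y [F q y, F r y]) z = local_torsion (?\<Gamma> z) q r"
          if z: "z \<in> cmap c ` cdom c" for z
      proof -
        obtain t where t: "z = cmap c t" "t \<in> cdom c" using z by blast
        have ct: "c \<in> charts_at M t" "t \<in> points M" using t c by (auto simp: charts_at_iff points_def)
        show ?thesis using ct t by (simp add: local_rep_at torsion_eq(1) FT)
      qed
      have "((\<lambda>z. local_torsion (?\<Gamma> z) q r) has_derivative (\<lambda>h. local_torsion (?\<Gamma>' y h) q r)) (at y)"
        unfolding local_torsion_def by (intro has_derivative_diff app \<Gamma>d)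
      then have "(local_rep c (\<lambda>y. torsion M B y [F q y, F r y])
          has_derivative (\<lambda>h. local_torsion (?\<Gamma>' y h) q r)) (at y)"
        by (rule has_derivative_transform_within_open[OF _ open_image[OF c] y]) (simp add: rep)
      note f = frechet_derivative_eqI[OF this]
      have "cov_deriv_at M B x ?v (\<lambda>y. torsion M B y [F q y, F r y]) c
          = local_torsion (?\<Gamma>' y p) q r - ?\<Gamma> y (local_torsion (?\<Gamma> y) q r) p"
        using cov_deriv_at_coord[where \<eta> = "\<lambda>y. torsion M B y [F q y, F r y]", OF cx torsion_eq(2)[OF xp
            FT(1)[OF x(3), of q] FT(1)[OF x(3), of r]] v(1)] f
        by (simp add: x(1)[symmetric] v(2) torsion_eq(1)[OF xp FT(1)[OF x(3), of q] FT(1)[OF x(3), of r]]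
            cx FT(2)[OF x(3)])
      with 0 show "local_torsion (?\<Gamma>' y p) q r = ?\<Gamma> y (local_torsion (?\<Gamma> y) q r) p
          - local_torsion (?\<Gamma> y) (?\<Gamma> y q p) r - local_torsion (?\<Gamma> y) q (?\<Gamma> y r p)"
        using FT[OF x(3)]
        by (simp add: torsion_eq(1)[OF xp] cx D x(1)[symmetric] local_torsion_def blinfun.bilinear_simps
            algebra_simps)
    }
    {
      fix s
      have "cov_deriv_tensor M B (curvature M B) x ?v [F q, F r, F s] = 0"
        using curv x v(1) F unfolding parallel_on_def by (auto simp: numeral_3_eq_3)
      then have "cov_deriv_tensor M B (curvature M B) x ?v [F q, F r, F s] c = 0" by simp
      then have 0: "cov_deriv_at M B x ?v (\<lambda>y. curvature M B y [F q y, F r y, F s y]) c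
          - (curvature M B x [?D q, F r x, F s x] c + curvature M B x [F q x, ?D r, F s x] c
              + curvature M B x [F q x, F r x, ?D s] c) = 0"
        by (simp add: cov_deriv_tensor_def lessThan_Suc numeral_3_eq_3 ac_simps)
      have rep: "local_rep c (\<lambda>y. curvature M B y [F q y, F r y, F s y]) z
          = local_curvature (?\<Gamma> z) (?\<Gamma>' z) q r s" if z: "z \<in> cmap c ` cdom c" for z
      proof -
        obtain t where t: "z = cmap c t" "t \<in> cdom c" using z by blast
        have ct: "c \<in> charts_at M t" "t \<in> points M" using t c by (auto simp: charts_at_iff points_def)
        show ?thesis using ct t by (simp add: local_rep_at curvature_eq(1) FT)
      qed
      note fd = bounded_bilinear.FDERIV[OF bounded_bilinear_blinfun_apply]
      have "((\<lambda>z. local_curvature (?\<Gamma> z) (?\<Gamma>' z) q r s) has_derivative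
          (\<lambda>h. local_curvature_derivative (?\<Gamma> y) (?\<Gamma>' y) (\<Gamma>'' y h) (?\<Gamma>' y h) q r s)) (at y)"
        unfolding local_curvature_def local_curvature_derivative_def
        by (rule has_derivative_eq_rhs[OF has_derivative_diff[OF has_derivative_add[OF has_derivative_diff[OF
              app[OF app[OF app[OF \<Gamma>''[OF y]]]] app[OF app[OF app[OF \<Gamma>''[OF y]]]]]
              fd[OF fd[OF \<Gamma>d app[OF app[OF \<Gamma>d]]] has_derivative_const]] fd[OF fd[OF \<Gamma>d app[OF app[OF \<Gamma>d]]]
                  has_derivative_const]]])
          (simp add: blinfun.bilinear_simps algebra_simps)
      then have "(local_rep c (\<lambda>y. curvature M B y [F q y, F r y, F s y]) has_derivative
          (\<lambda>h. local_curvature_derivative (?\<Gamma> y) (?\<Gamma>' y) (\<Gamma>'' y h) (?\<Gamma>' y h) q r s)) (at y)"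
        by (rule has_derivative_transform_within_open[OF _ open_image[OF c] y]) (simp add: rep)
      note f = frechet_derivative_eqI[OF this]
      note ce = curvature_eq[OF xp FT(1)[OF x(3), of q] FT(1)[OF x(3), of r] FT(1)[OF x(3), of s]]
      have "cov_deriv_at M B x ?v (\<lambda>y. curvature M B y [F q y, F r y, F s y]) c
          = local_curvature_derivative (?\<Gamma> y) (?\<Gamma>' y) (\<Gamma>'' y p) (?\<Gamma>' y p) q r s
              - ?\<Gamma> y (local_curvature (?\<Gamma> y) (?\<Gamma>' y) q r s) p"
        using cov_deriv_at_coord[where \<eta> = "\<lambda>y. curvature M B y [F q y, F r y, F s y]", OF cx ce(2) v(1)] f
        by (simp add: x(1)[symmetric] v(2) ce(1) cx FT(2)[OF x(3)])
      with 0 show "local_curvature_derivative (?\<Gamma> y) (?\<Gamma>' y) (\<Gamma>'' y p) (?\<Gamma>' y p) q r s =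
          ?\<Gamma> y (local_curvature (?\<Gamma> y) (?\<Gamma>' y) q r s) p - local_curvature (?\<Gamma> y) (?\<Gamma>' y) (?\<Gamma> y q p) r s
          - local_curvature (?\<Gamma> y) (?\<Gamma>' y) q (?\<Gamma> y r p) s - local_curvature (?\<Gamma> y) (?\<Gamma>' y) q r (?\<Gamma> y s p)"
        using FT[OF x(3)]
        by (simp add: curvature_eq(1)[OF xp] cx D x(1)[symmetric] local_curvature_def
            blinfun.bilinear_simps algebra_simps)
    }
  qed
qed

end

section \<open>Passage between charts and manifolds\<close>

lemma (in banach_atlas) coord_vector_add:
  assumes "c \<in> charts_at M x"
  shows "coord_vector M c x (a + b) = coord_vector M c x a + coord_vector M c x b"
  using linear_add[OF has_derivative_linear[OF transition_has_derivative[OF assms]]]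
  by (auto simp: coord_vector_def fun_eq_iff)

lemma (in banach_atlas) coord_vector_scaleR:
  assumes "c \<in> charts_at M x"
  shows "coord_vector M c x (r *\<^sub>R a) = (\<lambda>d. r *\<^sub>R coord_vector M c x a d)"
  using linear_scale[OF has_derivative_linear[OF transition_has_derivative[OF assms]]]
  by (auto simp: coord_vector_def fun_eq_iff)

lemma bounded_linear_in_coordinates:
  assumes M: "banach_manifold M" and A: "tangent_continuous_linear M x N y A"
    and c: "c \<in> charts_at M x" and d: "d \<in> charts_at N y"
  shows "bounded_linear (\<lambda>a. A (coord_vector M c x a) d)"
proof -
  interpret banach_atlas M by (rule banach_atlas.intro[OF M])
  note in_T = coord_vector_in[OF c]
  obtain K where K: "\<And>v. v \<in> tangent_space M x \<Longrightarrow> norm (A v d) \<le> K * norm (v c)"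
    using A c d unfolding tangent_continuous_linear_def by blast
  show ?thesis
  proof (rule bounded_linear_intro[of _ K])
    fix a b
    have "A (coord_vector M c x a + coord_vector M c x b)
        = A (coord_vector M c x a) + A (coord_vector M c x b)"
      using A in_T unfolding tangent_continuous_linear_def by blast
    then show "A (coord_vector M c x (a + b)) d = A (coord_vector M c x a) d + A (coord_vector M c x b) d"
      by (simp add: coord_vector_add[OF c])
  next
    fix r a
    have "A (\<lambda>d. r *\<^sub>R coord_vector M c x a d) = (\<lambda>d. r *\<^sub>R A (coord_vector M c x a) d)"
      using A in_T unfolding tangent_continuous_linear_def by blast
    then show "A (coord_vector M c x (r *\<^sub>R a)) d = r *\<^sub>R A (coord_vector M c x a) d"
      by (simp add: coord_vector_scaleR[OF c])
  next
    show "norm (A (coord_vector M c x a) d) \<le> norm a * K" for a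
      using K[OF in_T, of a] by (simp add: coord_vector_self[OF c] mult.commute)
  qed
qed

text \<open>Smoothness must be checked in all pairs of charts, not just in \<open>c1\<close> and
  \<open>c2\<close>; the other representatives are obtained by composing with chart changes on both
  sides.\<close>

lemma smooth_map_from_charts:
  assumes M: "banach_manifold M" and N: "banach_manifold N" and c1: "c1 \<in> M" and c2: "c2 \<in> N"
    and f: "smooth_on V f" and V: "V \<subseteq> cmap c1 ` cdom c1" and fV: "f ` V \<subseteq> cmap c2 ` cdom c2"
  shows "smooth_map M N {x \<in> cdom c1. cmap c1 x \<in> V} (\<lambda>x. cinv c2 (f (cmap c1 x)))"
proof -
  interpret M: banach_atlas M by (rule banach_atlas.intro[OF M])
  interpret N: banach_atlas N by (rule banach_atlas.intro[OF N])
  let ?W = "{x \<in> cdom c1. cmap c1 x \<in> V}" and ?F = "\<lambda>x. cinv c2 (f (cmap c1 x))"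
  have oV: "open V" by (rule smooth_on_open[OF f])
  have preimage: "open (cmap c ` (cdom c \<inter> cdom c1) \<inter> (cmap c1 \<circ> cinv c) -` G)" if "c \<in> M" "open G" for c G
    using continuous_open_preimage[OF smooth_on_continuous_on[OF M.smooth_transition[OF that(1) c1]]
        M.open_overlap[OF that(1) c1] that(2)] .
  have "open_subset M ?W" unfolding open_subset_def
  proof (intro conjI ballI)
    show "?W \<subseteq> points M" using c1 by (auto simp: points_def)
    fix c assume c: "c \<in> M"
    have "cmap c ` (?W \<inter> cdom c) = cmap c ` (cdom c \<inter> cdom c1) \<inter> (cmap c1 \<circ> cinv c) -` V"
      using c by (auto simp: M.cinv_cmap)
    then show "open (cmap c ` (?W \<inter> cdom c))" using preimage[OF c oV] by simp
  qed
  moreover have F: "?F x \<in> cdom c2" "cmap c2 (?F x) = f (cmap c1 x)" if "x \<in> ?W" for x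
    using that fV by (auto intro!: cinv_in_cdom cmap_cinv)
  then have "?F ` ?W \<subseteq> points N" using c2 by (auto simp: points_def)
  moreover have "smooth_on (cmap c ` {x \<in> ?W \<inter> cdom c. ?F x \<in> cdom d}) (cmap d \<circ> ?F \<circ> cinv c)"
      if c: "c \<in> M" and d: "d \<in> N" for c d
  proof -
    let ?\<tau> = "cmap c1 \<circ> cinv c" and ?O = "cmap c2 ` (cdom c2 \<inter> cdom d)"
    \<comment> \<open>The set on which the representative lives, as a preimage under continuous
      maps; its openness is part of smoothness.\<close>
    let ?G = "V \<inter> f -` ?O"
    let ?S = "cmap c ` (cdom c \<inter> cdom c1) \<inter> ?\<tau> -` ?G"
    have oG: "open ?G" by (rule continuous_open_preimage[OF smooth_on_continuous_on[OF f] oV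
        N.open_overlap[OF c2 d]])
    have oS: "open ?S" by (rule preimage[OF c oG])
    have im: "cmap c ` {x \<in> ?W \<inter> cdom c. ?F x \<in> cdom d} = ?S"
    proof (intro equalityI subsetI)
      fix y assume "y \<in> cmap c ` {x \<in> ?W \<inter> cdom c. ?F x \<in> cdom d}"
      then obtain x where x: "y = cmap c x" "x \<in> ?W" "x \<in> cdom c" "?F x \<in> cdom d" by blast
      have "f (cmap c1 x) \<in> ?O" using F[OF x(2)] x(4) by (metis IntI imageI)
      then show "y \<in> ?S" using x c by (auto simp: M.cinv_cmap)
    next
      fix y assume y: "y \<in> ?S"
      then obtain x where x: "y = cmap c x" "x \<in> cdom c" "x \<in> cdom c1" by blast
      have *: "cmap c1 x \<in> V" "f (cmap c1 x) \<in> ?O" using y x c by (auto simp: M.cinv_cmap)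
      then have "?F x \<in> cdom d" using c2 by (auto simp: N.cinv_cmap)
      then show "y \<in> cmap c ` {x \<in> ?W \<inter> cdom c. ?F x \<in> cdom d}" using x * by blast
    qed
    have \<tau>: "smooth_on ?S ?\<tau>" by (rule smooth_on_subset[OF M.smooth_transition[OF c c1] oS]) blast
    have 1: "smooth_on ?S (\<lambda>y. f (?\<tau> y))" by (rule smooth_on_compose[OF f \<tau>]) auto
    have 2: "smooth_on ?S (\<lambda>y. (cmap d \<circ> cinv c2) (f (?\<tau> y)))"
      by (rule smooth_on_compose[OF N.smooth_transition[OF c2 d] 1]) auto
    show ?thesis unfolding im by (rule smooth_on_cong[OF 2]) simp
  qed
  ultimately show ?thesis unfolding smooth_map_def by blast
qed

section \<open>The affine map between the manifolds, built from the solution in charts\<close>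

theorem corollary3p9:
  fixes M\<^sub>1 :: "('m, 'e::banach) chart set" and B\<^sub>1 :: "('m, 'e) connection" and b\<^sub>1 :: 'm
    and M\<^sub>2 :: "('n, 'f::banach) chart set" and B\<^sub>2 :: "('n, 'f) connection" and b\<^sub>2 :: 'n
    and A :: "('m, 'e) tvec \<Rightarrow> ('n, 'f) tvec"
  assumes "affine_banach_manifold M\<^sub>1 B\<^sub>1" and "b\<^sub>1 \<in> points M\<^sub>1"
    and "affine_banach_manifold M\<^sub>2 B\<^sub>2" and "b\<^sub>2 \<in> points M\<^sub>2"
    and "open_subset M\<^sub>1 U\<^sub>1" and "b\<^sub>1 \<in> U\<^sub>1"
    and "parallel_on M\<^sub>1 B\<^sub>1 2 (torsion M\<^sub>1 B\<^sub>1) U\<^sub>1"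
    and "parallel_on M\<^sub>1 B\<^sub>1 3 (curvature M\<^sub>1 B\<^sub>1) U\<^sub>1"
    and "open_subset M\<^sub>2 U\<^sub>2" and "b\<^sub>2 \<in> U\<^sub>2"
    and "parallel_on M\<^sub>2 B\<^sub>2 2 (torsion M\<^sub>2 B\<^sub>2) U\<^sub>2"
    and "parallel_on M\<^sub>2 B\<^sub>2 3 (curvature M\<^sub>2 B\<^sub>2) U\<^sub>2"
    and "tangent_continuous_linear M\<^sub>1 b\<^sub>1 M\<^sub>2 b\<^sub>2 A"
    and "\<forall>u\<in>tangent_space M\<^sub>1 b\<^sub>1. \<forall>v\<in>tangent_space M\<^sub>1 b\<^sub>1.
           A (torsion M\<^sub>1 B\<^sub>1 b\<^sub>1 [u, v]) = torsion M\<^sub>2 B\<^sub>2 b\<^sub>2 [A u, A v]"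
    and "\<forall>u\<in>tangent_space M\<^sub>1 b\<^sub>1. \<forall>v\<in>tangent_space M\<^sub>1 b\<^sub>1. \<forall>w\<in>tangent_space M\<^sub>1 b\<^sub>1.
           A (curvature M\<^sub>1 B\<^sub>1 b\<^sub>1 [u, v, w]) = curvature M\<^sub>2 B\<^sub>2 b\<^sub>2 [A u, A v, A w]"
  shows "\<exists>W f. open_subset M\<^sub>1 W \<and> b\<^sub>1 \<in> W \<and> affine_map M\<^sub>1 B\<^sub>1 M\<^sub>2 B\<^sub>2 W f \<and>
           (\<forall>v\<in>tangent_space M\<^sub>1 b\<^sub>1. tangent_map M\<^sub>1 M\<^sub>2 f (b\<^sub>1, v) = (b\<^sub>2, A v))"
proof -
  have m1: "banach_manifold M\<^sub>1" and m2: "banach_manifold M\<^sub>2" and a1: "affine_connection M\<^sub>1 B\<^sub>1"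
      and a2: "affine_connection M\<^sub>2 B\<^sub>2"
    using assms(1,3) unfolding affine_banach_manifold_def by blast+
  interpret A1: affine_atlas M\<^sub>1 B\<^sub>1
    by (intro affine_atlas.intro banach_atlas.intro affine_atlas_axioms.intro m1 a1)
  interpret A2: affine_atlas M\<^sub>2 B\<^sub>2
    by (intro affine_atlas.intro banach_atlas.intro affine_atlas_axioms.intro m2 a2)
  interpret T1: banach_atlas "tangent_atlas M\<^sub>1"
      by (rule banach_atlas.intro[OF A1.banach_manifold_tangent_atlas])
  interpret T2: banach_atlas "tangent_atlas M\<^sub>2"
      by (rule banach_atlas.intro[OF A2.banach_manifold_tangent_atlas])
  obtain c1 where c1: "c1 \<in> charts_at M\<^sub>1 b\<^sub>1" using assms(2) by (auto simp: points_def charts_at_iff)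
  obtain c2 where c2: "c2 \<in> charts_at M\<^sub>2 b\<^sub>2" using assms(4) by (auto simp: points_def charts_at_iff)
  have c1M: "c1 \<in> M\<^sub>1" "b\<^sub>1 \<in> cdom c1" and c2M: "c2 \<in> M\<^sub>2" "b\<^sub>2 \<in> cdom c2" using c1 c2 by
      (auto simp: charts_at_iff)
  let ?V1 = "cmap c1 ` (U\<^sub>1 \<inter> cdom c1)" and ?V2 = "cmap c2 ` (U\<^sub>2 \<inter> cdom c2)"
  let ?\<beta>1 = "A1.christoffel c1" and ?\<beta>2 = "A2.christoffel c2"
  let ?\<beta>1' = "A1.christoffel_derivative c1" and ?\<beta>2' = "A2.christoffel_derivative c2"
  obtain \<beta>1'' where P1: "locally_parallel ?V1 ?\<beta>1 ?\<beta>1' \<beta>1''"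
    by (rule A1.parallel_locally[OF assms(7,8,5) c1M(1)])
  obtain \<beta>2'' where P2: "locally_parallel ?V2 ?\<beta>2 ?\<beta>2' \<beta>2''"
    by (rule A2.parallel_locally[OF assms(11,12,9) c2M(1)])
  let ?x0 = "cmap c1 b\<^sub>1" and ?p0 = "cmap c2 b\<^sub>2"
  let ?vec = "coord_vector M\<^sub>1 c1 b\<^sub>1"
  note vec = A1.coord_vector_in[OF c1] A1.coord_vector_self[OF c1]
  have A_in: "A v \<in> tangent_space M\<^sub>2 b\<^sub>2" if "v \<in> tangent_space M\<^sub>1 b\<^sub>1" for v
    using assms(13) that unfolding tangent_continuous_linear_def by blast
  \<comment> \<open>The coordinate form of \<open>A\<close>, used as initial value for the
    derivative; the fact \<open>\<Lambda>'\<close> below translates back to arbitrary tangent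
    vectors.\<close>
  define \<Lambda> where "\<Lambda> = Blinfun (\<lambda>a. A (?vec a) c2)"
  have \<Lambda>: "blinfun_apply \<Lambda> a = A (?vec a) c2" for a
    unfolding \<Lambda>_def using bounded_linear_in_coordinates[OF m1 assms(13) c1 c2] by
        (simp add: bounded_linear_Blinfun_apply)
  have \<Lambda>': "blinfun_apply \<Lambda> (v c1) = A v c2" if "v \<in> tangent_space M\<^sub>1 b\<^sub>1" for v
    using A1.tangent_space_eq_coord_vector[OF that c1] \<Lambda>[of "v c1"] by simp
  have tor0: "blinfun_apply \<Lambda> (local_torsion (?\<beta>1 ?x0) a b)
      = local_torsion (?\<beta>2 ?p0) (blinfun_apply \<Lambda> a) (blinfun_apply \<Lambda> b)" for a b
  proof -
    note t1 = A1.torsion_eq[OF assms(2) vec(1)[of a] vec(1)[of b]]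
    have "A (torsion M\<^sub>1 B\<^sub>1 b\<^sub>1 [?vec a, ?vec b]) = torsion M\<^sub>2 B\<^sub>2 b\<^sub>2 [A (?vec a), A (?vec b)]"
      using assms(14) vec(1) by blast
    moreover have "torsion M\<^sub>2 B\<^sub>2 b\<^sub>2 [A (?vec a), A (?vec b)] c2
        = local_torsion (?\<beta>2 ?p0) (blinfun_apply \<Lambda> a) (blinfun_apply \<Lambda> b)"
      using A2.torsion_eq(1)[OF assms(4) A_in[OF vec(1)] A_in[OF vec(1)]] c2 by (simp add: \<Lambda>)
    moreover have "torsion M\<^sub>1 B\<^sub>1 b\<^sub>1 [?vec a, ?vec b] c1 = local_torsion (?\<beta>1 ?x0) a b"
      using t1(1) c1 by (simp add: vec(2))
    ultimately show ?thesis using \<Lambda>'[OF t1(2)] by simp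
  qed
  have curv0: "blinfun_apply \<Lambda> (local_curvature (?\<beta>1 ?x0) (?\<beta>1' ?x0) a b c) =
      local_curvature (?\<beta>2 ?p0) (?\<beta>2' ?p0) (blinfun_apply \<Lambda> a) (blinfun_apply \<Lambda> b) (blinfun_apply \<Lambda> c)"
          for a b c
  proof -
    note t1 = A1.curvature_eq[OF assms(2) vec(1)[of a] vec(1)[of b] vec(1)[of c]]
    have "A (curvature M\<^sub>1 B\<^sub>1 b\<^sub>1 [?vec a, ?vec b, ?vec c])
        = curvature M\<^sub>2 B\<^sub>2 b\<^sub>2 [A (?vec a), A (?vec b), A (?vec c)]"
      using assms(15) vec(1) by blast
    moreover have "curvature M\<^sub>2 B\<^sub>2 b\<^sub>2 [A (?vec a), A (?vec b), A (?vec c)] c2 =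
        local_curvature (?\<beta>2 ?p0) (?\<beta>2' ?p0) (blinfun_apply \<Lambda> a) (blinfun_apply \<Lambda> b) (blinfun_apply \<Lambda> c)"
      using A2.curvature_eq(1)[OF assms(4) A_in[OF vec(1)] A_in[OF vec(1)] A_in[OF vec(1)]] c2 by
          (simp add: \<Lambda>)
    moreover have "curvature M\<^sub>1 B\<^sub>1 b\<^sub>1 [?vec a, ?vec b, ?vec c] c1
        = local_curvature (?\<beta>1 ?x0) (?\<beta>1' ?x0) a b c"
      using t1(1) c1 by (simp add: vec(2))
    ultimately show ?thesis using \<Lambda>'[OF t1(2)] by simp
  qed
  obtain r f L where r: "0 < r" "ball ?x0 r \<subseteq> ?V1" and f_V2: "f ` ball ?x0 r \<subseteq> ?V2" and f0: "f ?x0 = ?p0"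
      and L0: "L ?x0 = \<Lambda>"
    and fs: "smooth_on (ball ?x0 r) f"
    and fd: "\<And>x. x \<in> ball ?x0 r \<Longrightarrow> (f has_derivative blinfun_apply (L x)) (at x)"
    and Ld: "\<And>x. x \<in> ball ?x0 r \<Longrightarrow> \<exists>L'. (L has_derivative blinfun_apply L') (at x) \<and>
       (\<forall>u v. blinfun_apply (blinfun_apply L' v) u =
          blinfun_apply (blinfun_apply (?\<beta>2 (f x)) (blinfun_apply (L x) u)) (blinfun_apply (L x) v)
          - blinfun_apply (L x) (blinfun_apply (blinfun_apply (?\<beta>1 x) u) v))"
  proof (rule local_affine_map[OF P1 P2 _ _ tor0 curv0])
    show "?x0 \<in> ?V1" "?p0 \<in> ?V2" using assms(6,10) c1M c2M by blast+
  qed (rule that)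
  define W where "W = {x \<in> cdom c1. cmap c1 x \<in> ball ?x0 r}"
  define F where "F = (\<lambda>x. cinv c2 (f (cmap c1 x)))"
  have V: "ball ?x0 r \<subseteq> cmap c1 ` cdom c1" and fV: "f ` ball ?x0 r \<subseteq> cmap c2 ` cdom c2" using r(2) f_V2
      by blast+
  have sF: "smooth_map M\<^sub>1 M\<^sub>2 W F" unfolding W_def F_def
      by (rule smooth_map_from_charts[OF m1 m2 c1M(1) c2M(1) fs V fV])
  have F: "F x \<in> cdom c2" "cmap c2 (F x) = f (cmap c1 x)" if "x \<in> W" for x
    using that fV unfolding W_def F_def by (auto intro!: cinv_in_cdom cmap_cinv)
  have rep: "(cmap c2 \<circ> F \<circ> cinv c1) y = f y" if "y \<in> ball ?x0 r" for y
  proof -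
    from V that obtain x where x: "y = cmap c1 x" "x \<in> cdom c1" by blast
    then have "x \<in> W" using that unfolding W_def by simp
    then show ?thesis using F(2) x c1M by (simp add: A1.cinv_cmap)
  qed
  have rep_d: "frechet_derivative (cmap c2 \<circ> F \<circ> cinv c1) (at y) = blinfun_apply (L y)"
      if y: "y \<in> ball ?x0 r" for y
  proof -
    have "frechet_derivative (cmap c2 \<circ> F \<circ> cinv c1) (at y) = frechet_derivative f (at y)"
      by (rule frechet_derivative_cong_open[OF open_ball y]) (rule rep)
    then show ?thesis by (simp add: frechet_derivative_eqI[OF fd[OF y]])
  qed
  have charts: "c1 \<in> charts_at M\<^sub>1 x" "c2 \<in> charts_at M\<^sub>2 (F x)" "cmap c1 x \<in> ball ?x0 r" "x \<in> points M\<^sub>1"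
      "F x \<in> points M\<^sub>2" if "x \<in> W" for x
    using that F(1)[OF that] c1M c2M unfolding W_def by (auto simp: charts_at_iff points_def)
  have TF: "tangent_at M\<^sub>1 M\<^sub>2 F x v c2 = blinfun_apply (L (cmap c1 x)) (v c1)"
    "tangent_at M\<^sub>1 M\<^sub>2 F x v \<in> tangent_space M\<^sub>2 (F x)" if x: "x \<in> W" and v: "v \<in> tangent_space M\<^sub>1 x"
        for x v
    using A1.tangent_at_eq[OF sF x charts(1,2)[OF x] v] rep_d[OF charts(3)[OF x]] A1.tangent_at_in[OF m2
        sF x v] by simp_all
  have b1W: "b\<^sub>1 \<in> W" using c1M r(1) unfolding W_def by simp
  have Fb: "F b\<^sub>1 = b\<^sub>2" unfolding F_def f0 using c2M by (simp add: A2.cinv_cmap)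
  have "affine_map M\<^sub>1 B\<^sub>1 M\<^sub>2 B\<^sub>2 W F"
    unfolding affine_map_def
  proof (intro conjI sF ballI, clarify)
    fix x v w assume xvw: "(x, v, w) \<in> whitney_sum M\<^sub>1" and x: "x \<in> W"
    have v: "v \<in> tangent_space M\<^sub>1 x" and w: "w \<in> tangent_space M\<^sub>1 x" using xvw by
        (auto simp: whitney_sum_def)
    note ch = charts[OF x]
    let ?y = "cmap c1 x" and ?TF = "tangent_map M\<^sub>1 M\<^sub>2 F" and ?W = "{u \<in> tangent_bundle M\<^sub>1. fst u \<in> W}"
    let ?v = "tangent_at M\<^sub>1 M\<^sub>2 F x v" and ?w = "tangent_at M\<^sub>1 M\<^sub>2 F x w"
    let ?C1 = "tangent_chart M\<^sub>1 c1" and ?C2 = "tangent_chart M\<^sub>2 c2"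
    define \<tau> where "\<tau> = snd (B\<^sub>1 (x, v, w))"
    have B1: "B\<^sub>1 (x, v, w) = ((x, v), \<tau>)" and \<tau>: "\<tau> \<in> tangent_space (tangent_atlas M\<^sub>1) (x, v)"
      using A1.connection_in[OF ch(4) v w] unfolding \<tau>_def by (auto simp: prod_eq_iff)
    have \<tau>C: "\<tau> ?C1 = (w c1, blinfun_apply (blinfun_apply (?\<beta>1 ?y) (v c1)) (w c1))"
      unfolding \<tau>_def by (rule A1.connection_coord[OF ch(1) v w])
    note sTF = A1.smooth_map_tangent_map[OF m2 sF]
    have xv: "(x, v) \<in> ?W" using ch(4) v x by (simp add: tangent_bundle_def)
    have TFxv: "?TF (x, v) = (F x, ?v)" by (simp add: tangent_map_def)
    have C1: "?C1 \<in> charts_at (tangent_atlas M\<^sub>1) (x, v)" using ch(1) v by (auto simp: tangent_charts_at_iff)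
    have C2: "?C2 \<in> charts_at (tangent_atlas M\<^sub>2) (?TF (x, v))"
      unfolding TFxv using ch(2) TF(2)[OF x v] by (auto simp: tangent_charts_at_iff)
    obtain L' where L': "(L has_derivative blinfun_apply L') (at ?y)"
      "\<And>u v. blinfun_apply (blinfun_apply L' v) u =
          blinfun_apply (blinfun_apply (?\<beta>2 (f ?y)) (blinfun_apply (L ?y) u)) (blinfun_apply (L ?y) v)
          - blinfun_apply (L ?y) (blinfun_apply (blinfun_apply (?\<beta>1 ?y) u) v)"
      using Ld[OF ch(3)] by blast
    \<comment> \<open>In the tangent charts the tangent map of \<open>F\<close> is
      (\<open>f\<close>, derivative of \<open>f\<close>), so its derivative is the second tangent
      map in coordinates, with \<open>L\<close> as first and \<open>L'\<close> as second
      derivative.\<close>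
    have "((cmap ?C2 \<circ> ?TF \<circ> cinv ?C1) has_derivative
        (\<lambda>(w, z). (blinfun_apply (L ?y) w, blinfun_apply (blinfun_apply L' w) (v c1)
            + blinfun_apply (L ?y) z))) (at (?y, v c1))"
    proof (rule has_derivative_transform_within_open[OF tangent_has_derivative[OF open_ball ch(3) fd
        L'(1)] open_Times[OF open_ball open_UNIV]])
      show "(?y, v c1) \<in> ball ?x0 r \<times> UNIV" using ch(3) by simp
      fix p :: "'e \<times> 'e" assume p: "p \<in> ball ?x0 r \<times> UNIV"
      then obtain z a where z: "p = (cmap c1 z, a)" "z \<in> cdom c1" "cmap c1 z \<in> ball ?x0 r" using V by auto
      then have zW: "z \<in> W" unfolding W_def by simp
      have "coord_vector M\<^sub>1 c1 z a \<in> tangent_space M\<^sub>1 z" "coord_vector M\<^sub>1 c1 z a c1 = a"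
        using charts(1)[OF zW] A1.coord_vector_in A1.coord_vector_self by blast+
      then show "(case p of (y, a) \<Rightarrow> (f y, frechet_derivative f (at y) a)) = (cmap ?C2 \<circ> ?TF \<circ> cinv ?C1) p"
        using z c1M F(2)[OF zW] TF(1)[OF zW] frechet_derivative_eqI[OF fd[OF z(3)]]
        by (simp add: A1.cinv_tangent_chart tangent_map_def cmap_tangent_chart)
    qed
    note d = frechet_derivative_eqI[OF this]
    \<comment> \<open>The equation for \<open>L'\<close> contributes
      \<open>- L (\<beta>1 v w)\<close>, which cancels against \<open>L\<close> applied to the last
      coordinate of \<open>B\<^sub>1\<close>; the term with \<open>\<beta>2\<close> that remains is
      the last coordinate of \<open>B\<^sub>2\<close> at the image vectors.\<close>
    have coord: "tangent_at (tangent_atlas M\<^sub>1) (tangent_atlas M\<^sub>2) ?TF (x, v) \<tau> ?C2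
      = (blinfun_apply (L ?y) (w c1), blinfun_apply (blinfun_apply (?\<beta>2 (f ?y)) (blinfun_apply (L ?y) (v
          c1))) (blinfun_apply (L ?y) (w c1)))"
      using T1.tangent_at_eq[OF sTF xv C1 C2 \<tau>] unfolding cmap_tangent_chart d \<tau>C by (simp add: L'(2))
    note B2 = A2.connection_in[OF ch(5) TF(2)[OF x v] TF(2)[OF x w]]
    have "snd (B\<^sub>2 (F x, ?v, ?w)) ?C2 = tangent_at (tangent_atlas M\<^sub>1) (tangent_atlas M\<^sub>2) ?TF (x, v) \<tau> ?C2"
      unfolding coord A2.connection_coord[OF ch(2) TF(2)[OF x v] TF(2)[OF x w]] TF(1)[OF x v] TF(1)[OF x
          w] F(2)[OF x] ..
    \<comment> \<open>Both sides are tangent vectors of the tangent bundle at the same point, so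
      agreement in one chart is enough.\<close>
    then have "snd (B\<^sub>2 (F x, ?v, ?w)) = tangent_at (tangent_atlas M\<^sub>1) (tangent_atlas M\<^sub>2) ?TF (x, v) \<tau>"
      using T1.tangent_at_in[OF A2.banach_manifold_tangent_atlas sTF xv \<tau>] B2(2) C2 unfolding TFxv
      by (intro T2.tangent_space_eqI) auto
    then show "tangent_map (tangent_atlas M\<^sub>1) (tangent_atlas M\<^sub>2) ?TF (B\<^sub>1 (x, v, w)) = B\<^sub>2 (F x, ?v, ?w)"
      using B2(1) unfolding B1 by (simp add: prod_eq_iff tangent_map_def)
  qed
  moreover have "tangent_map M\<^sub>1 M\<^sub>2 F (b\<^sub>1, v) = (b\<^sub>2, A v)" if v: "v \<in> tangent_space M\<^sub>1 b\<^sub>1" for v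
  proof -
    have "tangent_at M\<^sub>1 M\<^sub>2 F b\<^sub>1 v c2 = A v c2" using TF(1)[OF b1W v] \<Lambda>'[OF v] by (simp add: L0)
    then have "tangent_at M\<^sub>1 M\<^sub>2 F b\<^sub>1 v = A v"
      using TF(2)[OF b1W v] A_in[OF v] c2 unfolding Fb by (intro A2.tangent_space_eqI)
    then show ?thesis by (simp add: tangent_map_def Fb)
  qed
  moreover have "open_subset M\<^sub>1 W" using sF unfolding smooth_map_def by blast
  ultimately show ?thesis using b1W by blast
qed

end
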